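(* Clustering Explanation can be solved in $2^{2\min\{s,k\}}\cdot n^{2d}\cdot (dn)^{\mathcal{O}(1)}$ time, where $n=|\mathbf{X}|$ is the number of input points, $d$ the dimension, $k$ the number of clusters and $s$ the number of points allowed to be removed.
   Context: For a finite collection (multiset) $\mathbf{Z}$ of points of $\mathbb{R}^d$, $i\in\{1,\ldots,d\}$ and $\theta\in\mathbb{R}$, ${\sf Cut}_{i,\theta}(\mathbf{Z})=(\mathbf{Z}_1,\mathbf{Z}_2)$ where $\mathbf{Z}_1=\{\mathbf{x}\in\mathbf{Z}:\mathbf{x}[i]\le\theta\}$ and $\mathbf{Z}_2=\{\mathbf{x}\in\mathbf{Z}:\mathbf{x}[i]>\theta\}$. A partition $\{\mathbf{C}_1,\ldots,\mathbf{C}_k\}$ of $\mathbf{Z}$ (parts may be empty) is an explainable $k$-clustering if it arises recursively: for $k=1$ the unique cluster is $\mathbf{Z}$; for $k\ge2$ one chooses $i$, $\theta$, sets $(\mathbf{Z}_1,\mathbf{Z}_2)={\sf Cut}_{i,\theta}(\mathbf{Z})$, chooses integers $k_1,k_2\ge1$ with $k_1+k_2=k$, and takes the union of an explainable $k_1$-clustering of $\mathbf{Z}_1$ and an explainable $k_2$-clustering of $\mathbf{Z}_2$. In the Clustering Explanation problem the input is a $k$-clustering $\{\mathbf{C}_1,\ldots,\mathbf{C}_k\}$ (partition into $k$ parts) of a finite collection $\mathbf{X}\subseteq\mathbb{R}^d$ and a nonnegative integer $s$; the task is to decide whether there is $W\subseteq\mathbf{X}$ with $|W|\le s$ such that $\{\mathbf{C}_1\setminus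 W,\ldots,\mathbf{C}_k\setminus W\}$ is an explainable $k$-clustering (some $\mathbf{C}_i\setminus W$ may be empty). *)

theory Defs
  imports Complex_Main "HOL-Library.Multiset" "HOL-Library.Disjoint_Sets"
begin

section \<open>Explainable clusterings\<close>

text \<open>
  The dimension has to vary inside the statement (a single algorithm handles every \<open>d\<close>), so a point
  of \<open>\<real>\<^sup>d\<close> is a list of \<open>d\<close> reals.  Coordinates are numbered from \<open>0\<close>: coordinate
  \<open>\<^bold>x[i + 1]\<close> is \<open>x ! i\<close>.
\<close>

type_synonym point = "real list"

definition Cut :: "nat \<Rightarrow> real \<Rightarrow> point multiset \<Rightarrow> point multiset \<times> point multiset" where
  "Cut i \<theta> Z = (filter_mset (\<lambda>x. x ! i \<le> \<theta>) Z, filter_mset (\<lambda>x. x ! i > \<theta>) Z)"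

text \<open>
  \<open>explainable d k Z P\<close>: the collection \<open>P\<close> of parts is an explainable \<open>k\<close>-clustering of \<open>Z\<close>.
  As several parts may be empty, \<open>P\<close> is a multiset.
\<close>

inductive explainable ::
    "nat \<Rightarrow> nat \<Rightarrow> point multiset \<Rightarrow> point multiset multiset \<Rightarrow> bool"
  for d :: nat where
  single: "explainable d 1 Z {#Z#}"
| cut: "\<lbrakk>i < d; Cut i \<theta> Z = (Z1, Z2); k1 \<ge> 1; k2 \<ge> 1;
         explainable d k1 Z1 P1; explainable d k2 Z2 P2\<rbrakk>
        \<Longrightarrow> explainable d (k1 + k2) Z (P1 + P2)"

lemma explainable_is_partition:
  "explainable d k Z P \<Longrightarrow> size P = k \<and> \<Sum>\<^sub># P = Z"
proof (induction rule: explainable.induct)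
  case (cut i \<theta> Z Z1 Z2 k1 k2 P1 P2)
  have "filter_mset (\<lambda>x. x ! i \<le> \<theta>) Z + filter_mset (\<lambda>x. x ! i > \<theta>) Z = Z"
    by (induction Z) auto
  with cut show ?case by (auto simp: Cut_def)
qed simp

section \<open>Clustering Explanation\<close>

text \<open>
  The members of the input collection \<open>\<^bold>X\<close> may coincide as points while belonging to different
  clusters, and \<open>W\<close> may contain some copies of a point and not others.  So \<open>\<^bold>X\<close> is given as a list
  \<open>X\<close>; its clusters and its subcollections are sets of positions in that list, and \<open>points X I\<close> is the
  multiset of points standing at the positions in \<open>I\<close>.
\<close>

definition points :: "point list \<Rightarrow> nat set \<Rightarrow> point multiset" where
  "points X I = image_mset (\<lambda>j. X ! j) (mset_set I)"

definition is_clustering :: "point list \<Rightarrow> nat \<Rightarrow> (nat \<Rightarrow> nat set) \<Rightarrow> bool" where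
  "is_clustering X k C \<longleftrightarrow> disjoint_family_on C {..<k} \<and> (\<Union>i<k. C i) = {..<length X}"

definition valid_instance :: "nat \<Rightarrow> point list \<Rightarrow> nat \<Rightarrow> (nat \<Rightarrow> nat set) \<Rightarrow> bool" where
  "valid_instance d X k C \<longleftrightarrow>
     d \<ge> 1 \<and> k \<ge> 1 \<and> (\<forall>x\<in>set X. length x = d) \<and> is_clustering X k C"

definition clustering_explanation ::
    "nat \<Rightarrow> point list \<Rightarrow> nat \<Rightarrow> (nat \<Rightarrow> nat set) \<Rightarrow> nat \<Rightarrow> bool" where
  "clustering_explanation d X k C s \<longleftrightarrow>
     (\<exists>W. W \<subseteq> {..<length X} \<and> card W \<le> s \<and>
          explainable d k (points X ({..<length X} - W))
            (image_mset (\<lambda>i. points X (C i - W)) (mset_set {..<k})))"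

section \<open>The machine model\<close>

text \<open>
  Running times are measured on a unit-cost random access machine, programmed in a structured
  language.  The memory consists of arrays of natural numbers, initially zero except for the input; a
  program mentions only finitely many arrays, so they could be interleaved in a single one.  A
  scalar variable is cell \<open>0\<close> of an array.  The arithmetic operations are addition and truncated
  subtraction.  Multiplication is left out on purpose, since at unit cost it would make
  the machine unrealistically powerful.  Real numbers occur only as the coordinates of the input
  points, and all a program can do with them is to compare two of them; a real RAM and, for
  rational inputs, any machine that compares two input numbers in constant time can
  simulate this with constant overhead.
\<close>

type_synonym name = string
type_synonym store = "name \<Rightarrow> nat \<Rightarrow> nat"
type_synonym coords = "nat \<Rightarrow> nat \<Rightarrow> real"

datatype aexp = Num nat | Cell name aexp | Plus aexp aexp | Minus aexp aexp

datatype bexp =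
    Less aexp aexp
  | CoordLe aexp aexp aexp aexp
  | Not bexp
  | And bexp bexp

datatype com =
    Skip
  | Assign name aexp aexp
  | Seq com com
  | If bexp com com
  | While bexp com

fun aval :: "aexp \<Rightarrow> store \<Rightarrow> nat" where
  "aval (Num c) \<sigma> = c"
| "aval (Cell v e) \<sigma> = \<sigma> v (aval e \<sigma>)"
| "aval (Plus e1 e2) \<sigma> = aval e1 \<sigma> + aval e2 \<sigma>"
| "aval (Minus e1 e2) \<sigma> = aval e1 \<sigma> - aval e2 \<sigma>"

fun bval :: "coords \<Rightarrow> bexp \<Rightarrow> store \<Rightarrow> bool" where
  "bval x (Less e1 e2) \<sigma> \<longleftrightarrow> aval e1 \<sigma> < aval e2 \<sigma>"
| "bval x (CoordLe j i j' i') \<sigma> \<longleftrightarrow>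
     x (aval j \<sigma>) (aval i \<sigma>) \<le> x (aval j' \<sigma>) (aval i' \<sigma>)"
| "bval x (Not b) \<sigma> \<longleftrightarrow> \<not> bval x b \<sigma>"
| "bval x (And b1 b2) \<sigma> \<longleftrightarrow> bval x b1 \<sigma> \<and> bval x b2 \<sigma>"

text \<open>
  \<open>exec x c \<sigma> t \<sigma>'\<close>: on input coordinates \<open>x\<close>, the program \<open>c\<close> started in \<open>\<sigma>\<close> terminates in \<open>\<sigma>'\<close>
  after \<open>t\<close> steps.  Every assignment and every test is one step; the sizes of the expressions in it
  are bounded by a constant depending on the program only.
\<close>

inductive exec :: "coords \<Rightarrow> com \<Rightarrow> store \<Rightarrow> nat \<Rightarrow> store \<Rightarrow> bool"
  for x :: coords where
  Skip: "exec x Skip \<sigma> 1 \<sigma>"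
| Assign: "exec x (Assign v j e) \<sigma> 1 (\<sigma>(v := (\<sigma> v)(aval j \<sigma> := aval e \<sigma>)))"
| Seq: "\<lbrakk>exec x c1 \<sigma> t1 \<sigma>'; exec x c2 \<sigma>' t2 \<sigma>''\<rbrakk> \<Longrightarrow> exec x (Seq c1 c2) \<sigma> (t1 + t2) \<sigma>''"
| IfTrue: "\<lbrakk>bval x b \<sigma>; exec x c1 \<sigma> t \<sigma>'\<rbrakk> \<Longrightarrow> exec x (If b c1 c2) \<sigma> (1 + t) \<sigma>'"
| IfFalse: "\<lbrakk>\<not> bval x b \<sigma>; exec x c2 \<sigma> t \<sigma>'\<rbrakk> \<Longrightarrow> exec x (If b c1 c2) \<sigma> (1 + t) \<sigma>'"
| WhileFalse: "\<not> bval x b \<sigma> \<Longrightarrow> exec x (While b c) \<sigma> 1 \<sigma>"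
| WhileTrue: "\<lbrakk>bval x b \<sigma>; exec x c \<sigma> t1 \<sigma>'; exec x (While b c) \<sigma>' t2 \<sigma>''\<rbrakk>
              \<Longrightarrow> exec x (While b c) \<sigma> (1 + t1 + t2) \<sigma>''"

lemma exec_deterministic:
  "\<lbrakk>exec x c \<sigma> t \<sigma>'; exec x c \<sigma> u \<sigma>''\<rbrakk> \<Longrightarrow> t = u \<and> \<sigma>' = \<sigma>''"
proof (induction arbitrary: u \<sigma>'' rule: exec.induct)
  case Skip
  from Skip.prems show ?case by cases simp
next
  case Assign
  from Assign.prems show ?case by cases simp
next
  case Seq
  from Seq.prems show ?case by cases (auto dest!: Seq.IH)
next
  case IfTrue
  from IfTrue.prems IfTrue.hyps(1) show ?case by cases (auto dest!: IfTrue.IH)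
next
  case IfFalse
  from IfFalse.prems IfFalse.hyps(1) show ?case by cases (auto dest!: IfFalse.IH)
next
  case WhileFalse
  from WhileFalse.prems WhileFalse.hyps show ?case by cases auto
next
  case WhileTrue
  from WhileTrue.prems WhileTrue.hyps(1) show ?case by cases (auto dest!: WhileTrue.IH)
qed

section \<open>Input and output\<close>

definition input_coords :: "nat \<Rightarrow> point list \<Rightarrow> coords" where
  "input_coords d X = (\<lambda>j i. if j < length X \<and> i < d then X ! j ! i else 0)"

definition scalar :: "nat \<Rightarrow> nat \<Rightarrow> nat" where
  "scalar a = (\<lambda>_. 0)(0 := a)"

text \<open>The clustering is passed as the array that gives, for each member of \<open>\<^bold>X\<close>, the index of its cluster.\<close>

definition input_store ::
    "nat \<Rightarrow> point list \<Rightarrow> nat \<Rightarrow> (nat \<Rightarrow> nat set) \<Rightarrow> nat \<Rightarrow> store" where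
  "input_store d X k C s = (\<lambda>_ _. 0)
     (''d'' := scalar d,
      ''n'' := scalar (length X),
      ''k'' := scalar k,
      ''s'' := scalar s,
      ''cluster'' := (\<lambda>j. if j < length X then (THE i. i < k \<and> j \<in> C i) else 0))"

text \<open>The answer is yes iff the scalar \<open>out\<close> is nonzero at the end.\<close>

definition accepting :: "store \<Rightarrow> bool" where
  "accepting \<sigma> \<longleftrightarrow> \<sigma> ''out'' 0 \<noteq> 0"

end

theory Submission
  imports Defs "HOL-Library.Nat_Bijection"
begin

text \<open>
  A dynamic program over point sets \<open>Q = A - D\<close>, where \<open>A\<close> is the set of points in a box and \<open>D\<close> a set
  of clusters that meet both \<open>A\<close> and its complement and are given up inside \<open>A\<close>.  An explainable
  clustering cuts \<open>Q\<close> by a threshold; every cluster with points on both sides must be given up on one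
  of them, and this choice is enumerated.  In a solution removing at most \<open>s\<close> points, the boxes at the
  nodes of the tree separate the surviving parts of the clusters, so each cluster split by such a box
  or by a cut of it contains a removed point: at most \<open>min s k\<close> clusters are split, both for the box
  and for the cut.  This yields the two factors \<open>2 ^ min s k\<close>.  It suffices to consider nonempty closed
  boxes whose bounds are coordinates of input points, and there are at most \<open>n ^ (2 * d)\<close> choices of
  bounds.  Instead of processing the sets by size, the program sweeps \<open>n\<close> times over all of them.
  Empty clusters do not matter, since a cut beyond all points splits off an empty leaf.
\<close>

section \<open>Relaxing a table of point sets\<close>

text \<open>The two halves of correctness differ in nature. Soundness is claimed for every entry at
  every moment, so entries may be written in any order and read when already changed in the same
  pass. Completeness is claimed only relative to one fixed solution \<open>W\<close> and for boxes
  clean for \<open>W\<close>; other boxes may be skipped for being crossed by too many clusters, so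
  the table need not hold optimal values. A pass settles the boxes with one more point, because both
  sides of a proper cut are nonempty; hence \<open>n\<close> passes. The delicate point is that the
  given-up set of a child has again the enumerated shape. A cluster given up at a node has members
  outside its box, hence outside each child; a cluster newly given up in a child has members on the
  other side of the cut. So every set that arises is a box without some clusters crossing its
  border, and the history of cuts need not be stored. Entries are slacks rather than costs: zeros,
  the initial memory, then claim nothing, improvement means growth, and truncated subtraction turns
  excessive cost into 0.\<close>

text \<open>Points are positions below \<open>n\<close>, \<open>cl\<close> is their cluster, and \<open>x j i\<close> is coordinate \<open>i\<close> of point \<open>j\<close>.\<close>

locale coloured_points =
  fixes x :: coords and d n s :: nat and cl :: "nat \<Rightarrow> nat"
begin

text \<open>Leaves are not counted and may be empty, in contrast to \<open>explainable\<close>: this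
  makes the notion hereditary and frees it from \<open>k\<close>. The disjointness in
  \<open>split\<close> forbids a cut to tear a colour apart, which \<open>explainable\<close>
  expresses by the union of the two clusterings.\<close>

inductive expl :: "nat set \<Rightarrow> bool" where
  mono: "(\<And>a b. a \<in> R \<Longrightarrow> b \<in> R \<Longrightarrow> cl a = cl b) \<Longrightarrow> expl R"
| split: "i < d \<Longrightarrow> cl ` {j\<in>R. x j i \<le> \<theta>} \<inter> cl ` {j\<in>R. x j i > \<theta>} = {} \<Longrightarrow>
    expl {j\<in>R. x j i \<le> \<theta>} \<Longrightarrow> expl {j\<in>R. x j i > \<theta>} \<Longrightarrow> expl R"

text \<open>The threshold tree of \<open>R\<close> still works when every node is restricted to
  \<open>R'\<close>.\<close>

lemma expl_subset: "expl R \<Longrightarrow> R' \<subseteq> R \<Longrightarrow> expl R'"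
proof (induction arbitrary: R' rule: expl.induct)
  case (mono R)
  then show ?case by (intro expl.mono) blast
next
  case (split i R \<theta>)
  have "cl ` {j\<in>R'. x j i \<le> \<theta>} \<inter> cl ` {j\<in>R'. x j i > \<theta>} = {}"
    using split.hyps(2) split.prems by blast
  then show ?case using split.hyps(1) split.prems by (intro expl.split[of i R' \<theta>] split.IH) auto
qed

text \<open>Follow the tree through cuts with an empty side to the first proper one; a leaf cannot
  come before it, since two colours are present. Its real threshold is then replaced by a coordinate
  of a point, which leaves finitely many candidates and needs only comparisons of input
  coordinates.\<close>

lemma expl_separating_cut:
  assumes "expl R" "finite R" "a \<in> R" "b \<in> R" "cl a \<noteq> cl b"
  shows "\<exists>i<d. \<exists>t\<in>R. (\<exists>j\<in>R. x j i > x t i) \<and>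
    cl ` {j\<in>R. x j i \<le> x t i} \<inter> cl ` {j\<in>R. x j i > x t i} = {}"
  using assms
proof (induction rule: expl.induct)
  case (split i R \<theta>)
  let ?L = "{j\<in>R. x j i \<le> \<theta>}" and ?G = "{j\<in>R. x j i > \<theta>}"
  consider "?L = {}" | "?G = {}" | "?L \<noteq> {}" "?G \<noteq> {}" by blast
  then show ?case
  proof cases
    case 1
    then have "?G = R" by (auto simp: not_le)
    then show ?thesis using split.IH(2) split.prems by simp
  next
    case 2
    then have "?L = R" by (auto simp: not_less)
    then show ?thesis using split.IH(1) split.prems by simp
  next
    case 3
    \<comment> \<open>The largest coordinate on the low side induces the same cut of
      \<open>R\<close> as \<theta>.\<close>
    have fin: "finite ((\<lambda>j. x j i) ` ?L)" "(\<lambda>j. x j i) ` ?L \<noteq> {}" using split.prems 3 by auto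
    then obtain t where t: "t \<in> ?L" "x t i = Max ((\<lambda>j. x j i) ` ?L)"
      by (smt (verit) Max_in imageE)
    have eq: "x j i \<le> x t i \<longleftrightarrow> x j i \<le> \<theta>" if "j \<in> R" for j
    proof
      assume "x j i \<le> \<theta>"
      then show "x j i \<le> x t i" using that fin t(2) by simp
    qed (use t in auto)
    then have "{j\<in>R. x j i \<le> x t i} = ?L" "{j\<in>R. x j i > x t i} = ?G"
      by (auto simp: not_le[symmetric])
    then have "cl ` {j\<in>R. x j i \<le> x t i} \<inter> cl ` {j\<in>R. x j i > x t i} = {}"
      using split.hyps(2) by simp
    moreover have "\<exists>j\<in>R. x j i > x t i" using 3 t(1) by fastforce
    moreover have "t \<in> R" using t(1) by simp
    ultimately show ?thesis using split.hyps(1) by blast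
  qed
next
  case (mono R)
  then show ?case by blast
qed

section \<open>Candidates for table entries and their soundness\<close>

definition Cross :: "nat set \<Rightarrow> nat set \<Rightarrow> nat set" where
  "Cross U V = cl ` U \<inter> cl ` V"

definition without :: "nat set \<Rightarrow> nat set \<Rightarrow> nat set" where
  "without U D = {j\<in>U. cl j \<notin> D}"

definition low :: "nat set \<Rightarrow> nat \<Rightarrow> nat \<Rightarrow> nat set" where
  "low Q i t = {j\<in>Q. x j i \<le> x t i}"

definition high :: "nat set \<Rightarrow> nat \<Rightarrow> nat \<Rightarrow> nat set" where
  "high Q i t = {j\<in>Q. x j i > x t i}"

text \<open>Of the clusters meeting both sides \<open>U\<close> and \<open>V\<close> of a cut, those in \<open>D\<close> are given up in \<open>U\<close>
  and the others in \<open>V\<close>.\<close>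

definition lost :: "nat set \<Rightarrow> nat set \<Rightarrow> nat set \<Rightarrow> nat" where
  "lost U V D = card {j\<in>U. cl j \<in> D} + card {j\<in>V. cl j \<in> Cross U V - D}"

text \<open>The slack of turning \<open>Q\<close> into a leaf of the colour of \<open>t\<close>;
  truncation gives 0 as soon as more than \<open>s\<close> points have to go.\<close>

definition cand_keep :: "nat set \<Rightarrow> nat \<Rightarrow> nat" where
  "cand_keep Q t = s + 1 - card {j\<in>Q. cl j \<noteq> cl t}"

text \<open>If the sides have slacks \<open>s + 1 - c1\<close> and \<open>s + 1 - c2\<close>, this
  is the slack of the total cost \<open>c1 + c2 + lost U V D\<close>.\<close>

definition cand_cut :: "(nat \<Rightarrow> nat) \<Rightarrow> nat set \<Rightarrow> nat set \<Rightarrow> nat set \<Rightarrow> nat" where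
  "cand_cut tab U V D = tab (set_encode (without U D)) +
     tab (set_encode (without V (Cross U V - D))) - (s + 1 + lost U V D)"

text \<open>A table entry is the slack \<open>s + 1 - c\<close> of a removal of \<open>c\<close> points that makes the set
  explainable; \<open>0\<close> stands for infinite cost.\<close>

definition sound :: "(nat \<Rightarrow> nat) \<Rightarrow> bool" where
  "sound tab \<longleftrightarrow> (\<forall>Q\<subseteq>{..<n}. tab (set_encode Q) \<le> s + 1 \<and> (tab (set_encode Q) > 0 \<longrightarrow>
     (\<exists>W\<subseteq>Q. card W + tab (set_encode Q) \<le> s + 1 \<and> expl (Q - W))))"

text \<open>\<open>set_encode\<close> is injective on finite sets, so a write concerns the entry of
  a single set.\<close>

lemma sound_update:
  assumes "sound tab" "Q \<subseteq> {..<n}" "W \<subseteq> Q" "card W + c \<le> s + 1" "expl (Q - W)"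
  shows "sound (tab(set_encode Q := c))"
proof -
  have "Q' = Q" if "Q' \<subseteq> {..<n}" "set_encode Q' = set_encode Q" for Q'
    using that assms(2) by (metis finite_lessThan finite_subset set_encode_eq)
  then have upd: "(tab(set_encode Q := c)) (set_encode Q') = (if Q' = Q then c else tab (set_encode Q'))"
    if "Q' \<subseteq> {..<n}" for Q' using that by auto
  show ?thesis
    unfolding sound_def
  proof (intro allI impI)
    fix Q' assume Q': "Q' \<subseteq> {..<n}"
    show "(tab(set_encode Q := c)) (set_encode Q') \<le> s + 1 \<and>
      ((tab(set_encode Q := c)) (set_encode Q') > 0 \<longrightarrow>
        (\<exists>W\<subseteq>Q'. card W + (tab(set_encode Q := c)) (set_encode Q') \<le> s + 1 \<and> expl (Q' - W)))"
    proof (cases "Q' = Q")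
      case True
      then show ?thesis unfolding upd[OF Q'] using assms(3-5) by auto
    next
      case False
      then show ?thesis unfolding upd[OF Q'] using assms(1) Q' by (simp add: sound_def)
    qed
  qed
qed

lemma sound_keep:
  assumes "sound tab" "Q \<subseteq> {..<n}" "cand_keep Q t > 0"
  shows "sound (tab(set_encode Q := cand_keep Q t))"
  using assms unfolding cand_keep_def
  by (intro sound_update[where W = "{j\<in>Q. cl j \<noteq> cl t}"] expl.mono) auto

lemma sound_cut:
  assumes "sound tab" "Q \<subseteq> {..<n}" "i < d" "D \<subseteq> Cross (low Q i t) (high Q i t)"
    and pos: "cand_cut tab (low Q i t) (high Q i t) D > 0"
  shows "sound (tab(set_encode Q := cand_cut tab (low Q i t) (high Q i t) D))"
proof -
  let ?U = "low Q i t" and ?V = "high Q i t"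
  let ?E = "Cross ?U ?V"
  let ?A = "without ?U D" and ?B = "without ?V (?E - D)"
  have sub: "?A \<subseteq> {..<n}" "?B \<subseteq> {..<n}"
    using assms(2) by (auto simp: without_def low_def high_def)
  have le: "tab (set_encode ?A) \<le> s + 1" "tab (set_encode ?B) \<le> s + 1"
    using assms(1)[unfolded sound_def, rule_format, OF sub(1)]
      assms(1)[unfolded sound_def, rule_format, OF sub(2)] by simp_all
  \<comment> \<open>Each entry is at most \<open>s + 1\<close>, so a side of value 0 would make the
    candidate 0; this is why \<open>sound\<close> bounds the entries.\<close>
  then have pos12: "tab (set_encode ?A) > 0" "tab (set_encode ?B) > 0"
    using pos unfolding cand_cut_def by linarith+
  obtain W1 where
    W1: "W1 \<subseteq> ?A" "card W1 + tab (set_encode ?A) \<le> s + 1" "expl (?A - W1)"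
    using assms(1)[unfolded sound_def, rule_format, OF sub(1)] pos12(1) by auto
  obtain W2 where
    W2: "W2 \<subseteq> ?B" "card W2 + tab (set_encode ?B) \<le> s + 1" "expl (?B - W2)"
    using assms(1)[unfolded sound_def, rule_format, OF sub(2)] pos12(2) by auto
  let ?L = "{j\<in>?U. cl j \<in> D}" and ?G = "{j\<in>?V. cl j \<in> ?E - D}"
  let ?W = "W1 \<union> W2 \<union> ?L \<union> ?G"
  have "card ?W \<le> card W1 + card W2 + card ?L + card ?G"
    by (meson add_mono card_Un_le le_refl order_trans)
  then have card: "card ?W + cand_cut tab ?U ?V D \<le> s + 1"
    using W1(2) W2(2) pos unfolding cand_cut_def lost_def by linarith
  have lo: "{j\<in>Q - ?W. x j i \<le> x t i} = ?A - W1" and hi: "{j\<in>Q - ?W. x j i > x t i} = ?B - W2"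
    using W1(1) W2(1) by (auto simp: without_def low_def high_def)
  \<comment> \<open>A crossing colour is dropped on one of the sides: on the low one if it is in
    \<open>D\<close>, on the high one otherwise.\<close>
  have "cl a \<noteq> cl b" if a: "a \<in> ?A" and b: "b \<in> ?B" for a b
  proof
    assume eq: "cl a = cl b"
    have "cl a \<in> ?E"
      unfolding Cross_def using a b imageI[of a ?U cl] imageI[of b ?V cl] eq by (simp add: without_def)
    then show False using a b eq by (simp add: without_def)
  qed
  then have disj: "cl ` (?A - W1) \<inter> cl ` (?B - W2) = {}" by auto
  have expl: "expl (Q - ?W)"
    by (rule expl.split[of i _ "x t i"]) (simp_all only: lo hi assms(3) disj W1(3) W2(3))
  have "?W \<subseteq> Q"
    using W1(1) W2(1) by (auto simp: without_def low_def high_def)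
  then show ?thesis by (rule sound_update[OF assms(1,2) _ card expl])
qed

text \<open>\<open>tab0\<close> is the table at the start of a pass, \<open>tab\<close> a later one.
  The program computes candidates from tables in between, which can only make them larger. Cuts
  crossed by more than \<open>s\<close> colours are exempt because the program skips them.\<close>

definition relaxed :: "(nat \<Rightarrow> nat) \<Rightarrow> (nat \<Rightarrow> nat) \<Rightarrow> nat set \<Rightarrow> bool" where
  "relaxed tab0 tab Q \<longleftrightarrow> (\<forall>t<n. cand_keep Q t \<le> tab (set_encode Q)) \<and>
     (\<forall>i<d. \<forall>t<n. card (Cross (low Q i t) (high Q i t)) \<le> s \<longrightarrow>
        (\<forall>D\<subseteq>Cross (low Q i t) (high Q i t).
           cand_cut tab0 (low Q i t) (high Q i t) D \<le> tab (set_encode Q)))"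

section \<open>Point sets cut out by boxes\<close>

definition box_closed :: "nat set \<Rightarrow> bool" where
  "box_closed A \<longleftrightarrow> A \<noteq> {} \<and> A \<subseteq> {..<n} \<and>
     (\<forall>j<n. (\<forall>i<d. \<exists>a\<in>A. \<exists>b\<in>A. x a i \<le> x j i \<and> x j i \<le> x b i) \<longrightarrow> j \<in> A)"

text \<open>The lower bounds are the entries of \<open>f\<close> below \<open>d\<close>, the upper bounds the entries from \<open>d\<close> on.\<close>

definition box :: "(nat \<Rightarrow> nat) \<Rightarrow> nat set" where
  "box f = {j. j < n \<and> (\<forall>i<d. x (f i) i \<le> x j i \<and> x j i \<le> x (f (d + i)) i)}"

text \<open>\<open>box_closed\<close> describes the trace of a bounding box without naming the
  bounds, which suits the passage to the sides of a cut. The bounds reappear here as positions of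
  extreme members, hence as numbers below \<open>n\<close>.\<close>

lemma box_closed_eq_box:
  assumes "box_closed A"
  shows "\<exists>f. (\<forall>q<d + d. f q < n) \<and> box f = A"
proof -
  have A: "A \<noteq> {}" "A \<subseteq> {..<n}" "finite A"
    using assms finite_subset by (auto simp: box_closed_def)
  define lo where "lo i = arg_min_on (\<lambda>j. x j i) A" for i
  \<comment> \<open>A member of greatest coordinate, found as a minimum of the negated
    coordinate.\<close>
  define hi where "hi i = arg_min_on (\<lambda>j. - x j i) A" for i
  have lo: "lo i \<in> A" "\<And>j. j \<in> A \<Longrightarrow> x (lo i) i \<le> x j i" for i
    unfolding lo_def by (rule arg_min_if_finite(1)[OF A(3,1)], rule arg_min_least[OF A(3,1)])
  have hi: "hi i \<in> A" "\<And>j. j \<in> A \<Longrightarrow> x j i \<le> x (hi i) i" for i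
    unfolding hi_def
    by (rule arg_min_if_finite(1)[OF A(3,1)])
      (use arg_min_least[OF A(3,1), of _ "\<lambda>j. - x j i"] in simp)
  let ?f = "\<lambda>q. if q < d then lo q else hi (q - d)"
  have "box ?f = A"
  proof
    show "box ?f \<subseteq> A"
    proof
      fix j assume j: "j \<in> box ?f"
      then have "j < n" by (simp add: box_def)
      moreover have "\<exists>a\<in>A. \<exists>b\<in>A. x a i \<le> x j i \<and> x j i \<le> x b i" if "i < d" for i
        using j that lo(1)[of i] hi(1)[of i] unfolding box_def by auto
      ultimately show "j \<in> A" using assms unfolding box_closed_def by blast
    qed
    show "A \<subseteq> box ?f" using lo(2) hi(2) A(2) unfolding box_def by auto
  qed
  moreover have "?f q < n" for q using lo(1) hi(1) A(2) by auto
  ultimately show ?thesis by (intro exI[of _ ?f]) simp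
qed

text \<open>The bounding box of the low side lies in that of \<open>A\<close>, and in coordinate
  \<open>i\<close> an upper witness from the low side keeps the point below the threshold.\<close>

lemma box_closed_low:
  assumes "box_closed A" "low A i t \<noteq> {}" "i < d"
  shows "box_closed (low A i t)"
  unfolding box_closed_def
proof (intro conjI allI impI)
  fix j assume j: "j < n" "\<forall>i'<d. \<exists>a\<in>low A i t. \<exists>b\<in>low A i t. x a i' \<le> x j i' \<and> x j i' \<le> x b i'"
  have "\<exists>a\<in>A. \<exists>b\<in>A. x a i' \<le> x j i' \<and> x j i' \<le> x b i'" if i': "i' < d" for i'
  proof -
    obtain a b where "a \<in> low A i t" "b \<in> low A i t" "x a i' \<le> x j i'" "x j i' \<le> x b i'"
      using j(2) i' by meson
    then show ?thesis unfolding low_def by auto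
  qed
  then have "j \<in> A" using assms(1) j(1) unfolding box_closed_def by simp
  moreover obtain b where "b \<in> low A i t" "x j i \<le> x b i" using j(2) assms(3) by meson
  then have "x j i \<le> x t i" unfolding low_def by simp
  ultimately show "j \<in> low A i t" unfolding low_def by simp
qed (use assms(1,2) in \<open>auto simp: box_closed_def low_def\<close>)

lemma box_closed_high:
  assumes "box_closed A" "high A i t \<noteq> {}" "i < d"
  shows "box_closed (high A i t)"
  unfolding box_closed_def
proof (intro conjI allI impI)
  fix j assume j: "j < n" "\<forall>i'<d. \<exists>a\<in>high A i t. \<exists>b\<in>high A i t. x a i' \<le> x j i' \<and> x j i' \<le> x b i'"
  have "\<exists>a\<in>A. \<exists>b\<in>A. x a i' \<le> x j i' \<and> x j i' \<le> x b i'" if i': "i' < d" for i'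
  proof -
    obtain a b where "a \<in> high A i t" "b \<in> high A i t" "x a i' \<le> x j i'" "x j i' \<le> x b i'"
      using j(2) i' by meson
    then show ?thesis unfolding high_def by auto
  qed
  then have "j \<in> A" using assms(1) j(1) unfolding box_closed_def by simp
  moreover obtain a where "a \<in> high A i t" "x a i \<le> x j i" using j(2) assms(3) by meson
  then have "x j i > x t i" unfolding high_def by simp
  ultimately show "j \<in> high A i t" unfolding high_def by simp
qed (use assms(1,2) in \<open>auto simp: box_closed_def high_def\<close>)

section \<open>Completeness along a fixed solution\<close>

text \<open>A crossing colour has lost all its members on at least one side, so it is the colour of
  a point of \<open>W\<close>. Hence skipping boxes and cuts crossed by more than \<open>s\<close>
  colours misses no solution within the budget.\<close>

lemma card_Cross_le:
  assumes "W \<subseteq> {..<n}" "U \<subseteq> {..<n}" "V \<subseteq> {..<n}"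
    and "cl ` (U - W) \<inter> cl ` (V - W) = {}"
  shows "card (Cross U V) \<le> card W"
proof -
  have "Cross U V \<subseteq> cl ` W" using assms(4) unfolding Cross_def by blast
  then show ?thesis
    by (meson assms(1) card_image_le card_mono finite_imageI finite_lessThan finite_subset order_trans)
qed

text \<open>A box is clean for a solution \<open>W\<close> if no surviving cluster has members inside and outside;
  the boxes at the nodes of the tree belonging to the solution are clean.\<close>

definition clean :: "nat set \<Rightarrow> nat set \<Rightarrow> bool" where
  "clean W A \<longleftrightarrow> cl ` (A - W) \<inter> cl ` ({..<n} - A - W) = {}"

text \<open>The entry must be at least the slack left by the part of \<open>W\<close> inside the
  set; the additive form avoids truncated subtraction. Only those \<open>D\<close> count whose
  members in \<open>A\<close> are all removed by \<open>W\<close>: they are the choices that imitate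
  the solution.\<close>

definition complete :: "nat set \<Rightarrow> nat \<Rightarrow> (nat \<Rightarrow> nat) \<Rightarrow> bool" where
  "complete W p tab \<longleftrightarrow> (\<forall>A D. box_closed A \<longrightarrow> clean W A \<longrightarrow> card A \<le> p \<longrightarrow>
     D \<subseteq> Cross A ({..<n} - A) \<longrightarrow> D \<inter> cl ` (A - W) = {} \<longrightarrow>
     s + 1 \<le> tab (set_encode (without A D)) + card (W \<inter> without A D))"

text \<open>If \<open>W\<close> leaves at most one colour in \<open>A\<close>, the leaf candidate is
  good enough. Otherwise a proper cut of the surviving points is used as a cut of the whole box.
  Colours cross it only because of removed points, and each is given up on a side where
  \<open>W\<close> leaves nothing of it. Both sides are strictly smaller clean boxes, for which
  \<open>tab0\<close> is already good.\<close>

lemma complete_step: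
  assumes W: "W \<subseteq> {..<n}" "card W \<le> s" "expl ({..<n} - W)" and "n \<ge> 1"
    and comp: "complete W p tab0"
    and rel: "\<And>A D. box_closed A \<Longrightarrow> card (Cross A ({..<n} - A)) \<le> s \<Longrightarrow>
      D \<subseteq> Cross A ({..<n} - A) \<Longrightarrow> relaxed tab0 tab (without A D)"
  shows "complete W (Suc p) tab"
  unfolding complete_def
proof (intro allI impI)
  fix A D assume A: "box_closed A" and cleanA: "clean W A" and pA: "card A \<le> Suc p"
    and D: "D \<subseteq> Cross A ({..<n} - A)" and DW: "D \<inter> cl ` (A - W) = {}"
  define Q where "Q = without A D"
  have finW: "finite W" using W(1) finite_subset by blast
  have An: "A \<subseteq> {..<n}" and finA: "finite A"
    using A finite_subset by (auto simp: box_closed_def)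
  have AW: "A - W \<subseteq> Q" using DW by (auto simp: Q_def without_def)
  have "card (Cross A ({..<n} - A)) \<le> s"
    using card_Cross_le[OF W(1) An, of "{..<n} - A"] cleanA W(2) unfolding clean_def by auto
  then have relQ: "relaxed tab0 tab Q" unfolding Q_def using rel A D by blast
  have QA: "Q \<subseteq> A" and finQ: "finite Q"
    using finA by (auto simp: Q_def without_def)
  show "s + 1 \<le> tab (set_encode (without A D)) + card (W \<inter> without A D)"
  proof (cases "\<exists>a\<in>A - W. \<exists>b\<in>A - W. cl a \<noteq> cl b")
    case False
    obtain t where t: "t < n" "\<And>a. a \<in> A - W \<Longrightarrow> cl a = cl t"
    \<comment> \<open>If nothing survives, any colour may be kept; point 0 exists because
      \<open>n\<close> is positive.\<close>
    proof (cases "A - W = {}")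
      case True
      with \<open>n \<ge> 1\<close> that[of 0] show ?thesis by auto
    next
      case ne: False
      then obtain t where "t \<in> A - W" by blast
      then show ?thesis using that[of t] False An by blast
    qed
    have "{j\<in>Q. cl j \<noteq> cl t} \<subseteq> W \<inter> Q" using t(2) QA by blast
    then have "card {j\<in>Q. cl j \<noteq> cl t} \<le> card (W \<inter> Q)" using finW by (intro card_mono) auto
    moreover have "cand_keep Q t \<le> tab (set_encode Q)" using relQ t(1) unfolding relaxed_def by blast
    ultimately show ?thesis unfolding cand_keep_def Q_def[symmetric] by linarith
  next
    case True
    have "expl (A - W)" using W(3) An expl_subset by (meson Diff_mono order_refl)
    then obtain i t where it: "i < d" "t \<in> A - W" "\<exists>j\<in>A - W. x j i > x t i"
      "cl ` {j\<in>A - W. x j i \<le> x t i} \<inter> cl ` {j\<in>A - W. x j i > x t i} = {}"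
      using expl_separating_cut[of "A - W"] finA True by blast
    define A1 where "A1 = low A i t"
    define A2 where "A2 = high A i t"
    define U where "U = low Q i t"
    define V where "V = high Q i t"
    define E where "E = Cross U V"
    have A12: "A1 \<noteq> {}" "A2 \<noteq> {}" "A1 \<union> A2 = A" "A1 \<inter> A2 = {}"
      using it(2,3) by (auto simp: A1_def A2_def low_def high_def)
    have sep: "cl ` (A1 - W) \<inter> cl ` (A2 - W) = {}"
    proof -
      have "A1 - W = {j\<in>A - W. x j i \<le> x t i}" "A2 - W = {j\<in>A - W. x j i > x t i}"
        by (auto simp: A1_def A2_def low_def high_def)
      with it(4) show ?thesis by simp
    qed
    have UA: "U = without A1 D" and VA: "V = without A2 D"
      by (auto simp: U_def V_def A1_def A2_def Q_def without_def low_def high_def)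
    have UV: "U \<union> V = Q" "U \<inter> V = {}"
      by (auto simp: U_def V_def low_def high_def)
    \<comment> \<open>A colour surviving on one side survives neither on the other side nor outside
      \<open>A\<close>.\<close>
    have c12: "clean W A1" "clean W A2"
      using cleanA sep A12(3,4) An unfolding clean_def by blast+
    have b12: "box_closed A1" "box_closed A2"
      using A A12 it(1) box_closed_low box_closed_high unfolding A1_def A2_def by blast+
    have "card A1 + card A2 = card A" using A12 finA by (metis card_Un_disjoint finite_Un)
    moreover have "card A1 > 0" "card A2 > 0" using A12 finA by (auto simp: card_gt_0_iff)
    ultimately have p12: "card A1 \<le> p" "card A2 \<le> p" using pA by linarith+
    \<comment> \<open>No colour survives on both sides. Those with survivors on the high side are
      given up on the low side; the others have no survivor on the high side and are given up
      there.\<close>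
    define F where "F = E \<inter> cl ` (A2 - W)"
    have FE: "F \<subseteq> E" unfolding F_def by blast
    have EW: "card E \<le> s"
      unfolding E_def
      by (rule order_trans[OF card_Cross_le[OF W(1)] W(2)])
         (use An sep in \<open>auto simp: UA VA without_def A1_def A2_def low_def high_def\<close>)
    \<comment> \<open>Colours given up earlier are passed on only if they occur in the child, since
      \<open>D1\<close> has to consist of colours crossing its border.\<close>
    define D1 where "D1 = D \<inter> cl ` A1 \<union> F"
    define D2 where "D2 = D \<inter> cl ` A2 \<union> (E - F)"
    have w1: "without U F = without A1 D1" and w2: "without V (E - F) = without A2 D2"
      unfolding UA VA D1_def D2_def without_def by auto
    have Dx: "D \<subseteq> cl ` ({..<n} - A)" using D unfolding Cross_def by blast
    have EA: "E \<subseteq> cl ` A1 \<inter> cl ` A2" unfolding E_def Cross_def UA VA without_def by blast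
    \<comment> \<open>A colour from \<open>D\<close> has a member outside \<open>A\<close>, a colour
      from \<open>F\<close> has one on the other side of the cut.\<close>
    have D1: "D1 \<subseteq> Cross A1 ({..<n} - A1)"
      using Dx EA A12(3,4) An FE unfolding D1_def Cross_def by blast
    have D2: "D2 \<subseteq> Cross A2 ({..<n} - A2)"
      using Dx EA A12(3,4) An FE unfolding D2_def Cross_def by blast
    have DW1: "D1 \<inter> cl ` (A1 - W) = {}"
      using DW A12(3) sep unfolding D1_def F_def by blast
    have DW2: "D2 \<inter> cl ` (A2 - W) = {}"
      using DW A12(3) unfolding D2_def F_def by blast
    have s1: "s + 1 \<le> tab0 (set_encode (without U F)) + card (W \<inter> without U F)"
      using comp b12(1) c12(1) p12(1) D1 DW1 unfolding complete_def w1 by blast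
    have s2: "s + 1 \<le> tab0 (set_encode (without V (E - F))) + card (W \<inter> without V (E - F))"
      using comp b12(2) c12(2) p12(2) D2 DW2 unfolding complete_def w2 by blast
    have "cand_cut tab0 U V F \<le> tab (set_encode Q)"
      using relQ it(1,2) EW FE An unfolding relaxed_def E_def U_def V_def by blast
    \<comment> \<open>All points given up here belong to \<open>W\<close>, so \<open>W\<close>
      inside \<open>Q\<close> splits exactly into the losses of this cut and the removals in the two
      children; with this the slacks add up.\<close>
    moreover have "lost U V F + card (W \<inter> without U F) + card (W \<inter> without V (E - F)) = card (W \<inter> Q)"
    proof -
      let ?L = "{j\<in>U. cl j \<in> F}" and ?G = "{j\<in>V. cl j \<in> E - F}"
      have LW: "?L \<subseteq> W" using DW1 unfolding UA D1_def without_def by blast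
      have GW: "?G \<subseteq> W" using DW2 unfolding VA D2_def without_def by blast
      have "W \<inter> Q = (?L \<union> (W \<inter> without U F)) \<union> (?G \<union> (W \<inter> without V (E - F)))"
        using LW GW UV(1) unfolding without_def by blast
      moreover have "card \<dots> = card (?L \<union> (W \<inter> without U F)) + card (?G \<union> (W \<inter> without V (E - F)))"
        using UV(2) finQ UV(1) finW LW GW
        by (intro card_Un_disjoint) (auto simp: without_def intro: finite_subset)
      moreover have "card (?L \<union> (W \<inter> without U F)) = card ?L + card (W \<inter> without U F)"
        using finW LW by (intro card_Un_disjoint) (auto simp: without_def intro: finite_subset)
      moreover have "card (?G \<union> (W \<inter> without V (E - F))) = card ?G + card (W \<inter> without V (E - F))"
        using finW GW by (intro card_Un_disjoint) (auto simp: without_def intro: finite_subset)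
      ultimately show ?thesis unfolding lost_def E_def[symmetric] by simp
    qed
    ultimately show ?thesis
      using s1 s2 unfolding cand_cut_def E_def[symmetric] Q_def[symmetric] by linarith
  qed
qed

text \<open>The box of all points has no outside: it is clean and no colour crosses its border, so
  completeness applies with an empty \<open>D\<close>.\<close>

lemma table_decides:
  assumes "n \<ge> 1" "sound tab"
    and comp: "\<And>W. W \<subseteq> {..<n} \<Longrightarrow> card W \<le> s \<Longrightarrow> expl ({..<n} - W) \<Longrightarrow> complete W n tab"
  shows "tab (set_encode {..<n}) > 0 \<longleftrightarrow> (\<exists>W\<subseteq>{..<n}. card W \<le> s \<and> expl ({..<n} - W))"
proof
  assume "tab (set_encode {..<n}) > 0"
  then obtain W where "W \<subseteq> {..<n}" "card W + tab (set_encode {..<n}) \<le> s + 1" "expl ({..<n} - W)"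
    using assms(2) unfolding sound_def by blast
  then show "\<exists>W\<subseteq>{..<n}. card W \<le> s \<and> expl ({..<n} - W)"
    using \<open>tab (set_encode {..<n}) > 0\<close> by (intro exI[of _ W]) auto
next
  assume "\<exists>W\<subseteq>{..<n}. card W \<le> s \<and> expl ({..<n} - W)"
  then obtain W where W: "W \<subseteq> {..<n}" "card W \<le> s" "expl ({..<n} - W)" by blast
  have "box_closed {..<n}" using assms(1) unfolding box_closed_def by (auto simp: lessThan_empty_iff)
  moreover have "clean W {..<n}" unfolding clean_def by simp
  ultimately have "s + 1 \<le> tab (set_encode (without {..<n} {})) + card (W \<inter> without {..<n} {})"
    using comp[OF W] unfolding complete_def by auto
  moreover have "without {..<n} {} = {..<n}" "W \<inter> {..<n} = W" using W unfolding without_def by auto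
  ultimately show "tab (set_encode {..<n}) > 0" using W(2) by simp
qed

end

section \<open>Weakest preconditions with time bounds\<close>

text \<open>A total correctness statement: as \<open>exec\<close> is deterministic, asking for some
  execution means the only one.\<close>

definition ok :: "coords \<Rightarrow> com \<Rightarrow> store \<Rightarrow> nat \<Rightarrow> (store \<Rightarrow> bool) \<Rightarrow> bool" where
  "ok x c \<sigma> T Q \<longleftrightarrow> (\<exists>t \<sigma>'. exec x c \<sigma> t \<sigma>' \<and> t \<le> T \<and> Q \<sigma>')"

inductive_cases exec_SkipE: "exec x Skip \<sigma> t \<sigma>'"
inductive_cases exec_AssignE: "exec x (Assign v j e) \<sigma> t \<sigma>'"
inductive_cases exec_SeqE: "exec x (Seq c1 c2) \<sigma> t \<sigma>'"
inductive_cases exec_IfE: "exec x (If b c1 c2) \<sigma> t \<sigma>'"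

lemma exec_Skip_iff: "exec x Skip \<sigma> t \<sigma>' \<longleftrightarrow> t = 1 \<and> \<sigma>' = \<sigma>"
  by (auto elim: exec_SkipE intro: exec.Skip[unfolded One_nat_def])

lemma exec_Assign_iff: "exec x (Assign v j e) \<sigma> t \<sigma>' \<longleftrightarrow>
    t = 1 \<and> \<sigma>' = \<sigma>(v := (\<sigma> v)(aval j \<sigma> := aval e \<sigma>))"
  by (auto elim: exec_AssignE intro: exec.Assign[unfolded One_nat_def])

lemma exec_Seq_iff: "exec x (Seq c1 c2) \<sigma> t \<sigma>' \<longleftrightarrow>
    (\<exists>t1 t2 \<tau>. exec x c1 \<sigma> t1 \<tau> \<and> exec x c2 \<tau> t2 \<sigma>' \<and> t = t1 + t2)"
  by (auto elim!: exec_SeqE intro: exec.Seq)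

lemma exec_If_iff: "exec x (If b c1 c2) \<sigma> t \<sigma>' \<longleftrightarrow>
    (\<exists>t1. exec x (if bval x b \<sigma> then c1 else c2) \<sigma> t1 \<sigma>' \<and> t = 1 + t1)"
  using exec.IfTrue[of x b \<sigma> c1 _ \<sigma>' c2] exec.IfFalse[of x b \<sigma> c2 _ \<sigma>' c1]
  by (cases "bval x b \<sigma>") (auto elim!: exec_IfE)

lemma ok_Skip: "ok x Skip \<sigma> T Q \<longleftrightarrow> 1 \<le> T \<and> Q \<sigma>"
  by (auto simp: ok_def exec_Skip_iff)

lemma ok_Assign: "ok x (Assign v j e) \<sigma> T Q \<longleftrightarrow>
    1 \<le> T \<and> Q (\<sigma>(v := (\<sigma> v)(aval j \<sigma> := aval e \<sigma>)))"
  by (auto simp: ok_def exec_Assign_iff)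

lemma ok_step:
  assumes "\<And>t \<tau>. exec x c \<sigma> t \<tau> \<longleftrightarrow> (\<exists>t1. exec x c' \<sigma>' t1 \<tau> \<and> t = 1 + t1)"
  shows "ok x c \<sigma> T Q \<longleftrightarrow> 1 \<le> T \<and> ok x c' \<sigma>' (T - 1) Q"
  unfolding ok_def assms by (cases T) auto

lemma ok_If: "ok x (If b c1 c2) \<sigma> T Q \<longleftrightarrow>
    1 \<le> T \<and> ok x (if bval x b \<sigma> then c1 else c2) \<sigma> (T - 1) Q"
  by (rule ok_step) (rule exec_If_iff)

lemma ok_Seq_Skip: "ok x (Seq Skip c) \<sigma> T Q \<longleftrightarrow> 1 \<le> T \<and> ok x c \<sigma> (T - 1) Q"
  by (rule ok_step) (auto simp: exec_Seq_iff exec_Skip_iff)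

lemma ok_Seq_Assign: "ok x (Seq (Assign v j e) c) \<sigma> T Q \<longleftrightarrow>
    1 \<le> T \<and> ok x c (\<sigma>(v := (\<sigma> v)(aval j \<sigma> := aval e \<sigma>))) (T - 1) Q"
  by (rule ok_step) (auto simp: exec_Seq_iff exec_Assign_iff)

lemma ok_Seq_If: "ok x (Seq (If b c1 c2) c) \<sigma> T Q \<longleftrightarrow>
    1 \<le> T \<and> ok x (Seq (if bval x b \<sigma> then c1 else c2) c) \<sigma> (T - 1) Q"
  by (rule ok_step) (force simp: exec_Seq_iff exec_If_iff)

lemma ok_Seq_Seq: "ok x (Seq (Seq c1 c2) c3) \<sigma> T Q \<longleftrightarrow> ok x (Seq c1 (Seq c2 c3)) \<sigma> T Q"
proof -
  have "exec x (Seq (Seq c1 c2) c3) \<sigma> t \<tau> \<longleftrightarrow> exec x (Seq c1 (Seq c2 c3)) \<sigma> t \<tau>" for t \<tau>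
    unfolding exec_Seq_iff by (fastforce simp: add.assoc)
  then show ?thesis unfolding ok_def by simp
qed

text \<open>Rewriting with these rules executes loop-free code symbolically and counts the time
  down; loops are left to \<open>ok_For\<close> and joined by \<open>ok_Seq\<close>.\<close>

lemmas ok_simps = ok_Skip ok_Assign ok_If ok_Seq_Skip ok_Seq_Assign ok_Seq_If ok_Seq_Seq

lemma ok_mono: "ok x c \<sigma> T Q \<Longrightarrow> T \<le> T' \<Longrightarrow> (\<And>\<tau>. Q \<tau> \<Longrightarrow> Q' \<tau>) \<Longrightarrow> ok x c \<sigma> T' Q'"
  unfolding ok_def by (meson order_trans)

lemma ok_Seq:
  assumes "ok x c1 \<sigma> T1 (\<lambda>\<tau>. ok x c2 \<tau> T2 Q)" "T1 + T2 \<le> T"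
  shows "ok x (Seq c1 c2) \<sigma> T Q"
proof -
  obtain t1 t2 \<tau> \<rho> where "exec x c1 \<sigma> t1 \<tau>" "exec x c2 \<tau> t2 \<rho>" "Q \<rho>" "t1 \<le> T1" "t2 \<le> T2"
    using assms(1) unfolding ok_def by blast
  then have "exec x (Seq c1 c2) \<sigma> (t1 + t2) \<rho>" "t1 + t2 \<le> T" "Q \<rho>"
    using assms(2) by (auto intro: exec.Seq)
  then show ?thesis unfolding ok_def by blast
qed

section \<open>Frame conditions and counted loops\<close>

fun writes :: "com \<Rightarrow> name set" where
  "writes Skip = {}"
| "writes (Assign v j e) = {v}"
| "writes (Seq c1 c2) = writes c1 \<union> writes c2"
| "writes (If b c1 c2) = writes c1 \<union> writes c2"
| "writes (While b c) = writes c"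

definition unchanged :: "name set \<Rightarrow> store \<Rightarrow> store \<Rightarrow> bool" where
  "unchanged V \<sigma> \<tau> \<longleftrightarrow> (\<forall>v. v \<notin> V \<longrightarrow> \<tau> v = \<sigma> v)"

lemma unchanged_trans: "unchanged V \<sigma> \<tau> \<Longrightarrow> unchanged V' \<tau> \<rho> \<Longrightarrow> V \<subseteq> U \<Longrightarrow> V' \<subseteq> U \<Longrightarrow> unchanged U \<sigma> \<rho>"
  unfolding unchanged_def by (metis subsetD)

lemma exec_unchanged: "exec x c \<sigma> t \<sigma>' \<Longrightarrow> unchanged (writes c) \<sigma> \<sigma>'"
  by (induction rule: exec.induct) (auto simp: unchanged_def)

text \<open>Specifications can thus be limited to what a program computes; that it leaves the other
  arrays alone is read off its text.\<close>

lemma ok_frame: "ok x c \<sigma> T Q \<Longrightarrow> ok x c \<sigma> T (\<lambda>\<tau>. Q \<tau> \<and> unchanged (writes c) \<sigma> \<tau>)"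
  unfolding ok_def using exec_unchanged by blast

abbreviation Var :: "name \<Rightarrow> aexp" where
  "Var v \<equiv> Cell v (Num 0)"

abbreviation Set :: "name \<Rightarrow> aexp \<Rightarrow> com" where
  "Set v e \<equiv> Assign v (Num 0) e"

definition Eq :: "aexp \<Rightarrow> aexp \<Rightarrow> bexp" where
  "Eq e1 e2 = And (Not (Less e1 e2)) (Not (Less e2 e1))"

lemma bval_Eq [simp]: "bval x (Eq e1 e2) \<sigma> \<longleftrightarrow> aval e1 \<sigma> = aval e2 \<sigma>"
  by (auto simp: Eq_def)

definition For :: "name \<Rightarrow> aexp \<Rightarrow> com \<Rightarrow> com" where
  "For i e c = Seq (Set i (Num 0))
     (While (Less (Var i) e) (Seq c (Set i (Plus (Var i) (Num 1)))))"

lemma writes_For [simp]: "writes (For i e c) = insert i (writes c)"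
  by (auto simp: For_def)

text \<open>A round costs the body, a test and an increment, hence \<open>T + 2\<close>; the initial
  assignment and the last test give the final 2. The bound \<open>e\<close> is evaluated anew at
  each test, so its value must be stable under everything the loop writes.\<close>

lemma ok_For:
  assumes bound: "\<And>\<tau>. unchanged (insert i (writes c)) \<sigma> \<tau> \<Longrightarrow> aval e \<tau> = N"
    and i: "i \<notin> writes c"
    and init: "I 0 (\<sigma>(i := (\<sigma> i)(0 := 0)))"
    and step: "\<And>m \<tau>. m < N \<Longrightarrow> I m \<tau> \<Longrightarrow> \<tau> i 0 = m \<Longrightarrow> unchanged (insert i (writes c)) \<sigma> \<tau> \<Longrightarrow>
      ok x c \<tau> T (\<lambda>\<rho>. I (Suc m) (\<rho>(i := (\<rho> i)(0 := Suc m))))"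
    and final: "\<And>\<tau>. I N \<tau> \<Longrightarrow> \<tau> i 0 = N \<Longrightarrow> unchanged (insert i (writes c)) \<sigma> \<tau> \<Longrightarrow> Q \<tau>"
    and T': "N * (T + 2) + 2 \<le> T'"
  shows "ok x (For i e c) \<sigma> T' Q"
proof -
  let ?V = "insert i (writes c)"
  let ?c = "Seq c (Set i (Plus (Var i) (Num 1)))"
  let ?w = "While (Less (Var i) e) ?c"
  have loop: "\<exists>t \<rho>. exec x ?w \<tau> t \<rho> \<and> t \<le> (N - m) * (T + 2) + 1 \<and> Q \<rho>"
    if "m \<le> N" "I m \<tau>" "\<tau> i 0 = m" "unchanged ?V \<sigma> \<tau>" for m \<tau>
    using that
  proof (induction "N - m" arbitrary: m \<tau>)
    case 0
    then have "\<not> bval x (Less (Var i) e) \<tau>" using bound by auto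
    then have "exec x ?w \<tau> 1 \<tau>" by (rule exec.WhileFalse)
    moreover have "Q \<tau>" using 0 final by simp
    ultimately show ?case using 0 by force
  next
    case (Suc l)
    then have m: "m < N" by simp
    then have b: "bval x (Less (Var i) e) \<tau>" using bound Suc.prems by auto
    obtain t1 \<rho> where c: "exec x c \<tau> t1 \<rho>" "t1 \<le> T" "I (Suc m) (\<rho>(i := (\<rho> i)(0 := Suc m)))"
      using step[OF m] Suc.prems unfolding ok_def by blast
    let ?\<rho> = "\<rho>(i := (\<rho> i)(0 := Suc m))"
    have unch: "unchanged (writes c) \<tau> \<rho>" using c(1) by (rule exec_unchanged)
    then have "\<rho> i 0 = m" using i Suc.prems(3) by (simp add: unchanged_def)
    then have "exec x (Set i (Plus (Var i) (Num 1))) \<rho> 1 ?\<rho>"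
      using exec.Assign[of x i "Num 0" "Plus (Var i) (Num 1)" \<rho>] by simp
    with c(1) have body: "exec x ?c \<tau> (t1 + 1) ?\<rho>" by (rule exec.Seq)
    have unch': "unchanged ?V \<sigma> ?\<rho>"
      using Suc.prems(4) unch by (simp add: unchanged_def)
    have l: "l = N - Suc m" "Suc m \<le> N" "?\<rho> i 0 = Suc m" using Suc.hyps(2) m by simp_all
    obtain t2 \<rho>' where w: "exec x ?w ?\<rho> t2 \<rho>'" "t2 \<le> (N - Suc m) * (T + 2) + 1" "Q \<rho>'"
      using Suc.hyps(1)[OF l(1,2) c(3) l(3) unch'] by blast
    have "exec x ?w \<tau> (1 + (t1 + 1) + t2) \<rho>'" using b body w(1) by (rule exec.WhileTrue)
    moreover have "N - m = Suc (N - Suc m)" using m by simp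
    then have "1 + (t1 + 1) + t2 \<le> (N - m) * (T + 2) + 1" using c(2) w(2) by simp
    ultimately show ?case using w(3) by blast
  qed
  let ?\<tau> = "\<sigma>(i := (\<sigma> i)(0 := 0))"
  have "unchanged ?V \<sigma> ?\<tau>" by (simp add: unchanged_def)
  then obtain t \<rho> where w: "exec x ?w ?\<tau> t \<rho>" "t \<le> N * (T + 2) + 1" "Q \<rho>"
    using loop[OF le0 init] by auto
  have "exec x (Set i (Num 0)) \<sigma> 1 ?\<tau>"
    using exec.Assign[of x i "Num 0" "Num 0" \<sigma>] by simp
  then have "exec x (For i e c) \<sigma> (1 + t) \<rho>" unfolding For_def using w(1) by (rule exec.Seq)
  then show ?thesis using w T' unfolding ok_def by force
qed

section \<open>The program\<close>

text \<open>Because of this, one counter below \<open>q ^ l\<close> runs through all tuples of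
  digits. It serves bit masks of clusters with base 2 and box bounds with base
  \<open>n\<close>.\<close>

lemma digits_exist:
  assumes "\<And>b. b < l \<Longrightarrow> f b < q"
  shows "\<exists>w<q ^ l. \<forall>b<l. w div q ^ b mod q = (f b :: nat)"
  using assms
proof (induction l arbitrary: f)
  case 0
  then show ?case by auto
next
  case (Suc l)
  obtain w where w: "w < q ^ l" "\<forall>b<l. w div q ^ b mod q = f (Suc b)"
    using Suc.IH[of "\<lambda>b. f (Suc b)"] Suc.prems by auto
  have f0: "f 0 < q" using Suc.prems by simp
  let ?w = "f 0 + q * w"
  have "?w < q * (w + 1)" using f0 by simp
  also have "\<dots> \<le> q * q ^ l" using w(1) by (intro mult_le_mono2) simp
  finally have "?w < q ^ Suc l" by simp
  moreover have "?w div q ^ b mod q = f b" if "b < Suc l" for b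
  proof (cases b)
    case (Suc b')
    have "?w div q ^ b = (?w div q) div q ^ b'" unfolding Suc by (simp add: div_mult2_eq)
    also have "?w div q = w" using f0 by simp
    finally show ?thesis using w(2) that Suc by simp
  qed (use f0 in simp)
  ultimately show ?case by blast
qed

text \<open>The machine has no division, so digits are extracted from the most significant one down
  by subtracting the powers stored in \<open>P\<close>. A digit is below the base, so
  \<open>B\<close> rounds suffice; surplus rounds do nothing.\<close>

definition decode :: "name \<Rightarrow> name \<Rightarrow> aexp \<Rightarrow> aexp \<Rightarrow> aexp \<Rightarrow> com" where
  "decode P dg B L v = Seq (Set ''rem'' v) (For ''b'' L
     (Seq (Set ''pos'' (Minus (Minus L (Num 1)) (Var ''b'')))
     (Seq (Assign dg (Var ''pos'') (Num 0))
     (For ''e'' B (If (Less (Var ''rem'') (Cell P (Var ''pos''))) Skip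
       (Seq (Assign dg (Var ''pos'') (Plus (Cell dg (Var ''pos'')) (Num 1)))
            (Set ''rem'' (Minus (Var ''rem'') (Cell P (Var ''pos'')))))))))) "

lemma writes_decode [simp]: "writes (decode P dg B L v) = {''rem'', ''b'', ''pos'', ''e'', dg}"
  by (auto simp: decode_def)

lemma digit_step:
  fixes p q w :: nat
  assumes "p > 0"
  shows "w mod (q * p) div p = w div p mod q" and "w mod (q * p) mod p = w mod p"
  using assms by (simp_all add: mult.commute[of q p] mod_mult2_eq)

lemma ok_decode:
  assumes L: "\<And>\<tau>. unchanged {''rem'', ''b'', ''pos'', ''e'', dg} \<sigma> \<tau> \<Longrightarrow> aval L \<tau> = l"
    and B: "\<And>\<tau>. unchanged {''rem'', ''b'', ''pos'', ''e'', dg} \<sigma> \<tau> \<Longrightarrow> aval B \<tau> = q"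
    and w: "aval v \<sigma> = w" "w < q ^ l" and q: "q > 0"
    and P: "\<And>b. b < l \<Longrightarrow> \<sigma> P b = q ^ b"
    and dg: "dg \<notin> {''rem'', ''b'', ''pos'', ''e''}"
    and PV: "P \<notin> {''rem'', ''b'', ''pos'', ''e'', dg}"
    and T: "l * (q * 5 + 6) + 3 \<le> T"
  shows "ok x (decode P dg B L v) \<sigma> T (\<lambda>\<tau>. \<forall>b<l. \<tau> dg b = w div q ^ b mod q)"
proof -
  let ?inner = "If (Less (Var ''rem'') (Cell P (Var ''pos''))) Skip
     (Seq (Assign dg (Var ''pos'') (Plus (Cell dg (Var ''pos'')) (Num 1)))
          (Set ''rem'' (Minus (Var ''rem'') (Cell P (Var ''pos'')))))"
  let ?body = "Seq (Set ''pos'' (Minus (Minus L (Num 1)) (Var ''b'')))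
    (Seq (Assign dg (Var ''pos'') (Num 0)) (For ''e'' B ?inner))"
  define V where "V = {''rem'', ''b'', ''pos'', ''e'', dg}"
  define \<sigma>1 where "\<sigma>1 = \<sigma>(''rem'' := (\<sigma> ''rem'')(0 := w))"
  have unch1: "unchanged V \<sigma> \<tau>" if "unchanged V \<sigma>1 \<tau>" for \<tau>
    using that unfolding unchanged_def V_def \<sigma>1_def by auto
  \<comment> \<open>After \<open>m\<close> digits, what remains is \<open>w\<close> modulo the power
    that belongs to the last extracted digit.\<close>
  let ?I = "\<lambda>m \<tau>. \<tau> ''rem'' 0 = w mod q ^ (l - m) \<and> (\<forall>b<l. l - m \<le> b \<longrightarrow> \<tau> dg b = w div q ^ b mod q)"
  have "ok x (For ''b'' L
     ?body) \<sigma>1 (T - 1)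
     (\<lambda>\<tau>. \<forall>b<l. \<tau> dg b = w div q ^ b mod q)"
  proof (rule ok_For[where I = ?I and N = l and T = "q * 5 + 4"])
    show "?I 0 (\<sigma>1(''b'' := (\<sigma>1 ''b'')(0 := 0)))" using w by (simp add: \<sigma>1_def)
  next
    fix m \<tau>
    assume m: "m < l" and I: "?I m \<tau>" and b: "\<tau> ''b'' 0 = m" and
      "unchanged (insert ''b'' (writes ?body)) \<sigma>1 \<tau>"
    then have unch: "unchanged V \<sigma> \<tau>" by (intro unch1) (simp add: V_def unchanged_def)
    define pos where "pos = l - 1 - m"
    define p where "p = q ^ pos"
    define r where "r = w mod q ^ (l - m)"
    have lm: "l - m = Suc pos" and pos: "pos < l" and lpos: "l - Suc m = pos" using m by (simp_all add: pos_def)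
    have p0: "p > 0" using q by (simp add: p_def)
    have rp: "r div p = w div q ^ pos mod q" "r mod p = w mod q ^ pos"
      using digit_step[OF p0, of w q] by (simp_all add: r_def lm p_def)
    have L\<tau>: "aval L \<tau> = l" using L unch V_def by simp
    have P': "\<rho> P pos = p" if "unchanged V \<sigma> \<rho>" for \<rho>
      using that P[OF pos] PV unfolding unchanged_def V_def p_def by metis
    let ?\<tau>1 = "\<tau>(''pos'' := (\<tau> ''pos'')(0 := pos))"
    let ?\<tau>2 = "?\<tau>1(dg := (?\<tau>1 dg)(pos := 0))"
    have unch2: "unchanged V \<sigma> \<rho>" if "unchanged V ?\<tau>2 \<rho>" for \<rho>
      using that unch unfolding unchanged_def V_def by auto
    \<comment> \<open>The subtractions stop by themselves at the digit
      \<open>r div p\<close>.\<close>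
    let ?J = "\<lambda>e \<rho>. \<rho> ''pos'' 0 = pos \<and> \<rho> dg pos = min e (r div p) \<and>
      \<rho> ''rem'' 0 = r - min e (r div p) * p \<and> (\<forall>b. b \<noteq> pos \<longrightarrow> \<rho> dg b = \<tau> dg b)"
    have inner: "ok x (For ''e'' B ?inner)
      ?\<tau>2 (q * 5 + 2) (\<lambda>\<rho>. ?I (Suc m) (\<rho>(''b'' := (\<rho> ''b'')(0 := Suc m))))"
    proof (rule ok_For[where I = ?J and N = q and T = 3])
      fix \<rho> assume "unchanged (insert ''e'' (writes ?inner)) ?\<tau>2 \<rho>"
      then have "unchanged V \<sigma> \<rho>" by (intro unch2) (simp add: V_def unchanged_def)
      then show "aval B \<rho> = q" using B V_def by simp
    next
      show "?J 0 (?\<tau>2(''e'' := (?\<tau>2 ''e'')(0 := 0)))" using I dg by (auto simp: r_def)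
    next
      fix e \<rho> assume e: "e < q" and J: "?J e \<rho>" and
        "unchanged (insert ''e'' (writes ?inner)) ?\<tau>2 \<rho>"
      then have "unchanged V \<sigma> \<rho>" by (intro unch2) (simp add: V_def unchanged_def)
      then have P\<rho>: "\<rho> P pos = p" by (rule P')
      show "ok x ?inner \<rho> 3
        (\<lambda>\<rho>. ?J (Suc e) (\<rho>(''e'' := (\<rho> ''e'')(0 := Suc e))))"
      proof (cases "e < r div p")
        case True
        then have "Suc e * p \<le> r" by (metis Suc_leI less_eq_div_iff_mult_less_eq p0)
        then have "\<not> r - e * p < p" by simp
        then show ?thesis using J P\<rho> True dg PV by (auto simp: ok_simps)
      next
        case False
        then have "min e (r div p) = r div p" "min (Suc e) (r div p) = r div p" by auto
        moreover have "r - r div p * p < p" using p0 by (simp add: minus_div_mult_eq_mod)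
        ultimately show ?thesis using J P\<rho> dg PV by (auto simp: ok_simps)
      qed
    next
      fix \<rho> assume J: "?J q \<rho>"
      have "r div p < q" unfolding rp(1) using q by simp
      then have "min q (r div p) = r div p" by simp
      then have J': "\<rho> dg pos = w div q ^ pos mod q" "\<rho> ''rem'' 0 = w mod q ^ pos"
        using J by (simp_all add: rp[symmetric] minus_div_mult_eq_mod)
      note lpos
      moreover have "\<rho> dg b = w div q ^ b mod q" if "b < l" "pos \<le> b" for b
        using J J' I that lm by (cases "b = pos") auto
      ultimately show "?I (Suc m) (\<rho>(''b'' := (\<rho> ''b'')(0 := Suc m)))" using J' dg by auto
    qed (use dg in auto)
    show "ok x ?body
       \<tau> (q * 5 + 4) (\<lambda>\<rho>. ?I (Suc m) (\<rho>(''b'' := (\<rho> ''b'')(0 := Suc m))))"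
      using inner dg by (simp add: ok_simps L\<tau> b lpos)
  next
    fix \<tau> assume "unchanged (insert ''b'' (writes ?body)) \<sigma>1 \<tau>"
    then have "unchanged V \<sigma> \<tau>" by (intro unch1) (simp add: V_def unchanged_def)
    then show "aval L \<tau> = l" using L V_def by simp
  qed (use dg T in \<open>auto simp: algebra_simps\<close>)
  then show ?thesis using T by (simp add: decode_def ok_simps w \<sigma>1_def)
qed

text \<open>The arrays whose names start with the level \<open>l\<close> exist twice: level \<open>1\<close> separates a box from its
  complement, level \<open>2\<close> the two sides of a cut.  The array \<open>sd\<close> tells the side of a point (\<open>1\<close>, \<open>2\<close>, or
  \<open>0\<close> for neither), \<open>cr\<close> marks the points whose cluster meets both sides, and \<open>ix\<close> numbers these
  clusters; entries of \<open>ix\<close> at other clusters are junk.\<close>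

definition collect :: "char \<Rightarrow> com" where
  "collect l = Seq (Set (l # ''m'') (Num 0)) (For ''j'' (Var ''n'')
     (Seq (Set ''fa'' (Num 0)) (Seq (Set ''fb'' (Num 0)) (Seq (Set ''fc'' (Num 0))
     (Seq
       (For ''c'' (Var ''n'')
         (If (Eq (Cell ''cluster'' (Var ''c'')) (Cell ''cluster'' (Var ''j'')))
           (Seq (If (Eq (Cell (l # ''sd'') (Var ''c'')) (Num 1)) (Set ''fa'' (Num 1)) Skip)
           (Seq (If (Eq (Cell (l # ''sd'') (Var ''c'')) (Num 2)) (Set ''fb'' (Num 1)) Skip)
                (If (Less (Var ''c'') (Var ''j'')) (Set ''fc'' (Num 1)) Skip)))
           Skip))
       (If (And (Less (Num 0) (Var ''fa'')) (Less (Num 0) (Var ''fb'')))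
         (Seq (Assign (l # ''cr'') (Var ''j'') (Num 1))
           (If (Less (Num 0) (Var ''fc'')) Skip
             (Seq (Assign (l # ''ix'') (Cell ''cluster'' (Var ''j'')) (Var (l # ''m'')))
                  (Set (l # ''m'') (Plus (Var (l # ''m'')) (Num 1))))))
         (Assign (l # ''cr'') (Var ''j'') (Num 0))))))))"

lemma writes_collect [simp]:
  "writes (collect l) = {l # ''m'', l # ''cr'', l # ''ix'', ''j'', ''c'', ''fa'', ''fb'', ''fc''}"
  by (auto simp: collect_def)

text \<open>The test of \<open>cr\<close> guards the junk entries of \<open>ix\<close>. Besides the
  codes of both remaining sides, the low one is stored as the characteristic array \<open>q\<close>:
  at level 1 it is the point set that the cuts are applied to.\<close>

definition select :: "char \<Rightarrow> com" where
  "select l = Seq (Set (l # ''ka'') (Num 0)) (Seq (Set (l # ''kb'') (Num 0)) (Seq (Set (l # ''r'') (Num 0))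
     (For ''j'' (Var ''n'')
       (Seq (Assign (l # ''q'') (Var ''j'') (Num 0))
         (If (Eq (Cell (l # ''sd'') (Var ''j'')) (Num 1))
           (If (And (Less (Num 0) (Cell (l # ''cr'') (Var ''j'')))
                    (Less (Num 0) (Cell (l # ''sel'') (Cell (l # ''ix'') (Cell ''cluster'' (Var ''j''))))))
             (Set (l # ''r'') (Plus (Var (l # ''r'')) (Num 1)))
             (Seq (Set (l # ''ka'') (Plus (Var (l # ''ka'')) (Cell ''pow2'' (Var ''j''))))
                  (Assign (l # ''q'') (Var ''j'') (Num 1))))
           (If (Eq (Cell (l # ''sd'') (Var ''j'')) (Num 2))
             (If (And (Less (Num 0) (Cell (l # ''cr'') (Var ''j'')))
                      (Eq (Cell (l # ''sel'') (Cell (l # ''ix'') (Cell ''cluster'' (Var ''j'')))) (Num 0)))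
               (Set (l # ''r'') (Plus (Var (l # ''r'')) (Num 1)))
               (Set (l # ''kb'') (Plus (Var (l # ''kb'')) (Cell ''pow2'' (Var ''j'')))))
             Skip))))))"

lemma writes_select [simp]: "writes (select l) = {l # ''ka'', l # ''kb'', l # ''r'', l # ''q'', ''j''}"
  by (auto simp: select_def)

lemma unchanged_upd: "unchanged V \<sigma> \<tau> \<Longrightarrow> v \<in> V \<Longrightarrow> unchanged V \<sigma> (\<tau>(v := f))"
  by (auto simp: unchanged_def)

lemma bij_betw_upd:
  "bij_betw f S {..<k} \<Longrightarrow> a \<notin> S \<Longrightarrow> bij_betw (f(a := k)) (insert a S) {..<Suc k}"
  by (auto simp: bij_betw_def inj_on_def lessThan_Suc image_iff)

lemma set_encode_Int_Suc:
  "set_encode (S \<inter> {..<Suc m}) = set_encode (S \<inter> {..<m}) + (if m \<in> S then 2 ^ m else 0)"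
proof (cases "m \<in> S")
  case True
  then have "S \<inter> {..<Suc m} = insert m (S \<inter> {..<m})" by auto
  then show ?thesis using True by simp
next
  case False
  then have "S \<inter> {..<Suc m} = S \<inter> {..<m}" by (auto simp: less_Suc_eq)
  then show ?thesis using False by simp
qed

lemma card_Int_Suc:
  "card (S \<inter> {..<Suc m}) = card (S \<inter> {..<m}) + (if m \<in> S then 1 else 0)"
proof (cases "m \<in> S")
  case True
  then have "S \<inter> {..<Suc m} = insert m (S \<inter> {..<m})" by auto
  then show ?thesis using True by simp
next
  case False
  then have "S \<inter> {..<Suc m} = S \<inter> {..<m}" by (auto simp: less_Suc_eq)
  then show ?thesis using False by simp
qed

context coloured_points
begin

text \<open>The index \<open>n\<close> of \<open>pow2\<close> is included because
  \<open>subsets\<close> takes its loop bound from there, and up to \<open>n\<close> clusters may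
  cross.\<close>

definition env :: "store \<Rightarrow> bool" where
  "env \<sigma> \<longleftrightarrow> \<sigma> ''n'' 0 = n \<and> \<sigma> ''d'' 0 = d \<and> \<sigma> ''s'' 0 = s \<and>
    (\<forall>j<n. \<sigma> ''cluster'' j = cl j) \<and> (\<forall>j\<le>n. \<sigma> ''pow2'' j = 2 ^ j)"

lemma env_unchanged:
  assumes "env \<sigma>" "unchanged V \<sigma> \<tau>" "V \<inter> {''n'', ''d'', ''s'', ''cluster'', ''pow2''} = {}"
  shows "env \<tau>"
proof -
  have "\<tau> v = \<sigma> v" if "v \<in> {''n'', ''d'', ''s'', ''cluster'', ''pow2''}" for v
    using assms(2,3) that unfolding unchanged_def by blast
  then show ?thesis using assms(1) unfolding env_def by simp
qed

definition side :: "char \<Rightarrow> nat \<Rightarrow> store \<Rightarrow> nat set" where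
  "side l b \<sigma> = {j. j < n \<and> \<sigma> (l # ''sd'') j = b}"

text \<open>A crossing cluster receives the next free number at its first member, recognised by
  \<open>fc\<close> being 0; therefore the numbering is a bijection.\<close>

lemma ok_collect:
  assumes env: "env \<sigma>" and T: "n * (n * 9 + 12) + 3 \<le> T"
    and U: "U = side l 1 \<sigma>" and V: "V = side l 2 \<sigma>"
  shows "ok x (collect l) \<sigma> T (\<lambda>\<tau>. (\<forall>j<n. \<tau> (l # ''cr'') j = of_bool (cl j \<in> Cross U V)) \<and>
    bij_betw (\<tau> (l # ''ix'')) (Cross U V) {..<\<tau> (l # ''m'') 0})"
proof -
  let ?V = "{l # ''m'', l # ''cr'', l # ''ix'', ''j'', ''c'', ''fa'', ''fb'', ''fc''}"
  let ?\<sigma>1 = "\<sigma>(l # ''m'' := (\<sigma> (l # ''m''))(0 := 0))"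
  let ?find = "If (Eq (Cell ''cluster'' (Var ''c'')) (Cell ''cluster'' (Var ''j'')))
           (Seq (If (Eq (Cell (l # ''sd'') (Var ''c'')) (Num 1)) (Set ''fa'' (Num 1)) Skip)
           (Seq (If (Eq (Cell (l # ''sd'') (Var ''c'')) (Num 2)) (Set ''fb'' (Num 1)) Skip)
                (If (Less (Var ''c'') (Var ''j'')) (Set ''fc'' (Num 1)) Skip)))
           Skip"
  let ?record = "If (And (Less (Num 0) (Var ''fa'')) (Less (Num 0) (Var ''fb'')))
         (Seq (Assign (l # ''cr'') (Var ''j'') (Num 1))
           (If (Less (Num 0) (Var ''fc'')) Skip
             (Seq (Assign (l # ''ix'') (Cell ''cluster'' (Var ''j'')) (Var (l # ''m'')))
                  (Set (l # ''m'') (Plus (Var (l # ''m'')) (Num 1))))))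
         (Assign (l # ''cr'') (Var ''j'') (Num 0))"
  let ?body = "Seq (Set ''fa'' (Num 0)) (Seq (Set ''fb'' (Num 0)) (Seq (Set ''fc'' (Num 0))
     (Seq (For ''c'' (Var ''n'') ?find) ?record)))"
  have unch1: "unchanged ?V \<sigma> \<tau>" if "unchanged (insert ''j'' (writes ?body)) ?\<sigma>1 \<tau>" for \<tau>
    using that unfolding unchanged_def by auto
  have env': "env \<tau>" if "unchanged ?V \<sigma> \<tau>" for \<tau>
    using env that by (rule env_unchanged) auto
  \<comment> \<open>The crossing colours met among the first \<open>m\<close> points; exactly these
    are numbered by then.\<close>
  let ?S = "\<lambda>m. cl ` {..<m} \<inter> Cross U V"
  let ?I = "\<lambda>m \<tau>. (\<forall>j<m. \<tau> (l # ''cr'') j = of_bool (cl j \<in> Cross U V)) \<and>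
    bij_betw (\<tau> (l # ''ix'')) (?S m) {..<\<tau> (l # ''m'') 0}"
  have Un: "U \<subseteq> {..<n}" "V \<subseteq> {..<n}" using U V by (auto simp: side_def)
  have Sn: "?S n = Cross U V" using Un by (auto simp: Cross_def)
  have "ok x (For ''j'' (Var ''n'') ?body) ?\<sigma>1 (T - 1)
    (\<lambda>\<tau>. (\<forall>j<n. \<tau> (l # ''cr'') j = of_bool (cl j \<in> Cross U V)) \<and>
      bij_betw (\<tau> (l # ''ix'')) (Cross U V) {..<\<tau> (l # ''m'') 0})"
  proof (rule ok_For[where I = ?I and N = n and T = "n * 9 + 10"])
    show "?I 0 (?\<sigma>1(''j'' := (?\<sigma>1 ''j'')(0 := 0)))" by (simp add: bij_betw_def)
  next
    fix m \<tau>
    assume m: "m < n" and I: "?I m \<tau>" and j: "\<tau> ''j'' 0 = m" and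
      "unchanged (insert ''j'' (writes ?body)) ?\<sigma>1 \<tau>"
    then have unch: "unchanged ?V \<sigma> \<tau>" by (intro unch1)
    let ?\<tau>1 = "\<tau>(''fa'' := (\<tau> ''fa'')(0 := 0))"
    let ?\<tau>2 = "?\<tau>1(''fb'' := (?\<tau>1 ''fb'')(0 := 0))"
    let ?\<tau>3 = "?\<tau>2(''fc'' := (?\<tau>2 ''fc'')(0 := 0))"
    define A where "A e = {c. c < e \<and> cl c = cl m}" for e
    have A_Suc: "A (Suc e) = (if cl e = cl m then insert e (A e) else A e)" for e
      by (auto simp: A_def less_Suc_eq)
    let ?J = "\<lambda>e \<rho>. unchanged {''c'', ''fa'', ''fb'', ''fc''} \<tau> \<rho> \<and>
      \<rho> ''fa'' 0 = of_bool (A e \<inter> U \<noteq> {}) \<and> \<rho> ''fb'' 0 = of_bool (A e \<inter> V \<noteq> {}) \<and>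
      \<rho> ''fc'' 0 = of_bool (A e \<inter> {..<m} \<noteq> {})"
    have inner: "ok x (For ''c'' (Var ''n'') ?find) ?\<tau>3 (n * 9 + 2) (?J n)"
    proof (rule ok_For[where I = ?J and N = n and T = 7])
      show "?J 0 (?\<tau>3(''c'' := (?\<tau>3 ''c'')(0 := 0)))" by (simp add: A_def unchanged_def)
    next
      fix \<rho> assume "unchanged (insert ''c'' (writes ?find)) ?\<tau>3 \<rho>"
      then have "\<rho> ''n'' = \<tau> ''n''" by (simp add: unchanged_def)
      then show "aval (Var ''n'') \<rho> = n" using env'[OF unch] by (simp add: env_def)
    next
      fix e \<rho> assume e: "e < n" and J: "?J e \<rho>" and c: "\<rho> ''c'' 0 = e"
      then have eq: "\<rho> ''cluster'' = \<tau> ''cluster''" "\<rho> (l # ''sd'') = \<tau> (l # ''sd'')" "\<rho> ''j'' 0 = m"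
        using j by (simp_all add: unchanged_def)
      have cl: "\<tau> ''cluster'' e = cl e" "\<tau> ''cluster'' m = cl m"
        using env'[OF unch] e m by (auto simp: env_def)
      have sd: "\<tau> (l # ''sd'') = \<sigma> (l # ''sd'')" using unch by (simp add: unchanged_def)
      have UV: "e \<in> U \<longleftrightarrow> \<sigma> (l # ''sd'') e = 1" "e \<in> V \<longleftrightarrow> \<sigma> (l # ''sd'') e = 2"
        using e U V by (auto simp: side_def)
      show "ok x ?find \<rho> 7 (\<lambda>\<rho>. ?J (Suc e) (\<rho>(''c'' := (\<rho> ''c'')(0 := Suc e))))"
      proof (cases "cl e = cl m")
        case True
        have ins: "A (Suc e) \<inter> S \<noteq> {} \<longleftrightarrow> e \<in> S \<or> A e \<inter> S \<noteq> {}" for S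
          using A_Suc[of e] True by auto
        show ?thesis
          unfolding ins
          using J True
          by (cases "e \<in> U"; cases "e \<in> V"; cases "e < m")
             (simp_all add: ok_simps eq c j cl sd UV unchanged_upd)
      next
        case False
        then have "A (Suc e) = A e" using A_Suc by simp
        then show ?thesis using J False by (simp add: ok_simps eq c j cl unchanged_upd)
      qed
    qed (auto)
    have rec_ok: "ok x ?record \<rho> 5 (\<lambda>\<rho>. ?I (Suc m) (\<rho>(''j'' := (\<rho> ''j'')(0 := Suc m))))"
      if J: "?J n \<rho>" for \<rho>
    proof -
        have eq: "\<rho> ''cluster'' m = cl m" "\<rho> (l # ''cr'') = \<tau> (l # ''cr'')"
          "\<rho> (l # ''ix'') = \<tau> (l # ''ix'')" "\<rho> (l # ''m'') = \<tau> (l # ''m'')" "\<rho> ''j'' 0 = m"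
          using J j env'[OF unch] m by (simp_all add: unchanged_def env_def)
        have AU: "A n \<inter> U \<noteq> {} \<longleftrightarrow> cl m \<in> cl ` U" if that: "U \<subseteq> {..<n}" for U
        proof -
          have "A n \<inter> U = {c \<in> U. cl c = cl m}" using that unfolding A_def by blast
          then show ?thesis by (auto simp: image_iff eq_commute[of "cl m"])
        qed
        have cross: "A n \<inter> U \<noteq> {} \<and> A n \<inter> V \<noteq> {} \<longleftrightarrow> cl m \<in> Cross U V"
          by (simp add: AU[OF Un(1)] AU[OF Un(2)] Cross_def)
        have new: "A n \<inter> {..<m} \<noteq> {} \<longleftrightarrow> cl m \<in> cl ` {..<m}"
          using m by (intro AU) auto
        show ?thesis
        proof (cases "cl m \<in> Cross U V")
          case False
          then have "?S (Suc m) = ?S m" by (auto simp: lessThan_Suc)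
          then show ?thesis using J I False cross by (auto simp: ok_simps eq less_Suc_eq)
        next
          case True
          then have f: "\<rho> ''fa'' 0 = 1" "\<rho> ''fb'' 0 = 1" using J cross by auto
          show ?thesis
          proof (cases "cl m \<in> cl ` {..<m}")
            case old: True
            then have "?S (Suc m) = ?S m" by (auto simp: lessThan_Suc)
            moreover have "\<rho> ''fc'' 0 = 1" using J old new by auto
            ultimately show ?thesis using I True f by (auto simp: ok_simps eq less_Suc_eq)
          next
            case False
            then have S: "?S (Suc m) = insert (cl m) (?S m)" using True by (auto simp: lessThan_Suc)
            have "\<rho> ''fc'' 0 = 0" using J False new by auto
            moreover have "bij_betw ((\<tau> (l # ''ix''))(cl m := \<tau> (l # ''m'') 0)) (?S (Suc m))
                {..<Suc (\<tau> (l # ''m'') 0)}"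
              unfolding S using I False by (intro bij_betw_upd) auto
            ultimately show ?thesis using I True f by (auto simp: ok_simps eq less_Suc_eq)
          qed
        qed
    qed
    have "ok x (Seq (For ''c'' (Var ''n'') ?find) ?record) ?\<tau>3 (n * 9 + 7)
      (\<lambda>\<rho>. ?I (Suc m) (\<rho>(''j'' := (\<rho> ''j'')(0 := Suc m))))"
      by (rule ok_Seq[OF ok_mono[OF inner order_refl rec_ok]]) simp_all
    then show "ok x ?body \<tau> (n * 9 + 10) (\<lambda>\<rho>. ?I (Suc m) (\<rho>(''j'' := (\<rho> ''j'')(0 := Suc m))))"
      unfolding ok_Seq_Assign aval.simps by (intro conjI; (elim ok_mono)?) simp_all
  next
    fix \<tau> assume "unchanged (insert ''j'' (writes ?body)) ?\<sigma>1 \<tau>"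
    then show "aval (Var ''n'') \<tau> = n" using env'[OF unch1] by (simp add: env_def)
  qed (use T Sn in \<open>auto simp: algebra_simps\<close>)
  then show ?thesis using T by (simp add: collect_def ok_simps)
qed

lemma ok_select:
  assumes env: "env \<sigma>" and T: "n * 7 + 5 \<le> T"
    and U: "U = side l 1 \<sigma>" and V: "V = side l 2 \<sigma>"
    and cr: "\<And>j. j < n \<Longrightarrow> \<sigma> (l # ''cr'') j = of_bool (cl j \<in> Cross U V)"
    and D: "D = {c \<in> Cross U V. \<sigma> (l # ''sel'') (\<sigma> (l # ''ix'') c) > 0}"
  shows "ok x (select l) \<sigma> T (\<lambda>\<tau>. \<tau> (l # ''ka'') 0 = set_encode (without U D) \<and>
    \<tau> (l # ''kb'') 0 = set_encode (without V (Cross U V - D)) \<and> \<tau> (l # ''r'') 0 = lost U V D \<and>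
    (\<forall>j<n. \<tau> (l # ''q'') j = of_bool (j \<in> without U D)))"
proof -
  let ?V = "{l # ''ka'', l # ''kb'', l # ''r'', l # ''q'', ''j''}"
  let ?\<sigma>1 = "\<sigma>(l # ''ka'' := (\<sigma> (l # ''ka''))(0 := 0))"
  let ?\<sigma>2 = "?\<sigma>1(l # ''kb'' := (?\<sigma>1 (l # ''kb''))(0 := 0))"
  let ?\<sigma>3 = "?\<sigma>2(l # ''r'' := (?\<sigma>2 (l # ''r''))(0 := 0))"
  let ?body = "Seq (Assign (l # ''q'') (Var ''j'') (Num 0))
         (If (Eq (Cell (l # ''sd'') (Var ''j'')) (Num 1))
           (If (And (Less (Num 0) (Cell (l # ''cr'') (Var ''j'')))
                    (Less (Num 0) (Cell (l # ''sel'') (Cell (l # ''ix'') (Cell ''cluster'' (Var ''j''))))))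
             (Set (l # ''r'') (Plus (Var (l # ''r'')) (Num 1)))
             (Seq (Set (l # ''ka'') (Plus (Var (l # ''ka'')) (Cell ''pow2'' (Var ''j''))))
                  (Assign (l # ''q'') (Var ''j'') (Num 1))))
           (If (Eq (Cell (l # ''sd'') (Var ''j'')) (Num 2))
             (If (And (Less (Num 0) (Cell (l # ''cr'') (Var ''j'')))
                      (Eq (Cell (l # ''sel'') (Cell (l # ''ix'') (Cell ''cluster'' (Var ''j'')))) (Num 0)))
               (Set (l # ''r'') (Plus (Var (l # ''r'')) (Num 1)))
               (Set (l # ''kb'') (Plus (Var (l # ''kb'')) (Cell ''pow2'' (Var ''j'')))))
             Skip))"
  have unch1: "unchanged ?V \<sigma> \<tau>" if "unchanged (insert ''j'' (writes ?body)) ?\<sigma>3 \<tau>" for \<tau>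
    using that unfolding unchanged_def by auto
  have env': "env \<tau>" if "unchanged ?V \<sigma> \<tau>" for \<tau>
    using env that by (rule env_unchanged) auto
  have Un: "U \<subseteq> {..<n}" "V \<subseteq> {..<n}" using U V by (auto simp: side_def)
  let ?A = "without U D" and ?B = "without V (Cross U V - D)"
  let ?E = "{j\<in>U. cl j \<in> D}" and ?F = "{j\<in>V. cl j \<in> Cross U V - D}"
  let ?I = "\<lambda>m \<tau>. \<tau> (l # ''ka'') 0 = set_encode (?A \<inter> {..<m}) \<and>
    \<tau> (l # ''kb'') 0 = set_encode (?B \<inter> {..<m}) \<and>
    \<tau> (l # ''r'') 0 = card (?E \<inter> {..<m}) + card (?F \<inter> {..<m}) \<and>
    (\<forall>j<m. \<tau> (l # ''q'') j = of_bool (j \<in> ?A))"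
  have "ok x (For ''j'' (Var ''n'') ?body) ?\<sigma>3 (n * 7 + 2) (?I n)"
  proof (rule ok_For[where I = ?I and N = n and T = 5])
    show "?I 0 (?\<sigma>3(''j'' := (?\<sigma>3 ''j'')(0 := 0)))" by simp
  next
    fix m \<tau>
    assume m: "m < n" and I: "?I m \<tau>" and j: "\<tau> ''j'' 0 = m" and
      "unchanged (insert ''j'' (writes ?body)) ?\<sigma>3 \<tau>"
    then have unch: "unchanged ?V \<sigma> \<tau>" by (intro unch1)
    then have eq: "\<tau> (l # ''sd'') = \<sigma> (l # ''sd'')" "\<tau> (l # ''cr'') = \<sigma> (l # ''cr'')"
      "\<tau> (l # ''sel'') = \<sigma> (l # ''sel'')" "\<tau> (l # ''ix'') = \<sigma> (l # ''ix'')"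
      by (simp_all add: unchanged_def)
    have cl: "\<tau> ''cluster'' m = cl m" "\<tau> ''pow2'' m = 2 ^ m"
      using env'[OF unch] m by (auto simp: env_def)
    have sd: "\<sigma> (l # ''sd'') m = 1 \<longleftrightarrow> m \<in> U" "\<sigma> (l # ''sd'') m = 2 \<longleftrightarrow> m \<in> V" "\<not> (m \<in> U \<and> m \<in> V)"
      using m U V by (auto simp: side_def)
    have sel: "cl m \<in> Cross U V \<and> \<sigma> (l # ''sel'') (\<sigma> (l # ''ix'') (cl m)) > 0 \<longleftrightarrow> cl m \<in> D"
      "D \<subseteq> Cross U V"
      by (auto simp: D)
    show "ok x ?body \<tau> 5 (\<lambda>\<rho>. ?I (Suc m) (\<rho>(''j'' := (\<rho> ''j'')(0 := Suc m))))"
    proof -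
      \<comment> \<open>Lost on the low side, kept there, lost on the high side, kept there, on
        neither side. Each case fixes all memberships by which the partial results advance.\<close>
      consider "m \<in> U" "m \<notin> V" "cl m \<in> D" "m \<notin> ?A" "m \<notin> ?B" "m \<in> ?E" "m \<notin> ?F"
        | "m \<in> U" "m \<notin> V" "cl m \<notin> D" "m \<in> ?A" "m \<notin> ?B" "m \<notin> ?E" "m \<notin> ?F"
        | "m \<notin> U" "m \<in> V" "cl m \<in> Cross U V - D" "m \<notin> ?A" "m \<notin> ?B" "m \<notin> ?E" "m \<in> ?F"
        | "m \<notin> U" "m \<in> V" "cl m \<notin> Cross U V - D" "m \<notin> ?A" "m \<in> ?B" "m \<notin> ?E" "m \<notin> ?F"
        | "m \<notin> U" "m \<notin> V" "m \<notin> ?A" "m \<notin> ?B" "m \<notin> ?E" "m \<notin> ?F"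
        using sd(3) by (auto simp: without_def)
      then show ?thesis
      proof cases
        case 1
        then have "\<sigma> (l # ''cr'') m > 0" "\<sigma> (l # ''sel'') (\<sigma> (l # ''ix'') (cl m)) > 0"
          using sel cr[OF m] by auto
        then show ?thesis
          using I 1 sd by (auto simp: ok_simps eq j cl set_encode_Int_Suc card_Int_Suc less_Suc_eq)
      next
        case 2
        then have "\<not> (\<sigma> (l # ''cr'') m > 0 \<and> \<sigma> (l # ''sel'') (\<sigma> (l # ''ix'') (cl m)) > 0)"
          using sel cr[OF m] by auto
        then show ?thesis
          using I 2 sd by (auto simp: ok_simps eq j cl set_encode_Int_Suc card_Int_Suc less_Suc_eq)
      next
        case 3
        then have "\<sigma> (l # ''cr'') m > 0" "\<sigma> (l # ''sel'') (\<sigma> (l # ''ix'') (cl m)) = 0"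
          using sel cr[OF m] by auto
        then show ?thesis
          using I 3 sd by (auto simp: ok_simps eq j cl set_encode_Int_Suc card_Int_Suc less_Suc_eq)
      next
        case 4
        then have "\<not> (\<sigma> (l # ''cr'') m > 0 \<and> \<sigma> (l # ''sel'') (\<sigma> (l # ''ix'') (cl m)) = 0)"
          using sel cr[OF m] by auto
        then show ?thesis
          using I 4 sd by (auto simp: ok_simps eq j cl set_encode_Int_Suc card_Int_Suc less_Suc_eq)
      next
        case 5
        then show ?thesis
          using I sd by (auto simp: ok_simps eq j cl set_encode_Int_Suc card_Int_Suc less_Suc_eq)
      qed
    qed
  next
    fix \<tau> assume "unchanged (insert ''j'' (writes ?body)) ?\<sigma>3 \<tau>"
    then show "aval (Var ''n'') \<tau> = n" using env'[OF unch1] by (simp add: env_def)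
  qed auto
  moreover have "?A \<inter> {..<n} = ?A" "?B \<inter> {..<n} = ?B" "?E \<inter> {..<n} = ?E" "?F \<inter> {..<n} = ?F"
    using Un by (auto simp: without_def)
  ultimately have "ok x (For ''j'' (Var ''n'') ?body) ?\<sigma>3 (n * 7 + 2)
    (\<lambda>\<tau>. \<tau> (l # ''ka'') 0 = set_encode ?A \<and> \<tau> (l # ''kb'') 0 = set_encode ?B \<and>
      \<tau> (l # ''r'') 0 = lost U V D \<and> (\<forall>j<n. \<tau> (l # ''q'') j = of_bool (j \<in> ?A)))"
    by (simp add: lost_def)
  then have "ok x (select l) \<sigma> (n * 7 + 5)
    (\<lambda>\<tau>. \<tau> (l # ''ka'') 0 = set_encode ?A \<and> \<tau> (l # ''kb'') 0 = set_encode ?B \<and>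
      \<tau> (l # ''r'') 0 = lost U V D \<and> (\<forall>j<n. \<tau> (l # ''q'') j = of_bool (j \<in> ?A)))"
    by (simp add: select_def ok_simps)
  then show ?thesis by (rule ok_mono) (use T in auto)
qed

end

section \<open>Enumeration of the clusters to give up\<close>

text \<open>Skipping everything when more than \<open>s\<close> clusters cross is what yields the
  factor \<open>2 ^ min s k\<close>. The array \<open>sel\<close> holds the bits of the mask
  \<open>M\<close> and thus selects crossing clusters by number. \<open>c\<close> is the work for
  one choice: the relaxation of an entry at level 1, a single improvement at level 2.\<close>

definition subsets :: "char \<Rightarrow> com \<Rightarrow> com" where
  "subsets l c = Seq (collect l) (If (Less (Var ''s'') (Var (l # ''m''))) Skip
     (For (l # ''M'') (Cell ''pow2'' (Var (l # ''m'')))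
       (Seq (decode ''pow2'' (l # ''sel'') (Num 2) (Var (l # ''m'')) (Var (l # ''M'')))
         (Seq (select l) c))))"

definition subset_vars :: "char \<Rightarrow> name set" where
  "subset_vars l = {l # ''m'', l # ''cr'', l # ''ix'', l # ''M'', l # ''sel'',
     l # ''ka'', l # ''kb'', l # ''r'', l # ''q'',
     ''j'', ''c'', ''fa'', ''fb'', ''fc'', ''rem'', ''b'', ''pos'', ''e''}"

lemma writes_subsets [simp]: "writes (subsets l c) = subset_vars l \<union> writes c"
  by (auto simp: subsets_def subset_vars_def)

context coloured_points
begin

text \<open>\<open>J\<close> is an invariant of the table and \<open>G D\<close> is what the body
  achieves for the choice \<open>D\<close>. As \<open>G D\<close> persists when the table grows, the
  results of all rounds hold together at the end. In this generality the lemma serves both nested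
  levels.\<close>

lemma ok_subsets:
  fixes J :: "(nat \<Rightarrow> nat) \<Rightarrow> bool"
  assumes env: "env \<sigma>" and J: "J (\<sigma> ''tab'')"
    and U: "U = side l 1 \<sigma>" and V: "V = side l 2 \<sigma>"
    and body: "\<And>D \<tau>. D \<subseteq> Cross U V \<Longrightarrow> unchanged (subset_vars l \<union> writes c) \<sigma> \<tau> \<Longrightarrow> env \<tau> \<Longrightarrow>
      J (\<tau> ''tab'') \<Longrightarrow> \<tau> (l # ''ka'') 0 = set_encode (without U D) \<Longrightarrow>
      \<tau> (l # ''kb'') 0 = set_encode (without V (Cross U V - D)) \<Longrightarrow>
      \<tau> (l # ''r'') 0 = lost U V D \<Longrightarrow>
      (\<forall>j<n. \<tau> (l # ''q'') j = of_bool (j \<in> without U D)) \<Longrightarrow>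
      ok x c \<tau> T (\<lambda>\<rho>. J (\<rho> ''tab'') \<and> \<tau> ''tab'' \<le> \<rho> ''tab'' \<and> G D (\<rho> ''tab''))"
    and G: "\<And>D t t'. G D t \<Longrightarrow> t \<le> t' \<Longrightarrow> G D t'"
    and c: "writes c \<inter> {''n'', ''d'', ''s'', ''cluster'', ''pow2'',
      l # ''sd'', l # ''m'', l # ''cr'', l # ''ix'', l # ''M''} = {}"
    and K: "card (Cross U V) \<le> s \<Longrightarrow> 2 ^ card (Cross U V) \<le> K"
    and T': "n * (n * 9 + 12) + 6 + K * (n * 23 + 10 + T) \<le> T'"
  shows "ok x (subsets l c) \<sigma> T' (\<lambda>\<tau>. J (\<tau> ''tab'') \<and> \<sigma> ''tab'' \<le> \<tau> ''tab'' \<and>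
    (card (Cross U V) \<le> s \<longrightarrow> (\<forall>D\<subseteq>Cross U V. G D (\<tau> ''tab''))))"
proof -
  let ?C = "Cross U V"
  let ?W = "subset_vars l \<union> writes c"
  have W: "?W \<inter> {''n'', ''d'', ''s'', ''cluster'', ''pow2'', l # ''sd''} = {}"
    using c by (auto simp: subset_vars_def)
  have env': "env \<tau>" if "unchanged ?W \<sigma> \<tau>" for \<tau>
    using env that by (rule env_unchanged) (use W in blast)
  have Un: "U \<subseteq> {..<n}" "V \<subseteq> {..<n}" using U V by (auto simp: side_def)
  then have finU: "finite U" using finite_subset by blast
  then have finC: "finite ?C" by (simp add: Cross_def)
  \<comment> \<open>The number of crossing colours must not exceed \<open>n\<close>, the last index
    at which \<open>pow2\<close> is known.\<close>
  have "card ?C \<le> card U" using finU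
    by (metis Cross_def Int_lower1 card_image_le card_mono finite_imageI le_trans)
  also have "\<dots> \<le> n" using card_mono[OF _ Un(1)] by simp
  finally have Cn: "card ?C \<le> n" .
  let ?inner = "Seq (decode ''pow2'' (l # ''sel'') (Num 2) (Var (l # ''m'')) (Var (l # ''M'')))
         (Seq (select l) c)"
  let ?for = "For (l # ''M'') (Cell ''pow2'' (Var (l # ''m''))) ?inner"
  let ?Q = "\<lambda>\<tau>. J (\<tau> ''tab'') \<and> \<sigma> ''tab'' \<le> \<tau> ''tab'' \<and>
    (card ?C \<le> s \<longrightarrow> (\<forall>D\<subseteq>?C. G D (\<tau> ''tab'')))"
  have rest: "ok x (If (Less (Var ''s'') (Var (l # ''m''))) Skip ?for) \<sigma>1 (3 + K * (n * 23 + 10 + T)) ?Q"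
    if cr: "\<forall>j<n. \<sigma>1 (l # ''cr'') j = of_bool (cl j \<in> ?C)"
      and ix: "bij_betw (\<sigma>1 (l # ''ix'')) ?C {..<\<sigma>1 (l # ''m'') 0}"
      and un1: "unchanged (writes (collect l)) \<sigma> \<sigma>1" for \<sigma>1
  proof -
    let ?m = "\<sigma>1 (l # ''m'') 0" and ?ix = "\<sigma>1 (l # ''ix'')"
    have m: "?m = card ?C" using bij_betw_same_card[OF ix] by simp
    have un1': "unchanged ?W \<sigma> \<sigma>1" using un1 by (auto simp: unchanged_def subset_vars_def)
    have unW: "unchanged ?W \<sigma> \<tau>" if "unchanged ?W \<sigma>1 \<tau>" for \<tau>
      using un1' that unfolding unchanged_def by simp
    have s1: "\<sigma>1 ''s'' 0 = s" using env'[OF un1'] by (simp add: env_def)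
    have tab1: "\<sigma>1 ''tab'' = \<sigma> ''tab''" using un1 by (simp add: unchanged_def)
    show ?thesis
    proof (cases "card ?C \<le> s")
      case False
      then show ?thesis using J tab1 by (simp add: ok_simps m s1)
    next
      case True
      \<comment> \<open>Bit \<open>?ix c\<close> of the mask decides on the colour \<open>c\<close>;
        since \<open>?ix\<close> is a bijection onto the bit positions, every choice has a
        mask.\<close>
      define DM where "DM M = {c \<in> ?C. M div 2 ^ (?ix c) mod 2 > 0}" for M :: nat
      have DM_all: "\<exists>M<2 ^ ?m. DM M = D" if "D \<subseteq> ?C" for D
      proof -
        have "of_bool (b \<in> ?ix ` D) < (2 :: nat)" for b by simp
        then obtain M :: nat where M: "M < 2 ^ ?m" "\<forall>b<?m. M div 2 ^ b mod 2 = of_bool (b \<in> ?ix ` D)"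
          using digits_exist[of ?m "\<lambda>b. of_bool (b \<in> ?ix ` D)" 2] by blast
        have "c \<in> DM M \<longleftrightarrow> c \<in> D" if "c \<in> ?C" for c
        proof -
          have "?ix c < ?m" using ix that by (auto simp: bij_betw_def)
          moreover have "?ix c \<in> ?ix ` D \<longleftrightarrow> c \<in> D"
            using ix that \<open>D \<subseteq> ?C\<close> by (metis bij_betw_def inj_on_image_mem_iff)
          ultimately show ?thesis using M(2) that by (simp add: DM_def)
        qed
        then have "DM M = D" using \<open>D \<subseteq> ?C\<close> unfolding DM_def by blast
        then show ?thesis using M(1) by blast
      qed
      let ?I = "\<lambda>M \<tau>. J (\<tau> ''tab'') \<and> \<sigma> ''tab'' \<le> \<tau> ''tab'' \<and> (\<forall>M'<M. G (DM M') (\<tau> ''tab''))"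
      have mM: "l # ''M'' \<notin> writes ?inner" using c by (auto simp: subset_vars_def)
      have Kle: "2 ^ ?m \<le> K" using K[OF True] m by simp
      have "ok x ?for \<sigma>1 (2 + K * (n * 23 + 10 + T)) ?Q"
      proof (rule ok_For[where I = ?I and N = "2 ^ ?m" and T = "n * 23 + 8 + T"])
        fix \<tau> assume "unchanged (insert (l # ''M'') (writes ?inner)) \<sigma>1 \<tau>"
        then have un: "unchanged ?W \<sigma>1 \<tau>" and "\<tau> (l # ''m'') = \<sigma>1 (l # ''m'')"
          using c by (auto simp: unchanged_def subset_vars_def)
        then show "aval (Cell ''pow2'' (Var (l # ''m''))) \<tau> = 2 ^ ?m"
          using env'[OF unW[OF un]] Cn m by (simp add: env_def)
      next
        show "?I 0 (\<sigma>1((l # ''M'') := (\<sigma>1 (l # ''M''))(0 := 0)))" using J tab1 by simp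
      next
        fix M \<tau> assume M: "M < 2 ^ ?m" and I: "?I M \<tau>" and Mv: "\<tau> (l # ''M'') 0 = M"
          and un0: "unchanged (insert (l # ''M'') (writes ?inner)) \<sigma>1 \<tau>"
        then have un: "unchanged ?W \<sigma> \<tau>" by (intro unW) (auto simp: unchanged_def subset_vars_def)
        have eq: "\<tau> (l # ''m'') = \<sigma>1 (l # ''m'')" "\<tau> (l # ''ix'') = ?ix"
          "\<tau> (l # ''cr'') = \<sigma>1 (l # ''cr'')" using un0 c by (auto simp: unchanged_def)
        let ?dec = "decode ''pow2'' (l # ''sel'') (Num 2) (Var (l # ''m'')) (Var (l # ''M''))"
        let ?R = "\<lambda>\<rho>. ?I (Suc M) (\<rho>((l # ''M'') := (\<rho> (l # ''M''))(0 := Suc M)))"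
        have body': "ok x c \<rho> T ?R"
          if un2: "unchanged (writes (select l)) \<rho>1 \<rho>" and un1: "unchanged (writes ?dec) \<tau> \<rho>1"
            and post: "\<rho> (l # ''ka'') 0 = set_encode (without U (DM M)) \<and>
              \<rho> (l # ''kb'') 0 = set_encode (without V (?C - DM M)) \<and> \<rho> (l # ''r'') 0 = lost U V (DM M) \<and>
              (\<forall>j<n. \<rho> (l # ''q'') j = of_bool (j \<in> without U (DM M)))" for \<rho> \<rho>1
        proof -
          have "unchanged ?W \<sigma> \<rho>"
            using un un1 un2 by (auto simp: unchanged_def subset_vars_def)
          moreover have tab: "\<rho> ''tab'' = \<tau> ''tab''" using un1 un2 by (simp add: unchanged_def)
          ultimately have "ok x c \<rho> T (\<lambda>\<rho>'. J (\<rho>' ''tab'') \<and> \<rho> ''tab'' \<le> \<rho>' ''tab'' \<and> G (DM M) (\<rho>' ''tab''))"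
            using post I env' by (intro body) (auto simp: DM_def)
          then show ?thesis
          proof (rule ok_mono)
            fix \<rho>' assume r: "J (\<rho>' ''tab'') \<and> \<rho> ''tab'' \<le> \<rho>' ''tab'' \<and> G (DM M) (\<rho>' ''tab'')"
            have "G (DM M') (\<rho>' ''tab'')" if M': "M' < Suc M" for M'
            proof (cases "M' = M")
              case False
              then have "G (DM M') (\<tau> ''tab'')" using M' I by simp
              then show ?thesis by (rule G) (use r tab in simp)
            qed (use r in simp)
            moreover have "\<sigma> ''tab'' \<le> \<tau> ''tab''" "\<tau> ''tab'' \<le> \<rho>' ''tab''" using r I tab by simp_all
            then have "\<sigma> ''tab'' \<le> \<rho>' ''tab''" by (rule order_trans)
            ultimately show "?R \<rho>'" using r by simp
          qed simp
        qed
        have sel: "ok x (Seq (select l) c) \<rho>1 (n * 7 + 5 + T) ?R"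
          if un1: "unchanged (writes ?dec) \<tau> \<rho>1"
            and dec: "\<forall>b<?m. \<rho>1 (l # ''sel'') b = M div 2 ^ b mod 2" for \<rho>1
        proof -
          have un\<rho>: "unchanged ?W \<sigma> \<rho>1" using un un1 by (auto simp: unchanged_def subset_vars_def)
          then have sd: "\<rho>1 (l # ''sd'') = \<sigma> (l # ''sd'')" using W by (auto simp: unchanged_def)
          have eq1: "\<rho>1 (l # ''ix'') = ?ix" "\<rho>1 (l # ''cr'') = \<sigma>1 (l # ''cr'')"
            using un1 eq by (auto simp: unchanged_def)
          have "\<And>c. c \<in> ?C \<Longrightarrow> ?ix c < ?m" using ix by (auto simp: bij_betw_def)
          then have D: "DM M = {c \<in> ?C. \<rho>1 (l # ''sel'') (\<rho>1 (l # ''ix'') c) > 0}"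
            using dec unfolding DM_def eq1 by auto
          have sel_ok: "ok x (select l) \<rho>1 (n * 7 + 5) (\<lambda>\<rho>. \<rho> (l # ''ka'') 0 = set_encode (without U (DM M)) \<and>
              \<rho> (l # ''kb'') 0 = set_encode (without V (?C - DM M)) \<and> \<rho> (l # ''r'') 0 = lost U V (DM M) \<and>
              (\<forall>j<n. \<rho> (l # ''q'') j = of_bool (j \<in> without U (DM M))))"
            using U V sd cr eq1 D env'[OF un\<rho>] by (intro ok_select) (auto simp: side_def)
          show ?thesis
            by (rule ok_Seq[OF ok_mono[OF ok_frame[OF sel_ok] order_refl]], erule conjE, erule body'[OF _ un1])
              simp_all
        qed
        \<comment> \<open>At most \<open>n\<close> binary digits, at \<open>2 * 5 + 6\<close> steps
          each.\<close>
        have dec_ok: "ok x ?dec \<tau> (n * 16 + 3) (\<lambda>\<rho>. \<forall>b<?m. \<rho> (l # ''sel'') b = M div 2 ^ b mod 2)"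
          using M Mv eq(1) env'[OF un] Cn m
          by (intro ok_decode) (auto simp: unchanged_def env_def)
        show "ok x ?inner \<tau> (n * 23 + 8 + T) ?R"
          by (rule ok_Seq[OF ok_mono[OF ok_frame[OF dec_ok] order_refl]], erule conjE, erule sel) simp_all
      next
        fix \<tau> assume I: "?I (2 ^ ?m) \<tau>"
        show "?Q \<tau>"
        proof (intro conjI impI allI)
          fix D assume "D \<subseteq> ?C"
          then obtain M where "M < 2 ^ ?m" "DM M = D" using DM_all by blast
          then show "G D (\<tau> ''tab'')" using I by blast
        qed (use I in auto)
      next
        have "2 ^ ?m * (n * 23 + 10 + T) \<le> K * (n * 23 + 10 + T)" using Kle by (rule mult_le_mono1)
        then show "2 ^ ?m * (n * 23 + 8 + T + 2) + 2 \<le> 2 + K * (n * 23 + 10 + T)"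
          by (simp add: algebra_simps)
      qed (use mM in auto)
      then show ?thesis using True by (simp add: ok_If m s1)
    qed
  qed
  have coll: "ok x (collect l) \<sigma> (n * (n * 9 + 12) + 3)
    (\<lambda>\<tau>. (\<forall>j<n. \<tau> (l # ''cr'') j = of_bool (cl j \<in> ?C)) \<and>
      bij_betw (\<tau> (l # ''ix'')) ?C {..<\<tau> (l # ''m'') 0})"
    using env U V by (intro ok_collect) auto
  show ?thesis
    unfolding subsets_def
    by (rule ok_Seq[OF ok_mono[OF ok_frame[OF coll] order_refl]], elim conjE, erule (2) rest) (use T' in simp)
qed

end

text \<open>By the strict comparison entries only grow, and a candidate 0, which stands for no
  solution, is never written. The key \<open>1ka\<close> belongs to the point set chosen at level 1,
  also while the cuts of level 2 are tried.\<close>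

definition improve :: "aexp \<Rightarrow> com" where
  "improve e = If (Less (Cell ''tab'' (Var ''1ka'')) e) (Assign ''tab'' (Var ''1ka'') e) Skip"

lemma writes_improve [simp]: "writes (improve e) = {''tab''}"
  by (simp add: improve_def)

text \<open>The colour to keep is named by a representative point \<open>t\<close>, which replaces a
  loop over clusters by one over points.\<close>

definition keep :: com where
  "keep = For ''t'' (Var ''n'') (Seq (Set ''cnt'' (Num 0)) (Seq
     (For ''j'' (Var ''n'')
       (If (And (Less (Num 0) (Cell ''1q'' (Var ''j'')))
                (Not (Eq (Cell ''cluster'' (Var ''j'')) (Cell ''cluster'' (Var ''t'')))))
         (Set ''cnt'' (Plus (Var ''cnt'') (Num 1))) Skip))
     (improve (Minus (Plus (Var ''s'') (Num 1)) (Var ''cnt'')))))"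

lemma writes_keep [simp]: "writes keep = {''t'', ''cnt'', ''j'', ''tab''}"
  by (auto simp: keep_def)

definition partition :: com where
  "partition = For ''j'' (Var ''n'') (If (Less (Num 0) (Cell ''1q'' (Var ''j'')))
     (If (CoordLe (Var ''j'') (Var ''i'') (Var ''t'') (Var ''i''))
       (Assign ''2sd'' (Var ''j'') (Num 1)) (Assign ''2sd'' (Var ''j'') (Num 2)))
     (Assign ''2sd'' (Var ''j'') (Num 0)))"

lemma writes_partition [simp]: "writes partition = {''j'', ''2sd''}"
  by (auto simp: partition_def)

definition cut_value :: aexp where
  "cut_value = Minus (Plus (Cell ''tab'' (Var ''2ka'')) (Cell ''tab'' (Var ''2kb'')))
     (Plus (Plus (Var ''s'') (Num 1)) (Var ''2r''))"

definition cuts :: com where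
  "cuts = For ''i'' (Var ''d'') (For ''t'' (Var ''n'')
     (Seq partition (subsets (CHR ''2'') (improve cut_value))))"

lemma writes_cuts [simp]: "writes cuts = {''i'', ''t'', ''2sd'', ''tab''} \<union> subset_vars (CHR ''2'')"
  by (auto simp: cuts_def subset_vars_def)

text \<open>Marking the whole complement as side 2 makes the clusters crossing at level 1 those
  split by the border of the box.\<close>

definition fill_box :: com where
  "fill_box = For ''j'' (Var ''n'') (Seq (Assign ''1sd'' (Var ''j'') (Num 1))
     (For ''i'' (Var ''d'')
       (If (And (CoordLe (Cell ''dig'' (Var ''i'')) (Var ''i'') (Var ''j'') (Var ''i''))
                (CoordLe (Var ''j'') (Var ''i'') (Cell ''dig'' (Plus (Var ''d'') (Var ''i''))) (Var ''i'')))
         Skip (Assign ''1sd'' (Var ''j'') (Num 2)))))"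

lemma writes_fill_box [simp]: "writes fill_box = {''j'', ''i'', ''1sd''}"
  by (auto simp: fill_box_def)

text \<open>The base \<open>n\<close> digits of the counter \<open>v\<close> are the
  \<open>2 * d\<close> bounds. A box given by several tuples of bounds is simply treated several
  times.\<close>

definition sweep :: com where
  "sweep = For ''v'' (Cell ''pwn'' (Plus (Var ''d'') (Var ''d'')))
     (Seq (decode ''pwn'' ''dig'' (Var ''n'') (Plus (Var ''d'') (Var ''d'')) (Var ''v''))
     (Seq fill_box (subsets (CHR ''1'') (Seq keep cuts))))"

text \<open>The counterpart of \<open>ok_subsets\<close> for counted loops: results that persist
  when the table grows accumulate over the rounds.\<close>

lemma ok_For_table:
  fixes J :: "(nat \<Rightarrow> nat) \<Rightarrow> bool"
  assumes "\<And>\<tau>. unchanged (insert i (writes c)) \<sigma> \<tau> \<Longrightarrow> aval e \<tau> = N"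
    and i: "i \<notin> insert ''tab'' (writes c)"
    and J: "J (\<sigma> ''tab'')"
    and step: "\<And>m \<tau>. m < N \<Longrightarrow> J (\<tau> ''tab'') \<Longrightarrow> \<tau> i 0 = m \<Longrightarrow>
      unchanged (insert i (writes c)) \<sigma> \<tau> \<Longrightarrow>
      ok x c \<tau> T (\<lambda>\<rho>. J (\<rho> ''tab'') \<and> \<tau> ''tab'' \<le> \<rho> ''tab'' \<and> G m (\<rho> ''tab''))"
    and G: "\<And>m t t'. G m t \<Longrightarrow> t \<le> t' \<Longrightarrow> G m t'"
    and T': "N * (T + 2) + 2 \<le> T'"
  shows "ok x (For i e c) \<sigma> T' (\<lambda>\<tau>. J (\<tau> ''tab'') \<and> \<sigma> ''tab'' \<le> \<tau> ''tab'' \<and> (\<forall>m<N. G m (\<tau> ''tab'')))"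
proof (rule ok_For[OF assms(1) _ _ _ _ T',
    where I = "\<lambda>m \<tau>. J (\<tau> ''tab'') \<and> \<sigma> ''tab'' \<le> \<tau> ''tab'' \<and> (\<forall>m'<m. G m' (\<tau> ''tab''))"])
  have i': "i \<noteq> ''tab''" using i by simp
  fix m \<tau>
  assume I: "J (\<tau> ''tab'') \<and> \<sigma> ''tab'' \<le> \<tau> ''tab'' \<and> (\<forall>m'<m. G m' (\<tau> ''tab''))"
    and "m < N" "\<tau> i 0 = m" "unchanged (insert i (writes c)) \<sigma> \<tau>"
  then have "ok x c \<tau> T (\<lambda>\<rho>. J (\<rho> ''tab'') \<and> \<tau> ''tab'' \<le> \<rho> ''tab'' \<and> G m (\<rho> ''tab''))"
    by (intro step) auto
  then show "ok x c \<tau> T (\<lambda>\<rho>. J ((\<rho>(i := (\<rho> i)(0 := Suc m))) ''tab'') \<and>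
    \<sigma> ''tab'' \<le> (\<rho>(i := (\<rho> i)(0 := Suc m))) ''tab'' \<and>
    (\<forall>m'<Suc m. G m' ((\<rho>(i := (\<rho> i)(0 := Suc m))) ''tab'')))"
  proof (rule ok_mono)
    fix \<rho> assume r: "J (\<rho> ''tab'') \<and> \<tau> ''tab'' \<le> \<rho> ''tab'' \<and> G m (\<rho> ''tab'')"
    have "G m' (\<rho> ''tab'')" if "m' < Suc m" for m'
    proof (cases "m' = m")
      case False
      then have "G m' (\<tau> ''tab'')" using I that by simp
      then show ?thesis by (rule G) (use r in simp)
    qed (use r in simp)
    moreover have "\<sigma> ''tab'' \<le> \<tau> ''tab''" "\<tau> ''tab'' \<le> \<rho> ''tab''" using r I by simp_all
    then have "\<sigma> ''tab'' \<le> \<rho> ''tab''" by (rule order_trans)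
    ultimately show "J ((\<rho>(i := (\<rho> i)(0 := Suc m))) ''tab'') \<and>
      \<sigma> ''tab'' \<le> (\<rho>(i := (\<rho> i)(0 := Suc m))) ''tab'' \<and>
      (\<forall>m'<Suc m. G m' ((\<rho>(i := (\<rho> i)(0 := Suc m))) ''tab''))"
      using r not_sym[OF i'] by simp
  qed simp
qed (use i J in auto)

section \<open>Effect of one sweep on the table\<close>

context coloured_points
begin

definition above :: "(nat \<Rightarrow> nat) \<Rightarrow> (nat \<Rightarrow> nat) \<Rightarrow> bool" where
  "above tab0 tab \<longleftrightarrow> sound tab \<and> tab0 \<le> tab"

lemma above_upd:
  assumes "above tab0 tab" "tab q < v" "sound (tab(q := v))"
  shows "above tab0 (tab(q := v))"
  using assms unfolding above_def le_fun_def by (auto intro: order_trans less_imp_le)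

lemma ok_improve_above:
  assumes "\<sigma> ''1ka'' 0 = q" "aval e \<sigma> = v" "above tab0 (\<sigma> ''tab'')"
    "v > 0 \<Longrightarrow> sound ((\<sigma> ''tab'')(q := v))" "2 \<le> T"
  shows "ok x (improve e) \<sigma> T (\<lambda>\<tau>. above tab0 (\<tau> ''tab'') \<and> \<sigma> ''tab'' \<le> \<tau> ''tab'' \<and> v \<le> \<tau> ''tab'' q)"
proof (cases "\<sigma> ''tab'' q < v")
  case True
  moreover have "above tab0 ((\<sigma> ''tab'')(q := v))" using True assms by (intro above_upd) auto
  ultimately show ?thesis using assms(1,2,5) by (auto simp: improve_def ok_simps le_fun_def)
qed (use assms in \<open>auto simp: improve_def ok_simps\<close>)

lemma ok_keep:
  assumes env: "env \<sigma>" and J: "above tab0 (\<sigma> ''tab'')" and Q: "Q \<subseteq> {..<n}"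
    and q: "\<forall>j<n. \<sigma> ''1q'' j = of_bool (j \<in> Q)" and key: "\<sigma> ''1ka'' 0 = set_encode Q"
    and T: "n * (n * 4 + 7) + 2 \<le> T"
  shows "ok x keep \<sigma> T (\<lambda>\<tau>. above tab0 (\<tau> ''tab'') \<and> \<sigma> ''tab'' \<le> \<tau> ''tab'' \<and>
    (\<forall>t<n. cand_keep Q t \<le> \<tau> ''tab'' (set_encode Q)))"
  unfolding keep_def
proof (rule ok_For_table[where T = "n * 4 + 5"])
  let ?count = "If (And (Less (Num 0) (Cell ''1q'' (Var ''j'')))
                (Not (Eq (Cell ''cluster'' (Var ''j'')) (Cell ''cluster'' (Var ''t'')))))
         (Set ''cnt'' (Plus (Var ''cnt'') (Num 1))) Skip"
  let ?imp = "improve (Minus (Plus (Var ''s'') (Num 1)) (Var ''cnt''))"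
  let ?body = "Seq (Set ''cnt'' (Num 0)) (Seq (For ''j'' (Var ''n'') ?count) ?imp)"
  have env': "env \<tau>" if "unchanged {''t'', ''cnt'', ''j'', ''tab''} \<sigma> \<tau>" for \<tau>
    using env that by (rule env_unchanged) auto
  fix t \<tau>
  assume t: "t < n" and J: "above tab0 (\<tau> ''tab'')" and tv: "\<tau> ''t'' 0 = t"
    and "unchanged (insert ''t'' (writes ?body)) \<sigma> \<tau>"
  then have un: "unchanged {''t'', ''cnt'', ''j'', ''tab''} \<sigma> \<tau>" by (auto simp: unchanged_def)
  let ?\<tau>1 = "\<tau>(''cnt'' := (\<tau> ''cnt'')(0 := 0))"
  let ?S = "{j\<in>Q. cl j \<noteq> cl t}"
  have "ok x (For ''j'' (Var ''n'') ?count) ?\<tau>1 (n * 4 + 2) (\<lambda>\<rho>. \<rho> ''cnt'' 0 = card (?S \<inter> {..<n}))"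
  proof (rule ok_For[where I = "\<lambda>m \<rho>. \<rho> ''cnt'' 0 = card (?S \<inter> {..<m})" and N = n and T = 2])
    fix \<rho> assume "unchanged (insert ''j'' (writes ?count)) ?\<tau>1 \<rho>"
    then have "\<rho> ''n'' = \<tau> ''n''" by (simp add: unchanged_def)
    then show "aval (Var ''n'') \<rho> = n" using env'[OF un] by (simp add: env_def)
  next
    fix m \<rho> assume m: "m < n" and I: "\<rho> ''cnt'' 0 = card (?S \<inter> {..<m})" and j: "\<rho> ''j'' 0 = m"
      and un1: "unchanged (insert ''j'' (writes ?count)) ?\<tau>1 \<rho>"
    have "\<rho> ''cluster'' = \<tau> ''cluster''" "\<rho> ''1q'' = \<tau> ''1q''" "\<rho> ''t'' 0 = t"
      using un1 tv by (simp_all add: unchanged_def)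
    moreover have "\<tau> ''cluster'' m = cl m" "\<tau> ''cluster'' t = cl t"
      using env'[OF un] m t by (simp_all add: env_def)
    moreover have "\<tau> ''1q'' m = of_bool (m \<in> Q)" using un q m by (simp add: unchanged_def)
    ultimately show "ok x ?count \<rho> 2 (\<lambda>\<rho>. (\<rho>(''j'' := (\<rho> ''j'')(0 := Suc m))) ''cnt'' 0 = card (?S \<inter> {..<Suc m}))"
      using I j by (auto simp: ok_simps card_Int_Suc)
  qed simp_all
  moreover have "?S \<inter> {..<n} = ?S" using Q by auto
  ultimately have count: "ok x (For ''j'' (Var ''n'') ?count) ?\<tau>1 (n * 4 + 2) (\<lambda>\<rho>. \<rho> ''cnt'' 0 = card ?S)"
    by simp
  have imp: "ok x ?imp \<rho> 2 (\<lambda>\<rho>'. above tab0 (\<rho>' ''tab'') \<and> \<tau> ''tab'' \<le> \<rho>' ''tab'' \<and>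
      cand_keep Q t \<le> \<rho>' ''tab'' (set_encode Q))"
    if c: "\<rho> ''cnt'' 0 = card ?S" and un1: "unchanged (writes (For ''j'' (Var ''n'') ?count)) ?\<tau>1 \<rho>" for \<rho>
  proof -
    have tab: "\<rho> ''tab'' = \<tau> ''tab''" "\<rho> ''s'' = \<tau> ''s''" "\<rho> ''1ka'' = \<tau> ''1ka''"
      using un1 by (simp_all add: unchanged_def)
    have "\<tau> ''s'' 0 = s" "\<tau> ''1ka'' 0 = set_encode Q"
      using env'[OF un] un key by (simp_all add: env_def unchanged_def)
    then show ?thesis unfolding tab(1)[symmetric] using J Q c tab
      by (intro ok_improve_above sound_keep) (simp_all add: cand_keep_def above_def)
  qed
  have "ok x (Seq (For ''j'' (Var ''n'') ?count) ?imp) ?\<tau>1 (n * 4 + 4)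
    (\<lambda>\<rho>'. above tab0 (\<rho>' ''tab'') \<and> \<tau> ''tab'' \<le> \<rho>' ''tab'' \<and> cand_keep Q t \<le> \<rho>' ''tab'' (set_encode Q))"
    by (rule ok_Seq[OF ok_mono[OF ok_frame[OF count] order_refl]], erule conjE, erule (1) imp) simp
  then show "ok x ?body \<tau> (n * 4 + 5)
    (\<lambda>\<rho>'. above tab0 (\<rho>' ''tab'') \<and> \<tau> ''tab'' \<le> \<rho>' ''tab'' \<and> cand_keep Q t \<le> \<rho>' ''tab'' (set_encode Q))"
    unfolding ok_Seq_Assign aval.simps by (intro conjI; (elim ok_mono)?) simp_all
next
  fix \<tau> assume "unchanged (insert ''t'' (writes (Seq (Set ''cnt'' (Num 0)) (Seq
     (For ''j'' (Var ''n'')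
       (If (And (Less (Num 0) (Cell ''1q'' (Var ''j'')))
                (Not (Eq (Cell ''cluster'' (Var ''j'')) (Cell ''cluster'' (Var ''t'')))))
         (Set ''cnt'' (Plus (Var ''cnt'') (Num 1))) Skip))
     (improve (Minus (Plus (Var ''s'') (Num 1)) (Var ''cnt''))))))) \<sigma> \<tau>"
  then have "\<tau> ''n'' = \<sigma> ''n''" by (simp add: unchanged_def)
  then show "aval (Var ''n'') \<tau> = n" using env by (simp add: env_def)
qed (use J T in \<open>auto simp: le_fun_def algebra_simps intro: order_trans\<close>)

lemma ok_partition:
  assumes env: "env \<sigma>" and q: "\<forall>j<n. \<sigma> ''1q'' j = of_bool (j \<in> Q)" and Q: "Q \<subseteq> {..<n}"
    and i: "\<sigma> ''i'' 0 = i" and t: "\<sigma> ''t'' 0 = t" and T: "n * 5 + 2 \<le> T"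
  shows "ok x partition \<sigma> T (\<lambda>\<tau>. low Q i t = side (CHR ''2'') 1 \<tau> \<and> high Q i t = side (CHR ''2'') 2 \<tau>)"
  unfolding partition_def
proof (rule ok_For[where I = "\<lambda>m \<rho>. \<forall>j<m. \<rho> ''2sd'' j =
    (if j \<in> low Q i t then 1 else if j \<in> high Q i t then 2 else 0)" and N = n and T = 3])
  let ?body = "If (Less (Num 0) (Cell ''1q'' (Var ''j'')))
     (If (CoordLe (Var ''j'') (Var ''i'') (Var ''t'') (Var ''i''))
       (Assign ''2sd'' (Var ''j'') (Num 1)) (Assign ''2sd'' (Var ''j'') (Num 2)))
     (Assign ''2sd'' (Var ''j'') (Num 0))"
  {
    fix \<rho> assume "unchanged (insert ''j'' (writes ?body)) \<sigma> \<rho>"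
    then have "\<rho> ''n'' = \<sigma> ''n''" by (simp add: unchanged_def)
    then show "aval (Var ''n'') \<rho> = n" using env by (simp add: env_def)
  next
    fix m \<rho> assume m: "m < n" and I: "\<forall>j<m. \<rho> ''2sd'' j =
        (if j \<in> low Q i t then 1 else if j \<in> high Q i t then 2 else 0)" and j: "\<rho> ''j'' 0 = m"
      and un: "unchanged (insert ''j'' (writes ?body)) \<sigma> \<rho>"
    have eq: "\<rho> ''1q'' m = of_bool (m \<in> Q)" "\<rho> ''i'' 0 = i" "\<rho> ''t'' 0 = t"
      using un q m i t by (simp_all add: unchanged_def)
    show "ok x ?body \<rho> 3 (\<lambda>\<rho>. \<forall>j<Suc m. (\<rho>(''j'' := (\<rho> ''j'')(0 := Suc m))) ''2sd'' j =
        (if j \<in> low Q i t then 1 else if j \<in> high Q i t then 2 else 0))"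
      using I j eq by (auto simp: ok_simps low_def high_def less_Suc_eq)
  next
    fix \<tau> :: store assume I: "\<forall>j<n. \<tau> ''2sd'' j =
        (if j \<in> low Q i t then 1 else if j \<in> high Q i t then 2 else 0)"
    then show "low Q i t = side (CHR ''2'') 1 \<tau> \<and> high Q i t = side (CHR ''2'') 2 \<tau>"
      using Q by (auto simp: side_def low_def high_def split: if_splits)
  }
qed (use T in auto)


lemma cand_cut_mono: "tab0 \<le> tab \<Longrightarrow> cand_cut tab0 U V D \<le> cand_cut tab U V D"
  unfolding cand_cut_def le_fun_def by (intro diff_le_mono add_mono) auto

lemma ok_cuts:
  assumes env: "env \<sigma>" and J: "above tab0 (\<sigma> ''tab'')" and Q: "Q \<subseteq> {..<n}"
    and q: "\<forall>j<n. \<sigma> ''1q'' j = of_bool (j \<in> Q)" and key: "\<sigma> ''1ka'' 0 = set_encode Q"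
    and K: "\<And>U V. U \<subseteq> {..<n} \<Longrightarrow> card (Cross U V) \<le> s \<Longrightarrow> 2 ^ card (Cross U V) \<le> K"
    and T: "d * (n * (n * (n * 9 + 17) + K * (n * 23 + 12) + 10) + 4) + 2 \<le> T"
  shows "ok x cuts \<sigma> T (\<lambda>\<tau>. above tab0 (\<tau> ''tab'') \<and> \<sigma> ''tab'' \<le> \<tau> ''tab'' \<and>
    (\<forall>i<d. \<forall>t<n. card (Cross (low Q i t) (high Q i t)) \<le> s \<longrightarrow>
        (\<forall>D\<subseteq>Cross (low Q i t) (high Q i t).
           cand_cut tab0 (low Q i t) (high Q i t) D \<le> \<tau> ''tab'' (set_encode Q))))"
  unfolding cuts_def
proof (rule ok_For_table)
  let ?step = "Seq partition (subsets (CHR ''2'') (improve cut_value))"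
  let ?W = "{''i'', ''t'', ''2sd'', ''tab''} \<union> subset_vars (CHR ''2'')"
  let ?G = "\<lambda>i t tab. card (Cross (low Q i t) (high Q i t)) \<le> s \<longrightarrow>
        (\<forall>D\<subseteq>Cross (low Q i t) (high Q i t).
           cand_cut tab0 (low Q i t) (high Q i t) D \<le> tab (set_encode Q))"
  have env': "env \<tau>" if "unchanged ?W \<sigma> \<tau>" for \<tau>
    using env that by (rule env_unchanged) (auto simp: subset_vars_def)
  fix i \<tau>
  assume i: "i < d" and J: "above tab0 (\<tau> ''tab'')" and iv: "\<tau> ''i'' 0 = i"
    and "unchanged (insert ''i'' (writes (For ''t'' (Var ''n'') ?step))) \<sigma> \<tau>"
  then have un: "unchanged ?W \<sigma> \<tau>" by (auto simp: unchanged_def subset_vars_def)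
  show "ok x (For ''t'' (Var ''n'') ?step) \<tau> (n * (n * (n * 9 + 17) + K * (n * 23 + 12) + 10) + 2)
     (\<lambda>\<rho>. above tab0 (\<rho> ''tab'') \<and> \<tau> ''tab'' \<le> \<rho> ''tab'' \<and> (\<forall>t<n. ?G i t (\<rho> ''tab'')))"
  proof (rule ok_For_table[where T = "n * (n * 9 + 17) + K * (n * 23 + 12) + 8"])
    fix \<rho> assume "unchanged (insert ''t'' (writes ?step)) \<tau> \<rho>"
    then have "unchanged ?W \<sigma> \<rho>" using un by (auto simp: unchanged_def subset_vars_def)
    then show "aval (Var ''n'') \<rho> = n" using env' by (simp add: env_def)
  next
    fix t \<rho> assume t: "t < n" and J: "above tab0 (\<rho> ''tab'')" and tv: "\<rho> ''t'' 0 = t"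
      and un1: "unchanged (insert ''t'' (writes ?step)) \<tau> \<rho>"
    then have un: "unchanged ?W \<sigma> \<rho>" using un by (auto simp: unchanged_def subset_vars_def)
    let ?U = "low Q i t" and ?V = "high Q i t"
    have "\<rho> ''i'' 0 = i" using un1 iv by (simp add: unchanged_def subset_vars_def)
    moreover have "\<forall>j<n. \<rho> ''1q'' j = of_bool (j \<in> Q)"
      using un q by (simp add: unchanged_def subset_vars_def)
    ultimately have part: "ok x partition \<rho> (n * 5 + 2)
        (\<lambda>\<tau>. ?U = side (CHR ''2'') 1 \<tau> \<and> ?V = side (CHR ''2'') 2 \<tau>)"
      using Q tv env'[OF un] by (intro ok_partition) auto
    have subs: "ok x (subsets (CHR ''2'') (improve cut_value)) \<rho>1
        (n * (n * 9 + 12) + 6 + K * (n * 23 + 10 + 2))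
        (\<lambda>\<rho>'. above tab0 (\<rho>' ''tab'') \<and> \<rho> ''tab'' \<le> \<rho>' ''tab'' \<and> ?G i t (\<rho>' ''tab''))"
      if UV: "?U = side (CHR ''2'') 1 \<rho>1" "?V = side (CHR ''2'') 2 \<rho>1"
        and un1: "unchanged (writes partition) \<rho> \<rho>1" for \<rho>1
    proof -
      have tab: "\<rho>1 ''tab'' = \<rho> ''tab''" using un1 by (simp add: unchanged_def)
      have un2: "unchanged ?W \<sigma> \<rho>1" using un un1 by (auto simp: unchanged_def subset_vars_def)
      show ?thesis
        unfolding tab[symmetric]
      proof (rule ok_subsets[OF env'[OF un2] _ UV, where T = 2])
        show "above tab0 (\<rho>1 ''tab'')" using J tab by simp
      next
        fix D \<tau>
        assume D: "D \<subseteq> Cross ?U ?V" and un3: "unchanged (subset_vars (CHR ''2'') \<union> writes (improve cut_value)) \<rho>1 \<tau>"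
          and e: "env \<tau>" and J: "above tab0 (\<tau> ''tab'')"
          and ka: "\<tau> ''2ka'' 0 = set_encode (without ?U D)"
          and kb: "\<tau> ''2kb'' 0 = set_encode (without ?V (Cross ?U ?V - D))"
          and r: "\<tau> ''2r'' 0 = lost ?U ?V D"
        have "unchanged ?W \<sigma> \<tau>" using un2 un3 by (auto simp: unchanged_def)
        then have "\<tau> ''1ka'' 0 = set_encode Q" using key by (simp add: unchanged_def subset_vars_def)
        moreover have "aval cut_value \<tau> = cand_cut (\<tau> ''tab'') ?U ?V D"
          using ka kb r e by (simp add: cut_value_def cand_cut_def env_def)
        ultimately have "ok x (improve cut_value) \<tau> 2 (\<lambda>\<rho>'. above tab0 (\<rho>' ''tab'') \<and> \<tau> ''tab'' \<le> \<rho>' ''tab'' \<and>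
            cand_cut (\<tau> ''tab'') ?U ?V D \<le> \<rho>' ''tab'' (set_encode Q))"
          using J Q i D by (intro ok_improve_above sound_cut) (auto simp: above_def)
        then show "ok x (improve cut_value) \<tau> 2 (\<lambda>\<rho>'. above tab0 (\<rho>' ''tab'') \<and> \<tau> ''tab'' \<le> \<rho>' ''tab'' \<and>
            cand_cut tab0 ?U ?V D \<le> \<rho>' ''tab'' (set_encode Q))"
        proof (rule ok_mono)
          fix \<rho>' assume "above tab0 (\<rho>' ''tab'') \<and> \<tau> ''tab'' \<le> \<rho>' ''tab'' \<and>
            cand_cut (\<tau> ''tab'') ?U ?V D \<le> \<rho>' ''tab'' (set_encode Q)"
          \<comment> \<open>The program has used the current table; its candidate dominates the one
            computed from the start of the pass, to which completeness refers.\<close>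
          moreover have "cand_cut tab0 ?U ?V D \<le> cand_cut (\<tau> ''tab'') ?U ?V D"
            using J by (intro cand_cut_mono) (simp add: above_def)
          ultimately show "above tab0 (\<rho>' ''tab'') \<and> \<tau> ''tab'' \<le> \<rho>' ''tab'' \<and>
            cand_cut tab0 ?U ?V D \<le> \<rho>' ''tab'' (set_encode Q)" by linarith
        qed simp
      next
        show "cand_cut tab0 ?U ?V D \<le> t' (set_encode Q)"
          if "cand_cut tab0 ?U ?V D \<le> t (set_encode Q)" "t \<le> t'" for D t t'
          using that by (auto simp: le_fun_def intro: order_trans)
      next
        show "2 ^ card (Cross ?U ?V) \<le> K" if "card (Cross ?U ?V) \<le> s"
          using that Q by (intro K) (auto simp: low_def)
      qed auto
    qed
    show "ok x ?step \<rho> (n * (n * 9 + 17) + K * (n * 23 + 12) + 8)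
        (\<lambda>\<rho>'. above tab0 (\<rho>' ''tab'') \<and> \<rho> ''tab'' \<le> \<rho>' ''tab'' \<and> ?G i t (\<rho>' ''tab''))"
      by (rule ok_Seq[OF ok_mono[OF ok_frame[OF part] order_refl]], elim conjE, erule (2) subs)
        (simp add: algebra_simps)
  next
    show "?G i m t'" if "?G i m t" "t \<le> t'" for m t t'
      using that unfolding le_fun_def by (meson order_trans)
  qed (use J in \<open>auto simp: subset_vars_def\<close>)
next
  show "\<forall>t<n. card (Cross (low Q i t) (high Q i t)) \<le> s \<longrightarrow>
        (\<forall>D\<subseteq>Cross (low Q i t) (high Q i t).
           cand_cut tab0 (low Q i t) (high Q i t) D \<le> t2 (set_encode Q))"
    if "\<forall>t<n. card (Cross (low Q i t) (high Q i t)) \<le> s \<longrightarrow>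
        (\<forall>D\<subseteq>Cross (low Q i t) (high Q i t).
           cand_cut tab0 (low Q i t) (high Q i t) D \<le> t1 (set_encode Q))" "t1 \<le> t2" for i t1 t2
    using that unfolding le_fun_def by (meson order_trans)
next
  fix \<tau> assume "unchanged (insert ''i'' (writes (For ''t'' (Var ''n'')
     (Seq partition (subsets (CHR ''2'') (improve cut_value)))))) \<sigma> \<tau>"
  then have "\<tau> ''d'' = \<sigma> ''d''" by (simp add: unchanged_def subset_vars_def)
  then show "aval (Var ''d'') \<tau> = d" using env by (simp add: env_def)
qed (use J T in \<open>auto simp: subset_vars_def algebra_simps\<close>)

lemma ok_fill_box:
  assumes env: "env \<sigma>" and T: "n * (d * 4 + 5) + 2 \<le> T"
  shows "ok x fill_box \<sigma> T (\<lambda>\<tau>. box (\<sigma> ''dig'') = side (CHR ''1'') 1 \<tau> \<and>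
    {..<n} - box (\<sigma> ''dig'') = side (CHR ''1'') 2 \<tau>)"
  unfolding fill_box_def
proof (rule ok_For[where I = "\<lambda>m \<rho>. \<forall>j<m. \<rho> ''1sd'' j = (if j \<in> box (\<sigma> ''dig'') then 1 else 2)"
    and N = n and T = "d * 4 + 3"])
  let ?f = "\<sigma> ''dig''"
  let ?test = "If (And (CoordLe (Cell ''dig'' (Var ''i'')) (Var ''i'') (Var ''j'') (Var ''i''))
                (CoordLe (Var ''j'') (Var ''i'') (Cell ''dig'' (Plus (Var ''d'') (Var ''i''))) (Var ''i'')))
         Skip (Assign ''1sd'' (Var ''j'') (Num 2))"
  let ?body = "Seq (Assign ''1sd'' (Var ''j'') (Num 1)) (For ''i'' (Var ''d'') ?test)"
  {
    fix \<rho> assume "unchanged (insert ''j'' (writes ?body)) \<sigma> \<rho>"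
    then have "\<rho> ''n'' = \<sigma> ''n''" by (simp add: unchanged_def)
    then show "aval (Var ''n'') \<rho> = n" using env by (simp add: env_def)
  next
    fix m \<rho> assume m: "m < n" and I: "\<forall>j<m. \<rho> ''1sd'' j = (if j \<in> box ?f then 1 else 2)"
      and j: "\<rho> ''j'' 0 = m" and un: "unchanged (insert ''j'' (writes ?body)) \<sigma> \<rho>"
    let ?P = "\<lambda>i. x (?f i) i \<le> x m i \<and> x m i \<le> x (?f (d + i)) i"
    let ?\<rho>1 = "\<rho>(''1sd'' := (\<rho> ''1sd'')(m := 1))"
    let ?I = "\<lambda>e \<tau>. (\<forall>j<m. \<tau> ''1sd'' j = (if j \<in> box ?f then 1 else 2)) \<and>
      \<tau> ''1sd'' m = (if \<forall>i<e. ?P i then 1 else 2)"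
    have "ok x (For ''i'' (Var ''d'') ?test) ?\<rho>1 (d * 4 + 2)
      (\<lambda>\<tau>. \<forall>j<Suc m. (\<tau>(''j'' := (\<tau> ''j'')(0 := Suc m))) ''1sd'' j = (if j \<in> box ?f then 1 else 2))"
    proof (rule ok_For[where I = ?I and N = d and T = 2])
      fix \<tau> assume "unchanged (insert ''i'' (writes ?test)) ?\<rho>1 \<tau>"
      then have "\<tau> ''d'' = \<sigma> ''d''" using un by (simp add: unchanged_def)
      then show "aval (Var ''d'') \<tau> = d" using env by (simp add: env_def)
    next
      show "?I 0 (?\<rho>1(''i'' := (?\<rho>1 ''i'')(0 := 0)))" using I by simp
    next
      fix e \<tau> assume e: "e < d" and I: "?I e \<tau>" and i: "\<tau> ''i'' 0 = e"
        and un1: "unchanged (insert ''i'' (writes ?test)) ?\<rho>1 \<tau>"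
      have eq: "\<tau> ''dig'' = ?f" "\<tau> ''d'' 0 = d" "\<tau> ''j'' 0 = m"
        using un un1 j env by (simp_all add: unchanged_def env_def)
      have all: "(\<forall>i<Suc e. ?P i) \<longleftrightarrow> (\<forall>i<e. ?P i) \<and> ?P e" by (auto simp: less_Suc_eq)
      show "ok x ?test \<tau> 2 (\<lambda>\<tau>. ?I (Suc e) (\<tau>(''i'' := (\<tau> ''i'')(0 := Suc e))))"
        unfolding all using I by (cases "?P e") (auto simp: ok_simps eq i)
    next
      fix \<tau> :: store assume I: "?I d \<tau>"
      have "m \<in> box ?f \<longleftrightarrow> (\<forall>i<d. ?P i)" using m by (simp add: box_def)
      then show "\<forall>j<Suc m. (\<tau>(''j'' := (\<tau> ''j'')(0 := Suc m))) ''1sd'' j = (if j \<in> box ?f then 1 else 2)"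
        using I by (simp add: less_Suc_eq)
    qed auto
    then show "ok x ?body \<rho> (d * 4 + 3)
      (\<lambda>\<tau>. \<forall>j<Suc m. (\<tau>(''j'' := (\<tau> ''j'')(0 := Suc m))) ''1sd'' j = (if j \<in> box ?f then 1 else 2))"
      unfolding ok_Seq_Assign aval.simps j by (intro conjI; (elim ok_mono)?) simp_all
  next
    fix \<tau> :: store assume I: "\<forall>j<n. \<tau> ''1sd'' j = (if j \<in> box ?f then 1 else 2)"
    then show "box ?f = side (CHR ''1'') 1 \<tau> \<and> {..<n} - box ?f = side (CHR ''1'') 2 \<tau>"
      by (auto simp: side_def box_def split: if_splits)
  }
qed (use T in \<open>auto simp: algebra_simps\<close>)

end

lemma writes_sweep [simp]: "writes sweep = {''v'', ''rem'', ''b'', ''pos'', ''e'', ''dig'', ''j'', ''i'', ''t'',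
    ''1sd'', ''2sd'', ''cnt'', ''tab''} \<union> subset_vars (CHR ''1'') \<union> subset_vars (CHR ''2'')"
  by (auto simp: sweep_def subset_vars_def)

definition keep_time :: "nat \<Rightarrow> nat" where
  "keep_time n = n * (n * 4 + 7) + 2"

definition cuts_time :: "nat \<Rightarrow> nat \<Rightarrow> nat \<Rightarrow> nat" where
  "cuts_time d n K = d * (n * (n * (n * 9 + 17) + K * (n * 23 + 12) + 10) + 4) + 2"

definition box_time :: "nat \<Rightarrow> nat \<Rightarrow> nat \<Rightarrow> nat" where
  "box_time d n K = (d + d) * (n * 5 + 6) + 3 + (n * (d * 4 + 5) + 2) +
     (n * (n * 9 + 12) + 6 + K * (n * 23 + 10 + (keep_time n + cuts_time d n K)))"

definition sweep_time :: "nat \<Rightarrow> nat \<Rightarrow> nat \<Rightarrow> nat" where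
  "sweep_time d n K = n ^ (d + d) * (box_time d n K + 2) + 2"

lemma unchanged_subset: "unchanged V \<sigma> \<tau> \<Longrightarrow> V \<subseteq> U \<Longrightarrow> unchanged U \<sigma> \<tau>"
  by (auto simp: unchanged_def)

context coloured_points
begin

lemma relaxed_mono:
  assumes "relaxed tab0 t Q" "t \<le> t'"
  shows "relaxed tab0 t' Q"
proof -
  have "t (set_encode Q) \<le> t' (set_encode Q)" using assms(2) by (simp add: le_fun_def)
  then show ?thesis using assms(1) unfolding relaxed_def by (meson order_trans)
qed

lemma ok_relax:
  assumes env: "env \<sigma>" and J: "above tab0 (\<sigma> ''tab'')" and Q: "Q \<subseteq> {..<n}"
    and q: "\<forall>j<n. \<sigma> ''1q'' j = of_bool (j \<in> Q)" and key: "\<sigma> ''1ka'' 0 = set_encode Q"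
    and K: "\<And>U V. U \<subseteq> {..<n} \<Longrightarrow> card (Cross U V) \<le> s \<Longrightarrow> 2 ^ card (Cross U V) \<le> K"
  shows "ok x (Seq keep cuts) \<sigma> (keep_time n + cuts_time d n K)
    (\<lambda>\<tau>. above tab0 (\<tau> ''tab'') \<and> \<sigma> ''tab'' \<le> \<tau> ''tab'' \<and> relaxed tab0 (\<tau> ''tab'') Q)"
proof (rule ok_Seq[OF ok_mono[OF ok_frame[OF ok_keep[OF assms(1-5) order_refl]] order_refl]])
  fix \<tau> assume *: "(above tab0 (\<tau> ''tab'') \<and> \<sigma> ''tab'' \<le> \<tau> ''tab'' \<and>
    (\<forall>t<n. cand_keep Q t \<le> \<tau> ''tab'' (set_encode Q))) \<and> unchanged (writes keep) \<sigma> \<tau>"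
  then have "env \<tau>" using env_unchanged[OF env] by auto
  then have "ok x cuts \<tau> (cuts_time d n K) (\<lambda>\<rho>. above tab0 (\<rho> ''tab'') \<and> \<tau> ''tab'' \<le> \<rho> ''tab'' \<and>
    (\<forall>i<d. \<forall>t<n. card (Cross (low Q i t) (high Q i t)) \<le> s \<longrightarrow>
        (\<forall>D\<subseteq>Cross (low Q i t) (high Q i t).
           cand_cut tab0 (low Q i t) (high Q i t) D \<le> \<rho> ''tab'' (set_encode Q))))"
    using * q key by (intro ok_cuts[OF _ _ Q _ _ K]) (simp_all add: unchanged_def cuts_time_def)
  then show "ok x cuts \<tau> (cuts_time d n K)
    (\<lambda>\<rho>. above tab0 (\<rho> ''tab'') \<and> \<sigma> ''tab'' \<le> \<rho> ''tab'' \<and> relaxed tab0 (\<rho> ''tab'') Q)"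
  proof (rule ok_mono)
    fix \<rho> assume r: "above tab0 (\<rho> ''tab'') \<and> \<tau> ''tab'' \<le> \<rho> ''tab'' \<and>
      (\<forall>i<d. \<forall>t<n. card (Cross (low Q i t) (high Q i t)) \<le> s \<longrightarrow>
        (\<forall>D\<subseteq>Cross (low Q i t) (high Q i t).
           cand_cut tab0 (low Q i t) (high Q i t) D \<le> \<rho> ''tab'' (set_encode Q)))"
    then have "\<tau> ''tab'' (set_encode Q) \<le> \<rho> ''tab'' (set_encode Q)" by (simp add: le_fun_def)
    then have "relaxed tab0 (\<rho> ''tab'') Q"
      using * r unfolding relaxed_def by (meson order_trans)
    moreover have "\<sigma> ''tab'' \<le> \<rho> ''tab''" using * r by (meson order_trans)
    ultimately show "above tab0 (\<rho> ''tab'') \<and> \<sigma> ''tab'' \<le> \<rho> ''tab'' \<and> relaxed tab0 (\<rho> ''tab'') Q"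
      using r by simp
  qed simp
qed (simp add: keep_time_def)

lemma ok_sweep:
  assumes env: "env \<sigma>" and n: "n > 0" and J: "above tab0 (\<sigma> ''tab'')"
    and pw: "\<forall>b\<le>d + d. \<sigma> ''pwn'' b = n ^ b"
    and K: "\<And>U V. U \<subseteq> {..<n} \<Longrightarrow> card (Cross U V) \<le> s \<Longrightarrow> 2 ^ card (Cross U V) \<le> K"
  shows "ok x sweep \<sigma> (sweep_time d n K) (\<lambda>\<tau>. above tab0 (\<tau> ''tab'') \<and>
    (\<forall>A D. box_closed A \<longrightarrow> card (Cross A ({..<n} - A)) \<le> s \<longrightarrow> D \<subseteq> Cross A ({..<n} - A) \<longrightarrow>
      relaxed tab0 (\<tau> ''tab'') (without A D)))"
proof -
  let ?dec = "decode ''pwn'' ''dig'' (Var ''n'') (Plus (Var ''d'') (Var ''d'')) (Var ''v'')"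
  let ?subs = "subsets (CHR ''1'') (Seq keep cuts)"
  let ?body = "Seq ?dec (Seq fill_box ?subs)"
  let ?W = "writes sweep"
  have W: "v \<notin> ?W" if "v \<in> {''n'', ''d'', ''s'', ''cluster'', ''pow2'', ''pwn''}" for v
    using that by (auto simp: subset_vars_def)
  have env': "env \<tau>" if "unchanged ?W \<sigma> \<tau>" for \<tau>
    using env that by (rule env_unchanged) (use W in blast)
  have pw': "\<forall>b\<le>d + d. \<tau> ''pwn'' b = n ^ b" if "unchanged ?W \<sigma> \<tau>" for \<tau>
    using that pw W[of "''pwn''"] by (simp add: unchanged_def)
  have sub: "insert ''v'' (writes ?body) \<subseteq> ?W" "writes ?dec \<subseteq> ?W" "writes fill_box \<subseteq> ?W"
    "subset_vars (CHR ''1'') \<union> writes (Seq keep cuts) \<subseteq> ?W" "''v'' \<in> ?W"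
    by (auto simp: sweep_def)
  define B where "B w = box (\<lambda>b. w div n ^ b mod n)" for w
  have Bn: "B w \<subseteq> {..<n}" for w by (auto simp: B_def box_def)
  let ?G = "\<lambda>w tab. card (Cross (B w) ({..<n} - B w)) \<le> s \<longrightarrow>
    (\<forall>D\<subseteq>Cross (B w) ({..<n} - B w). relaxed tab0 tab (without (B w) D))"
  have "ok x sweep \<sigma> (sweep_time d n K) (\<lambda>\<tau>. above tab0 (\<tau> ''tab'') \<and> \<sigma> ''tab'' \<le> \<tau> ''tab'' \<and>
    (\<forall>w<n ^ (d + d). ?G w (\<tau> ''tab'')))"
    unfolding sweep_def
  proof (rule ok_For_table[where T = "box_time d n K"])
    fix \<tau> assume "unchanged (insert ''v'' (writes ?body)) \<sigma> \<tau>"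
    then have un: "unchanged ?W \<sigma> \<tau>" using sub(1) by (rule unchanged_subset)
    have "\<tau> ''d'' 0 = d" using env'[OF un] by (simp add: env_def)
    then show "aval (Cell ''pwn'' (Plus (Var ''d'') (Var ''d''))) \<tau> = n ^ (d + d)"
      using pw'[OF un] by simp
  next
    fix w \<tau> assume w: "w < n ^ (d + d)" and J: "above tab0 (\<tau> ''tab'')" and v: "\<tau> ''v'' 0 = w"
      and un0: "unchanged (insert ''v'' (writes ?body)) \<sigma> \<tau>"
    have un: "unchanged ?W \<sigma> \<tau>" using un0 sub(1) by (rule unchanged_subset)
    let ?R = "\<lambda>\<rho>. above tab0 (\<rho> ''tab'') \<and> \<tau> ''tab'' \<le> \<rho> ''tab'' \<and> ?G w (\<rho> ''tab'')"
    have subs: "ok x ?subs \<rho> (n * (n * 9 + 12) + 6 + K * (n * 23 + 10 + (keep_time n + cuts_time d n K))) ?R"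
      if un1: "unchanged ?W \<sigma> \<rho>" and tab: "\<rho> ''tab'' = \<tau> ''tab''"
        and UV: "B w = side (CHR ''1'') 1 \<rho>" "{..<n} - B w = side (CHR ''1'') 2 \<rho>" for \<rho>
      unfolding tab[symmetric]
    proof (rule ok_subsets[OF env'[OF un1] _ UV, where T = "keep_time n + cuts_time d n K"])
      show "above tab0 (\<rho> ''tab'')" using J tab by simp
    next
      fix D \<rho>1 assume "env \<rho>1" "above tab0 (\<rho>1 ''tab'')" "\<rho>1 ''1ka'' 0 = set_encode (without (B w) D)"
        "\<forall>j<n. \<rho>1 ''1q'' j = of_bool (j \<in> without (B w) D)"
      then show "ok x (Seq keep cuts) \<rho>1 (keep_time n + cuts_time d n K)
        (\<lambda>\<rho>2. above tab0 (\<rho>2 ''tab'') \<and> \<rho>1 ''tab'' \<le> \<rho>2 ''tab'' \<and> relaxed tab0 (\<rho>2 ''tab'') (without (B w) D))"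
        using Bn[of w] by (intro ok_relax K) (auto simp: without_def)
    next
      show "writes (Seq keep cuts) \<inter> {''n'', ''d'', ''s'', ''cluster'', ''pow2'',
        CHR ''1'' # ''sd'', CHR ''1'' # ''m'', CHR ''1'' # ''cr'', CHR ''1'' # ''ix'', CHR ''1'' # ''M''} = {}"
        by (simp add: subset_vars_def)
    next
      show "2 ^ card (Cross (B w) ({..<n} - B w)) \<le> K" if "card (Cross (B w) ({..<n} - B w)) \<le> s"
        using that Bn by (intro K)
    qed (auto intro: relaxed_mono)
    have box: "ok x (Seq fill_box ?subs) \<rho> (n * (d * 4 + 5) + 2 +
        (n * (n * 9 + 12) + 6 + K * (n * 23 + 10 + (keep_time n + cuts_time d n K)))) ?R"
      if un1: "unchanged (writes ?dec) \<tau> \<rho>" and dig: "\<forall>b<d + d. \<rho> ''dig'' b = w div n ^ b mod n" for \<rho>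
    proof -
      have un\<rho>: "unchanged ?W \<sigma> \<rho>" using un un1 sub(2) by (rule unchanged_trans[OF _ _ subset_refl])
      have Bd: "B w = box (\<rho> ''dig'')" using dig by (simp add: B_def box_def)
      have tab: "\<rho> ''tab'' = \<tau> ''tab''" using un1 by (simp add: unchanged_def)
      show ?thesis
      proof (rule ok_Seq[OF ok_mono[OF ok_frame[OF ok_fill_box[OF env'[OF un\<rho>] order_refl]] order_refl]])
        fix \<rho>1 assume *: "(box (\<rho> ''dig'') = side (CHR ''1'') 1 \<rho>1 \<and>
          {..<n} - box (\<rho> ''dig'') = side (CHR ''1'') 2 \<rho>1) \<and> unchanged (writes fill_box) \<rho> \<rho>1"
        then have "unchanged (writes fill_box) \<rho> \<rho>1" by simp
        then have "unchanged ?W \<sigma> \<rho>1"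
          using sub(3) by (rule unchanged_trans[OF un\<rho> _ subset_refl])
        moreover have "\<rho>1 ''tab'' = \<tau> ''tab''" using * tab by (simp add: unchanged_def)
        moreover have "B w = side (CHR ''1'') 1 \<rho>1" "{..<n} - B w = side (CHR ''1'') 2 \<rho>1"
          using * unfolding Bd by (rule conjunct1[THEN conjunct1], rule conjunct1[THEN conjunct2])
        ultimately show "ok x ?subs \<rho>1 (n * (n * 9 + 12) + 6 +
            K * (n * 23 + 10 + (keep_time n + cuts_time d n K))) ?R"
          by (rule subs)
      qed simp
    qed
    have dec: "ok x ?dec \<tau> ((d + d) * (n * 5 + 6) + 3) (\<lambda>\<rho>. \<forall>b<d + d. \<rho> ''dig'' b = w div n ^ b mod n)"
      using w v n env'[OF un] pw'[OF un] by (intro ok_decode) (auto simp: unchanged_def env_def)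
    show "ok x ?body \<tau> (box_time d n K) ?R"
      by (rule ok_Seq[OF ok_mono[OF ok_frame[OF dec] order_refl]], erule conjE, erule (1) box[rotated])
        (simp add: box_time_def)
  next
    show "?G m t'" if "?G m t" "t \<le> t'" for m t t'
      using that relaxed_mono by blast
  qed (use J in \<open>auto simp: subset_vars_def sweep_time_def\<close>)
  then show ?thesis
  proof (rule ok_mono)
    fix \<tau> assume t: "above tab0 (\<tau> ''tab'') \<and> \<sigma> ''tab'' \<le> \<tau> ''tab'' \<and> (\<forall>w<n ^ (d + d). ?G w (\<tau> ''tab''))"
    have "relaxed tab0 (\<tau> ''tab'') (without A D)"
      if A: "box_closed A" "card (Cross A ({..<n} - A)) \<le> s" "D \<subseteq> Cross A ({..<n} - A)" for A D
    proof -
      \<comment> \<open>The bounds of \<open>A\<close> can be taken from the points, and every tuple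
        of bounds is the digit sequence of some counter value; so the sweep meets
        \<open>A\<close>.\<close>
      obtain f where f: "\<forall>q<d + d. f q < n" "box f = A" using box_closed_eq_box[OF A(1)] by blast
      then obtain w where w: "w < n ^ (d + d)" "\<forall>b<d + d. w div n ^ b mod n = f b"
        using digits_exist[of "d + d" f n] by blast
      then have "B w = A" unfolding B_def f(2)[symmetric] by (simp add: box_def)
      then show ?thesis using t w(1) A(2,3) by metis
    qed
    then show "above tab0 (\<tau> ''tab'') \<and>
      (\<forall>A D. box_closed A \<longrightarrow> card (Cross A ({..<n} - A)) \<le> s \<longrightarrow> D \<subseteq> Cross A ({..<n} - A) \<longrightarrow>
        relaxed tab0 (\<tau> ''tab'') (without A D))"
      using t by blast
  qed simp
qed

end

section \<open>Stored powers, passes and the answer\<close>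

definition powers2 :: com where
  "powers2 = Seq (Assign ''pow2'' (Num 0) (Num 1)) (For ''j'' (Var ''n'')
     (Assign ''pow2'' (Plus (Var ''j'') (Num 1))
       (Plus (Cell ''pow2'' (Var ''j'')) (Cell ''pow2'' (Var ''j'')))))"

text \<open>In the absence of multiplication, each power is the \<open>n\<close>-fold sum of the
  previous one.\<close>

definition powers_n :: com where
  "powers_n = Seq (Assign ''pwn'' (Num 0) (Num 1)) (For ''j'' (Plus (Var ''d'') (Var ''d''))
     (Seq (Assign ''pwn'' (Plus (Var ''j'') (Num 1)) (Num 0))
       (For ''e'' (Var ''n'') (Assign ''pwn'' (Plus (Var ''j'') (Num 1))
         (Plus (Cell ''pwn'' (Plus (Var ''j'') (Num 1))) (Cell ''pwn'' (Var ''j'')))))))"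

definition answer :: com where
  "answer = Seq (Set ''full'' (Num 0)) (Seq
     (For ''j'' (Var ''n'') (Set ''full'' (Plus (Var ''full'') (Cell ''pow2'' (Var ''j'')))))
     (Set ''out'' (Cell ''tab'' (Var ''full''))))"

text \<open>Without points the answer is yes, while the base \<open>n\<close> of the decoding would
  be 0; hence the case distinction.\<close>

definition program :: com where
  "program = If (Less (Num 0) (Var ''n''))
     (Seq powers2 (Seq powers_n (Seq (For ''pass'' (Var ''n'') sweep) answer)))
     (Set ''out'' (Num 1))"

lemma writes_powers2 [simp]: "writes powers2 = {''pow2'', ''j''}"
  by (auto simp: powers2_def)

lemma writes_powers_n [simp]: "writes powers_n = {''pwn'', ''j'', ''e''}"
  by (auto simp: powers_n_def)

lemma ok_powers2:
  assumes n: "\<sigma> ''n'' 0 = n" and T: "n * 3 + 3 \<le> T"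
  shows "ok x powers2 \<sigma> T (\<lambda>\<tau>. \<forall>j\<le>n. \<tau> ''pow2'' j = 2 ^ j)"
proof -
  let ?\<sigma>1 = "\<sigma>(''pow2'' := (\<sigma> ''pow2'')(0 := 1))"
  let ?step = "Assign ''pow2'' (Plus (Var ''j'') (Num 1))
       (Plus (Cell ''pow2'' (Var ''j'')) (Cell ''pow2'' (Var ''j'')))"
  have "ok x (For ''j'' (Var ''n'') ?step) ?\<sigma>1 (n * 3 + 2) (\<lambda>\<tau>. \<forall>j\<le>n. \<tau> ''pow2'' j = 2 ^ j)"
  proof (rule ok_For[where I = "\<lambda>m \<tau>. \<forall>j\<le>m. \<tau> ''pow2'' j = 2 ^ j" and N = n and T = 1])
    fix m \<tau> assume "\<forall>j\<le>m. \<tau> ''pow2'' j = (2 :: nat) ^ j" "\<tau> ''j'' 0 = m"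
    then show "ok x ?step \<tau> 1 (\<lambda>\<tau>. \<forall>j\<le>Suc m. (\<tau>(''j'' := (\<tau> ''j'')(0 := Suc m))) ''pow2'' j = 2 ^ j)"
      by (auto simp: ok_simps le_Suc_eq)
  qed (use n in \<open>auto simp: unchanged_def\<close>)
  then show ?thesis
    unfolding powers2_def ok_Seq_Assign aval.simps using T by (intro conjI; (elim ok_mono)?) simp_all
qed

lemma ok_powers_n:
  assumes n: "\<sigma> ''n'' 0 = n" and d: "\<sigma> ''d'' 0 = d" and T: "(d + d) * (n * 3 + 5) + 3 \<le> T"
  shows "ok x powers_n \<sigma> T (\<lambda>\<tau>. \<forall>b\<le>d + d. \<tau> ''pwn'' b = n ^ b)"
proof -
  let ?\<sigma>1 = "\<sigma>(''pwn'' := (\<sigma> ''pwn'')(0 := 1))"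
  let ?add = "Assign ''pwn'' (Plus (Var ''j'') (Num 1))
         (Plus (Cell ''pwn'' (Plus (Var ''j'') (Num 1))) (Cell ''pwn'' (Var ''j'')))"
  let ?step = "Seq (Assign ''pwn'' (Plus (Var ''j'') (Num 1)) (Num 0)) (For ''e'' (Var ''n'') ?add)"
  have "ok x (For ''j'' (Plus (Var ''d'') (Var ''d'')) ?step) ?\<sigma>1 ((d + d) * (n * 3 + 5) + 2)
    (\<lambda>\<tau>. \<forall>b\<le>d + d. \<tau> ''pwn'' b = n ^ b)"
  proof (rule ok_For[where I = "\<lambda>m \<tau>. \<forall>b\<le>m. \<tau> ''pwn'' b = n ^ b" and N = "d + d" and T = "n * 3 + 3"])
    fix m \<tau> assume I: "\<forall>b\<le>m. \<tau> ''pwn'' b = n ^ b" and j: "\<tau> ''j'' 0 = m"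
      and un: "unchanged (insert ''j'' (writes ?step)) ?\<sigma>1 \<tau>"
    let ?\<tau>1 = "\<tau>(''pwn'' := (\<tau> ''pwn'')(Suc m := 0))"
    have "ok x (For ''e'' (Var ''n'') ?add) ?\<tau>1 (n * 3 + 2)
      (\<lambda>\<tau>. \<forall>b\<le>Suc m. (\<tau>(''j'' := (\<tau> ''j'')(0 := Suc m))) ''pwn'' b = n ^ b)"
    proof (rule ok_For[where I = "\<lambda>e \<rho>. \<rho> ''j'' 0 = m \<and> (\<forall>b\<le>m. \<rho> ''pwn'' b = n ^ b) \<and>
        \<rho> ''pwn'' (Suc m) = e * n ^ m" and N = n and T = 1])
      fix e \<rho> assume "\<rho> ''j'' 0 = m \<and> (\<forall>b\<le>m. \<rho> ''pwn'' b = n ^ b) \<and> \<rho> ''pwn'' (Suc m) = e * n ^ m"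
      then show "ok x ?add \<rho> 1 (\<lambda>\<rho>. (\<rho>(''e'' := (\<rho> ''e'')(0 := Suc e))) ''j'' 0 = m \<and>
        (\<forall>b\<le>m. (\<rho>(''e'' := (\<rho> ''e'')(0 := Suc e))) ''pwn'' b = n ^ b) \<and>
        (\<rho>(''e'' := (\<rho> ''e'')(0 := Suc e))) ''pwn'' (Suc m) = Suc e * n ^ m)"
        by (auto simp: ok_simps)
    qed (use n un I j in \<open>auto simp: unchanged_def le_Suc_eq\<close>)
    then show "ok x ?step \<tau> (n * 3 + 3) (\<lambda>\<tau>. \<forall>b\<le>Suc m. (\<tau>(''j'' := (\<tau> ''j'')(0 := Suc m))) ''pwn'' b = n ^ b)"
      unfolding ok_Seq_Assign aval.simps j by (intro conjI; (elim ok_mono)?) simp_all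
  qed (use d in \<open>auto simp: unchanged_def algebra_simps\<close>)
  then show ?thesis
    unfolding powers_n_def ok_Seq_Assign aval.simps using T by (intro conjI; (elim ok_mono)?) simp_all
qed

context coloured_points
begin

text \<open>After \<open>p\<close> passes the table is complete for boxes of at most
  \<open>p\<close> points. The zero table is sound, as it claims nothing, and complete for
  \<open>p = 0\<close>, as closed boxes are nonempty.\<close>

lemma ok_passes:
  assumes env: "env \<sigma>" and n: "n > 0" and tab: "\<sigma> ''tab'' = (\<lambda>_. 0)"
    and pw: "\<forall>b\<le>d + d. \<sigma> ''pwn'' b = n ^ b"
    and K: "\<And>U V. U \<subseteq> {..<n} \<Longrightarrow> card (Cross U V) \<le> s \<Longrightarrow> 2 ^ card (Cross U V) \<le> K"
  shows "ok x (For ''pass'' (Var ''n'') sweep) \<sigma> (n * (sweep_time d n K + 2) + 2)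
    (\<lambda>\<tau>. \<tau> ''tab'' (set_encode {..<n}) > 0 \<longleftrightarrow> (\<exists>W\<subseteq>{..<n}. card W \<le> s \<and> expl ({..<n} - W)))"
proof -
  let ?W = "insert ''pass'' (writes sweep)"
  have env': "env \<tau>" if "unchanged ?W \<sigma> \<tau>" for \<tau>
    using env that by (rule env_unchanged) (auto simp: subset_vars_def)
  let ?I = "\<lambda>p \<tau>. sound (\<tau> ''tab'') \<and>
    (\<forall>W\<subseteq>{..<n}. card W \<le> s \<longrightarrow> expl ({..<n} - W) \<longrightarrow> complete W p (\<tau> ''tab''))"
  show ?thesis
  proof (rule ok_For[where I = ?I and N = n and T = "sweep_time d n K"])
    fix \<tau> assume "unchanged ?W \<sigma> \<tau>"
    then have "env \<tau>" by (rule env')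
    then show "aval (Var ''n'') \<tau> = n" by (simp add: env_def)
  next
    have "complete W 0 (\<lambda>_. 0)" for W
      unfolding complete_def
    proof (intro allI impI)
      fix A D assume "box_closed A" "card A \<le> 0"
      moreover have "finite A" if "A \<subseteq> {..<n}" for A using that finite_subset by blast
      ultimately have False by (auto simp: box_closed_def)
      then show "s + 1 \<le> 0 + card (W \<inter> without A D)" ..
    qed
    then show "?I 0 (\<sigma>(''pass'' := (\<sigma> ''pass'')(0 := 0)))" using tab by (simp add: sound_def)
  next
    fix p \<tau> assume I: "?I p \<tau>" and un: "unchanged ?W \<sigma> \<tau>"
    have "\<tau> ''pwn'' = \<sigma> ''pwn''" using un by (simp add: unchanged_def subset_vars_def)
    then have "ok x sweep \<tau> (sweep_time d n K) (\<lambda>\<rho>. above (\<tau> ''tab'') (\<rho> ''tab'') \<and>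
      (\<forall>A D. box_closed A \<longrightarrow> card (Cross A ({..<n} - A)) \<le> s \<longrightarrow> D \<subseteq> Cross A ({..<n} - A) \<longrightarrow>
        relaxed (\<tau> ''tab'') (\<rho> ''tab'') (without A D)))"
      using pw I by (intro ok_sweep[OF env'[OF un] n _ _ K]) (auto simp: above_def)
    then show "ok x sweep \<tau> (sweep_time d n K) (\<lambda>\<rho>. ?I (Suc p) (\<rho>(''pass'' := (\<rho> ''pass'')(0 := Suc p))))"
    proof (rule ok_mono)
      fix \<rho> assume r: "above (\<tau> ''tab'') (\<rho> ''tab'') \<and>
        (\<forall>A D. box_closed A \<longrightarrow> card (Cross A ({..<n} - A)) \<le> s \<longrightarrow> D \<subseteq> Cross A ({..<n} - A) \<longrightarrow>
          relaxed (\<tau> ''tab'') (\<rho> ''tab'') (without A D))"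
      have "complete W (Suc p) (\<rho> ''tab'')"
        if "W \<subseteq> {..<n}" "card W \<le> s" "expl ({..<n} - W)" for W
      proof (rule complete_step[OF that])
        show "complete W p (\<tau> ''tab'')" using I that by blast
      qed (use n r in simp_all)
      then show "?I (Suc p) (\<rho>(''pass'' := (\<rho> ''pass'')(0 := Suc p)))" using r by (simp add: above_def)
    qed simp
  next
    fix \<tau> assume I: "?I n \<tau>"
    show "\<tau> ''tab'' (set_encode {..<n}) > 0 \<longleftrightarrow> (\<exists>W\<subseteq>{..<n}. card W \<le> s \<and> expl ({..<n} - W))"
      using n I by (intro table_decides) simp_all
  qed (simp_all add: subset_vars_def)
qed

lemma ok_answer:
  assumes env: "env \<sigma>"
  shows "ok x answer \<sigma> (n * 3 + 4) (\<lambda>\<tau>. \<tau> ''out'' 0 = \<sigma> ''tab'' (set_encode {..<n}))"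
proof -
  let ?\<sigma>1 = "\<sigma>(''full'' := (\<sigma> ''full'')(0 := 0))"
  let ?add = "Set ''full'' (Plus (Var ''full'') (Cell ''pow2'' (Var ''j'')))"
  let ?out = "Set ''out'' (Cell ''tab'' (Var ''full''))"
  have sum: "ok x (For ''j'' (Var ''n'') ?add) ?\<sigma>1 (n * 3 + 2) (\<lambda>\<tau>. \<tau> ''full'' 0 = set_encode {..<n})"
  proof (rule ok_For[where I = "\<lambda>m \<tau>. \<tau> ''full'' 0 = set_encode {..<m}" and N = n and T = 1])
    fix m \<tau> assume m: "m < n" "\<tau> ''full'' 0 = set_encode {..<m}" "\<tau> ''j'' 0 = m"
      and un: "unchanged (insert ''j'' (writes ?add)) ?\<sigma>1 \<tau>"
    then have "\<tau> ''pow2'' m = 2 ^ m" using env by (simp add: unchanged_def env_def)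
    then show "ok x ?add \<tau> 1 (\<lambda>\<tau>. (\<tau>(''j'' := (\<tau> ''j'')(0 := Suc m))) ''full'' 0 = set_encode {..<Suc m})"
      using m by (simp add: ok_simps lessThan_Suc)
  qed (use env in \<open>auto simp: unchanged_def env_def\<close>)
  have "ok x (Seq (For ''j'' (Var ''n'') ?add) ?out) ?\<sigma>1 (n * 3 + 3)
    (\<lambda>\<tau>. \<tau> ''out'' 0 = \<sigma> ''tab'' (set_encode {..<n}))"
    by (rule ok_Seq[OF ok_mono[OF ok_frame[OF sum] order_refl], where ?T2.0 = 1])
      (simp_all add: ok_simps unchanged_def)
  then show ?thesis
    unfolding answer_def ok_Seq_Assign aval.simps by (intro conjI; (elim ok_mono)?) simp_all
qed

definition main_time :: "nat \<Rightarrow> nat" where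
  "main_time K = (n * 3 + 3) + ((d + d) * (n * 3 + 5) + 3) + (n * (sweep_time d n K + 2) + 2) + (n * 3 + 4)"

lemma ok_program:
  assumes \<sigma>: "\<sigma> ''n'' 0 = n" "\<sigma> ''d'' 0 = d" "\<sigma> ''s'' 0 = s" "\<forall>j<n. \<sigma> ''cluster'' j = cl j"
    "\<sigma> ''tab'' = (\<lambda>_. 0)"
    and n: "n > 0"
    and K: "\<And>U V. U \<subseteq> {..<n} \<Longrightarrow> card (Cross U V) \<le> s \<Longrightarrow> 2 ^ card (Cross U V) \<le> K"
  shows "ok x program \<sigma> (1 + main_time K)
    (\<lambda>\<tau>. \<tau> ''out'' 0 > 0 \<longleftrightarrow> (\<exists>W\<subseteq>{..<n}. card W \<le> s \<and> expl ({..<n} - W)))"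
proof -
  let ?Q = "\<lambda>\<tau>. \<tau> ''out'' 0 > 0 \<longleftrightarrow> (\<exists>W\<subseteq>{..<n}. card W \<le> s \<and> expl ({..<n} - W))"
  let ?passes = "For ''pass'' (Var ''n'') sweep"
  have ans: "ok x answer \<tau> (n * 3 + 4) ?Q"
    if "env \<sigma>1" "unchanged (writes ?passes) \<sigma>1 \<tau>"
      "\<tau> ''tab'' (set_encode {..<n}) > 0 \<longleftrightarrow> (\<exists>W\<subseteq>{..<n}. card W \<le> s \<and> expl ({..<n} - W))" for \<sigma>1 \<tau>
  proof -
    have "env \<tau>" using that(1,2) by (rule env_unchanged) (auto simp: subset_vars_def)
    then show ?thesis by (rule ok_mono[OF ok_answer]) (use that(3) in simp_all)
  qed
  have passes: "ok x (Seq ?passes answer) \<tau> (n * (sweep_time d n K + 2) + 2 + (n * 3 + 4)) ?Q"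
    if e: "env \<tau>" and t: "\<tau> ''tab'' = (\<lambda>_. 0)" and p: "\<forall>b\<le>d + d. \<tau> ''pwn'' b = n ^ b" for \<tau>
    by (rule ok_Seq[OF ok_mono[OF ok_frame[OF ok_passes[OF e n t p K]] order_refl] order_refl])
      (simp_all only:, erule conjE, erule (1) ans[OF e, rotated])
  have pown: "ok x (Seq powers_n (Seq ?passes answer)) \<tau>
      ((d + d) * (n * 3 + 5) + 3 + (n * (sweep_time d n K + 2) + 2 + (n * 3 + 4))) ?Q"
    if e: "env \<tau>" and t: "\<tau> ''tab'' = (\<lambda>_. 0)" for \<tau>
  proof (rule ok_Seq[OF ok_mono[OF ok_frame[OF ok_powers_n[OF _ _ order_refl]] order_refl] order_refl])
    show "\<tau> ''n'' 0 = n" "\<tau> ''d'' 0 = d" using e by (simp_all add: env_def)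
  next
    fix \<rho> assume r: "(\<forall>b\<le>d + d. \<rho> ''pwn'' b = n ^ b) \<and> unchanged (writes powers_n) \<tau> \<rho>"
    then have "env \<rho>" using env_unchanged[OF e] by auto
    moreover have "\<rho> ''tab'' = (\<lambda>_. 0)" using r t by (simp add: unchanged_def)
    ultimately show "ok x (Seq ?passes answer) \<rho> (n * (sweep_time d n K + 2) + 2 + (n * 3 + 4)) ?Q"
      using r by (intro passes) simp_all
  qed
  have "ok x (Seq powers2 (Seq powers_n (Seq ?passes answer))) \<sigma> (main_time K) ?Q"
  proof (rule ok_Seq[OF ok_mono[OF ok_frame[OF ok_powers2[where n = n and \<sigma> = \<sigma>, OF \<sigma>(1) order_refl]] order_refl]])
    fix \<rho> assume r: "(\<forall>j\<le>n. \<rho> ''pow2'' j = 2 ^ j) \<and> unchanged (writes powers2) \<sigma> \<rho>"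
    then have "env \<rho>" "\<rho> ''tab'' = (\<lambda>_. 0)" using \<sigma> by (simp_all add: env_def unchanged_def)
    then show "ok x (Seq powers_n (Seq ?passes answer)) \<rho>
      ((d + d) * (n * 3 + 5) + 3 + (n * (sweep_time d n K + 2) + 2 + (n * 3 + 4))) ?Q"
      by (rule pown)
  qed (simp add: main_time_def)
  then show ?thesis using n \<sigma>(1) by (simp add: program_def ok_If)
qed

end

section \<open>Explainable clusterings as explainable colourings\<close>

lemma points_filter:
  assumes "finite R"
  shows "points X {j\<in>R. P (X ! j)} = filter_mset P (points X R)"
  using assms by (simp add: points_def filter_mset_image_mset filter_mset_mset_set)

lemma points_Un:
  "finite A \<Longrightarrow> finite B \<Longrightarrow> A \<inter> B = {} \<Longrightarrow> points X (A \<union> B) = points X A + points X B"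
  by (simp add: points_def mset_set_Union)

lemma points_empty [simp]: "points X {} = {#}"
  by (simp add: points_def)

text \<open>No element of the sum is repeated, so the summands are disjoint sets. This turns a
  division \<open>P1 + P2\<close> of the parts into a division of the cluster indices.\<close>

lemma mset_set_eq_plusD:
  assumes "mset_set I = M1 + M2"
  shows "M1 = mset_set (set_mset M1)" "M2 = mset_set (set_mset M2)" "set_mset M1 \<inter> set_mset M2 = {}"
proof -
  have c: "count M1 a + count M2 a \<le> 1" for a
  proof -
    have "count M1 a + count M2 a = count (mset_set I) a" using assms by simp
    also have "\<dots> \<le> 1" by (simp add: count_mset_set')
    finally show ?thesis .
  qed
  show "M1 = mset_set (set_mset M1)"
  proof (rule multiset_eqI)
    fix a show "count M1 a = count (mset_set (set_mset M1)) a"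
      using c[of a] by (cases "a \<in># M1") (auto simp: count_mset_set' not_in_iff simp flip: count_greater_zero_iff)
  qed
  show "M2 = mset_set (set_mset M2)"
  proof (rule multiset_eqI)
    fix a show "count M2 a = count (mset_set (set_mset M2)) a"
      using c[of a] by (cases "a \<in># M2") (auto simp: count_mset_set' not_in_iff simp flip: count_greater_zero_iff)
  qed
  show "set_mset M1 \<inter> set_mset M2 = {}"
  proof (rule ccontr)
    assume "set_mset M1 \<inter> set_mset M2 \<noteq> {}"
    then obtain a where "a \<in># M1" "a \<in># M2" by blast
    then have "count M1 a \<ge> 1" "count M2 a \<ge> 1" by (simp_all add: Suc_le_eq)
    then show False using c[of a] by linarith
  qed
qed

lemma explainable_add_empty:
  assumes "explainable d k Z P" "d > 0"
  shows "explainable d (k + 1) Z (P + {#{#}#})"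
proof -
  obtain \<theta> where \<theta>: "\<And>y. y \<in># Z \<Longrightarrow> y ! 0 \<le> \<theta>"
  proof
    fix y assume "y \<in># Z"
    \<comment> \<open>The inserted 0 keeps the maximum meaningful when \<open>Z\<close> is
      empty.\<close>
    then show "y ! 0 \<le> Max (insert 0 ((\<lambda>y. y ! 0) ` set_mset Z))" by (intro Max_ge) auto
  qed
  have "filter_mset (\<lambda>y. y ! 0 \<le> \<theta>) Z = Z"
    using \<theta> by (simp add: filter_mset_eq_conv)
  moreover have "set_mset (filter_mset (\<lambda>y. y ! 0 > \<theta>) Z) = {}"
    using \<theta> by (auto simp: not_less)
  then have "filter_mset (\<lambda>y. y ! 0 > \<theta>) Z = {#}" by (simp only: set_mset_eq_empty_iff)
  ultimately have cut: "Cut 0 \<theta> Z = (Z, {#})" by (simp add: Cut_def)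
  have "k \<ge> 1" using assms(1) by induction auto
  then show ?thesis
    by (rule explainable.cut[OF assms(2) cut _ _ assms(1) explainable.single]) simp
qed

context coloured_points
begin

definition part :: "point list \<Rightarrow> nat set \<Rightarrow> nat \<Rightarrow> point multiset" where
  "part X R i = points X {j\<in>R. cl j = i}"

text \<open>With this, the collection that a subtree received is recovered from its parts.\<close>

lemma sum_part:
  assumes "finite R" "finite I" "cl ` R \<subseteq> I"
  shows "\<Sum>\<^sub># (image_mset (part X R) (mset_set I)) = points X R"
proof -
  have "(\<Sum>i\<in>J. part X R i) = points X {j\<in>R. cl j \<in> J}" if "finite J" for J
    using that
  proof induction
    case (insert i J)
    have "{j\<in>R. cl j \<in> insert i J} = {j\<in>R. cl j = i} \<union> {j\<in>R. cl j \<in> J}" by blast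
    also have "points X \<dots> = part X R i + points X {j\<in>R. cl j \<in> J}"
      unfolding part_def using assms(1) insert.hyps by (intro points_Un) auto
    finally show ?case using insert by simp
  qed simp
  from this[OF assms(2)] show ?thesis
    using assms(3) by (simp add: sum_unfold_sum_mset[symmetric] image_subset_iff cong: conj_cong)
qed

text \<open>Different clusters may have equal multisets of points, so \<open>P1\<close> and
  \<open>P2\<close> do not determine which indices went to which subtree. Any distribution
  compatible with them will do, because the points of the indices assigned to a subtree add up to
  its side of the cut.\<close>

lemma expl_if_explainable:
  assumes "explainable d k Z P" "P = image_mset (part X R) (mset_set I)" "finite I" "finite R" "cl ` R \<subseteq> I"
    and x: "\<And>j i. j \<in> R \<Longrightarrow> i < d \<Longrightarrow> x j i = X ! j ! i"
  shows "expl R"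
  using assms
proof (induction arbitrary: R I rule: explainable.induct)
  case (single Z)
  then have "card I = 1" by (metis size_image_mset size_mset_set size_single)
  then obtain i where "I = {i}" by (rule card_1_singletonE)
  then show ?case using single.prems(4) by (intro expl.mono) auto
next
  case (cut i \<theta> Z Z1 Z2 k1 k2 P1 P2)
  obtain M1 M2 where M: "mset_set I = M1 + M2" "P1 = image_mset (part X R) M1" "P2 = image_mset (part X R) M2"
    using image_mset_eq_plusD cut.prems(1) by metis
  define I1 where "I1 = set_mset M1"
  define I2 where "I2 = set_mset M2"
  have I: "M1 = mset_set I1" "M2 = mset_set I2" "I1 \<inter> I2 = {}"
    unfolding I1_def I2_def by (rule mset_set_eq_plusD[OF M(1)])+
  have "set_mset (mset_set I) = I1 \<union> I2" using M(1) by (simp add: I1_def I2_def)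
  then have IU: "I = I1 \<union> I2" using cut.prems(2) by simp
  have finI: "finite I1" "finite I2" by (simp_all add: I1_def I2_def)
  define R1 where "R1 = {j\<in>R. cl j \<in> I1}"
  define R2 where "R2 = {j\<in>R. cl j \<in> I2}"
  have finR: "finite R1" "finite R2" using cut.prems(3) by (simp_all add: R1_def R2_def)
  have R: "R1 \<union> R2 = R" "R1 \<inter> R2 = {}"
    using cut.prems(4) I(3) unfolding IU R1_def R2_def by blast+
  have sub: "cl ` R1 \<subseteq> I1" "cl ` R2 \<subseteq> I2" by (auto simp: R1_def R2_def)
  have part1: "part X R c = part X R1 c" if "c \<in> I1" for c
    unfolding part_def R1_def using that by (intro arg_cong[where f = "points X"]) blast
  have part2: "part X R c = part X R2 c" if "c \<in> I2" for c
    unfolding part_def R2_def using that by (intro arg_cong[where f = "points X"]) blast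
  have P1: "P1 = image_mset (part X R1) (mset_set I1)"
    unfolding M(2) I(1) using finI part1 by (intro image_mset_cong) simp
  have P2: "P2 = image_mset (part X R2) (mset_set I2)"
    unfolding M(3) I(2) using finI part2 by (intro image_mset_cong) simp
  have Z: "Z1 = filter_mset (\<lambda>y. y ! i \<le> \<theta>) Z" "Z2 = filter_mset (\<lambda>y. y ! i > \<theta>) Z"
    using cut.hyps(2) by (simp_all add: Cut_def)
  \<comment> \<open>Both are the sum of the parts in \<open>P1\<close>.\<close>
  have Z1: "points X R1 = Z1"
    using explainable_is_partition[OF cut.hyps(5)] sum_part[OF finR(1) finI(1) sub(1)] P1 by simp
  have Z2: "points X R2 = Z2"
    using explainable_is_partition[OF cut.hyps(6)] sum_part[OF finR(2) finI(2) sub(2)] P2 by simp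
  have "set_mset (points X R1) = (\<lambda>j. X ! j) ` R1" "set_mset (points X R2) = (\<lambda>j. X ! j) ` R2"
    using finR by (simp_all add: points_def)
  then have lo: "X ! j ! i \<le> \<theta>" if "j \<in> R1" for j
    using that Z(1) Z1 by auto
  have hi: "X ! j ! i > \<theta>" if "j \<in> R2" for j
    using that Z(2) Z2 \<open>set_mset (points X R2) = _\<close> by auto
  have xR: "x j i = X ! j ! i" if "j \<in> R" for j using cut.prems(5) cut.hyps(1) that by simp
  \<comment> \<open>\<open>R1\<close> and \<open>R2\<close> cover \<open>R\<close> and lie on
    different sides of the threshold, so they are the two sides of the cut.\<close>
  have R1: "{j\<in>R. x j i \<le> \<theta>} = R1" and R2: "{j\<in>R. x j i > \<theta>} = R2"
    using lo hi xR R by (force simp: not_le[symmetric])+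
  have "expl R1" using cut.IH(1)[OF P1 finI(1) finR(1) sub(1)] cut.prems(5) R by blast
  moreover have "expl R2" using cut.IH(2)[OF P2 finI(2) finR(2) sub(2)] cut.prems(5) R by blast
  moreover have "cl ` R1 \<inter> cl ` R2 = {}" using sub I(3) by blast
  ultimately show ?case using expl.split[of i R \<theta>] cut.hyps(1) unfolding R1 R2 by blast
qed

text \<open>The number of leaves has to be exactly \<open>card I\<close>. Cuts with an empty side
  are dropped, and indices without points are carried along to a monochromatic set, where they
  become additional empty leaves.\<close>

lemma explainable_if_expl:
  assumes "expl R" "finite I" "I \<noteq> {}" "finite R" "cl ` R \<subseteq> I" "d > 0"
    and x: "\<And>j i. j \<in> R \<Longrightarrow> i < d \<Longrightarrow> x j i = X ! j ! i"
  shows "explainable d (card I) (points X R) (image_mset (part X R) (mset_set I))"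
  using assms
proof (induction arbitrary: I rule: expl.induct)
  case (mono R)
  obtain c where c: "c \<in> I" "cl ` R \<subseteq> {c}"
  proof (cases "R = {}")
    case True
    then show ?thesis using that mono.prems(2) by blast
  next
    case False
    then obtain j where "j \<in> R" by blast
    then show ?thesis using that[of "cl j"] mono.hyps[OF _ \<open>j \<in> R\<close>] mono.prems(4) by blast
  qed
  have Rc: "part X R c = points X R"
    unfolding part_def using c(2) by (intro arg_cong[where f = "points X"]) auto
  have Re: "part X R i = {#}" if "i \<noteq> c" for i
  proof -
    have "{j\<in>R. cl j = i} = {}" using c(2) that by auto
    then show ?thesis by (simp only: part_def points_empty)
  qed
  \<comment> \<open>The leaf of \<open>c\<close> comes first; the other indices of the node have
    empty parts and are attached one at a time.\<close>
  have "explainable d (Suc (card J)) (points X R) (image_mset (part X R) (add_mset c (mset_set J)))"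
    if "finite J" "c \<notin> J" for J
    using that
  proof induction
    case empty
    show ?case using explainable.single[of d "points X R"] Rc by simp
  next
    case (insert i J)
    then have "explainable d (Suc (card J) + 1) (points X R)
        (image_mset (part X R) (add_mset c (mset_set J)) + {#{#}#})"
      using mono.prems(5) by (intro explainable_add_empty) auto
    moreover have "part X R i = {#}" using insert.prems by (intro Re) auto
    ultimately show ?case using insert.hyps by (simp add: add_mset_commute)
  qed
  from this[of "I - {c}"] show ?case
    unfolding mset_set.remove[OF mono.prems(1) c(1), symmetric] card_Suc_Diff1[OF mono.prems(1) c(1)]
    using mono.prems(1) by simp
next
  case (split i R \<theta>)
  let ?L = "{j\<in>R. x j i \<le> \<theta>}" and ?G = "{j\<in>R. x j i > \<theta>}"
  have xR: "x j i = X ! j ! i" if "j \<in> R" for j using split.prems(6) split.hyps(1) that by simp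
  consider "?L = {}" | "?G = {}" | "?L \<noteq> {}" "?G \<noteq> {}" by blast
  then show ?case
  proof cases
    case 1
    then have "?G = R" by (auto simp: not_le)
    then show ?thesis using split.IH(2)[of I] split.prems by simp
  next
    case 2
    then have "?L = R" by (auto simp: not_less)
    then show ?thesis using split.IH(1)[of I] split.prems by simp
  next
    case 3
    \<comment> \<open>Indices without points all go to the high side.\<close>
    define I1 where "I1 = cl ` ?L"
    define I2 where "I2 = I - I1"
    have I: "finite I1" "finite I2" "I1 \<noteq> {}" "I1 \<inter> I2 = {}" "I1 \<union> I2 = I"
      using 3 split.prems(1,3,4) by (auto simp: I1_def I2_def)
    have G2: "cl ` ?G \<subseteq> I2" using split.hyps(2) split.prems(4) unfolding I1_def I2_def by blast
    then have "I2 \<noteq> {}" using 3(2) by blast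
    have L1: "cl ` ?L \<subseteq> I1" by (simp add: I1_def)
    have e1: "explainable d (card I1) (points X ?L) (image_mset (part X ?L) (mset_set I1))"
      using I split.prems L1 by (intro split.IH(1)) auto
    have e2: "explainable d (card I2) (points X ?G) (image_mset (part X ?G) (mset_set I2))"
      using I \<open>I2 \<noteq> {}\<close> split.prems G2 by (intro split.IH(2)) auto
    have p1: "part X ?L c = part X R c" if "c \<in> I1" for c
    proof -
      have "x j i \<le> \<theta>" if "j \<in> R" "cl j = c" for j
        using G2 that \<open>c \<in> I1\<close> I(4) by (force simp: not_le[symmetric])
      then have "{j\<in>?L. cl j = c} = {j\<in>R. cl j = c}" by blast
      then show ?thesis by (simp only: part_def)
    qed
    have p2: "part X ?G c = part X R c" if "c \<in> I2" for c
    proof -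
      have "x j i > \<theta>" if "j \<in> R" "cl j = c" for j
        using L1 that \<open>c \<in> I2\<close> I(4) by (force simp: not_le[symmetric])
      then have "{j\<in>?G. cl j = c} = {j\<in>R. cl j = c}" by blast
      then show ?thesis by (simp only: part_def)
    qed
    have i1: "image_mset (part X ?L) (mset_set I1) = image_mset (part X R) (mset_set I1)"
      using I p1 by (intro image_mset_cong) simp
    have i2: "image_mset (part X ?G) (mset_set I2) = image_mset (part X R) (mset_set I2)"
      using I p2 by (intro image_mset_cong) simp
    have "?L = {j\<in>R. X ! j ! i \<le> \<theta>}" "?G = {j\<in>R. X ! j ! i > \<theta>}" using xR by auto
    then have cut: "Cut i \<theta> (points X R) = (points X ?L, points X ?G)"
      using points_filter[OF split.prems(3), of X "\<lambda>y. y ! i \<le> \<theta>"]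
        points_filter[OF split.prems(3), of X "\<lambda>y. y ! i > \<theta>"] by (simp add: Cut_def)
    have "card I1 \<ge> 1" "card I2 \<ge> 1" using I \<open>I2 \<noteq> {}\<close> by (simp_all add: Suc_leI card_gt_0_iff)
    from explainable.cut[OF split.hyps(1) cut this e1 e2]
    have "explainable d (card I1 + card I2) (points X R)
        (image_mset (part X R) (mset_set I1) + image_mset (part X R) (mset_set I2))"
      by (simp only: i1 i2)
    moreover have "card I1 + card I2 = card I" using I by (metis card_Un_disjoint)
    moreover have "mset_set I1 + mset_set I2 = mset_set I" using I by (metis mset_set_Union)
    ultimately show ?thesis by (metis image_mset_union)
  qed
qed

end

section \<open>Running time and correctness\<close>

definition cluster_of :: "nat \<Rightarrow> point list \<Rightarrow> nat \<Rightarrow> (nat \<Rightarrow> nat set) \<Rightarrow> nat \<Rightarrow> nat" where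
  "cluster_of d X k C = input_store d X k C 0 ''cluster''"

lemma cluster_of_iff:
  assumes "valid_instance d X k C" "j < length X" "i < k"
  shows "cluster_of d X k C j = i \<longleftrightarrow> j \<in> C i"
    and "cluster_of d X k C j < k"
proof -
  have disj: "disjoint_family_on C {..<k}" and U: "(\<Union>i<k. C i) = {..<length X}"
    using assms(1) by (simp_all add: valid_instance_def is_clustering_def)
  obtain i0 where i0: "i0 < k" "j \<in> C i0" using U assms(2) by blast
  have uniq: "i' = i0" if "i' < k" "j \<in> C i'" for i'
    using disj i0 that unfolding disjoint_family_on_def by blast
  have "(THE i. i < k \<and> j \<in> C i) = i0" using i0 uniq by blast
  then have "cluster_of d X k C j = i0" using assms(2) by (simp add: cluster_of_def input_store_def)
  then show "cluster_of d X k C j = i \<longleftrightarrow> j \<in> C i" "cluster_of d X k C j < k"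
    using i0 uniq assms(3) by blast+
qed

lemma clustering_explanation_iff_expl:
  fixes d X k C s
  defines "n \<equiv> length X"
  assumes valid: "valid_instance d X k C"
  shows "clustering_explanation d X k C s \<longleftrightarrow> (\<exists>W\<subseteq>{..<n}. card W \<le> s \<and>
    coloured_points.expl (input_coords d X) d (cluster_of d X k C) ({..<n} - W))"
proof -
  interpret coloured_points "input_coords d X" d n s "cluster_of d X k C" .
  have dk: "d > 0" "k > 0" using valid by (auto simp: valid_instance_def)
  have x: "input_coords d X j i = X ! j ! i" if "j \<in> {..<n} - W" "i < d" for j i W
    using that by (simp add: input_coords_def n_def)
  have sub: "cluster_of d X k C ` ({..<n} - W) \<subseteq> {..<k}" for W
    using cluster_of_iff(2)[OF valid _ dk(2)] by (auto simp: n_def)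
  have Cn: "C i \<subseteq> {..<n}" if "i < k" for i
    using valid that unfolding valid_instance_def is_clustering_def n_def by blast
  have part: "image_mset (part X ({..<n} - W)) (mset_set {..<k}) =
      image_mset (\<lambda>i. points X (C i - W)) (mset_set {..<k})" for W
  proof (intro image_mset_cong)
    fix i assume "i \<in># mset_set {..<k}"
    then have i: "i < k" by simp
    have "{j \<in> {..<n} - W. cluster_of d X k C j = i} = C i - W"
      using Cn[OF i] cluster_of_iff(1)[OF valid _ i] by (auto simp: n_def)
    then show "part X ({..<n} - W) i = points X (C i - W)" by (simp only: part_def)
  qed
  have "explainable d k (points X ({..<n} - W)) (image_mset (\<lambda>i. points X (C i - W)) (mset_set {..<k})) \<longleftrightarrow>
    expl ({..<n} - W)" for W
  proof
    assume "explainable d k (points X ({..<n} - W)) (image_mset (\<lambda>i. points X (C i - W)) (mset_set {..<k}))"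
    then show "expl ({..<n} - W)"
      by (rule expl_if_explainable[OF _ part[symmetric] _ _ sub x[of _ W]]) simp_all
  next
    assume "expl ({..<n} - W)"
    then have "explainable d (card {..<k}) (points X ({..<n} - W))
        (image_mset (part X ({..<n} - W)) (mset_set {..<k}))"
      using dk by (intro explainable_if_expl[OF _ _ _ _ sub _ x[of _ W]]) auto
    then show "explainable d k (points X ({..<n} - W)) (image_mset (\<lambda>i. points X (C i - W)) (mset_set {..<k}))"
      unfolding part by simp
  qed
  then show ?thesis unfolding clustering_explanation_def n_def by auto
qed

text \<open>\<open>K\<close> enters once for the clusters split by a box and once for those split by
  a cut, and the bounds of the boxes give \<open>n ^ (2 * d)\<close>. Of the five factors
  \<open>Z\<close>, one pays for the passes, two for the coordinate and threshold of a cut, and two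
  for quadratic scans over the points.\<close>

lemma main_time_le:
  fixes n d K Z :: nat
  assumes n: "n \<ge> 1" and d: "d \<ge> 1" and K: "K \<ge> 1" and Z: "Z = d * n"
  shows "1 + coloured_points.main_time d n K \<le> 250 * (K * K) * n ^ (2 * d) * Z ^ 5"
proof -
  have nZ: "n \<le> Z" and dZ: "d \<le> Z" and Z1: "1 \<le> Z" using n d by (simp_all add: Z)
  define N where "N = n ^ (d + d)"
  have N1: "1 \<le> N" using n by (simp add: N_def)
  \<comment> \<open>Leading monomials, increasing from \<open>p\<close> to \<open>m\<close>. Each
    intermediate time is charged to one of them, which leaves linear estimates.\<close>
  define p where "p = Z * Z"
  define q where "q = K * p"
  define u where "u = Z * (Z * q)"
  define w where "w = K * u"
  define v where "v = N * w"
  define m where "m = Z * v"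
  have mono: "a \<le> b * a" if "1 \<le> b" for a b :: nat using that by simp
  have o1: "1 \<le> p" "Z \<le> p" using Z1 by (simp_all add: p_def)
  have o2: "p \<le> q" using K by (simp add: q_def)
  have o3: "q \<le> Z * q" "Z * q \<le> u" using Z1 by (simp_all add: u_def)
  have o4: "u \<le> w" using K by (simp add: w_def)
  have o5: "w \<le> v" using N1 by (simp add: v_def)
  have o6: "v \<le> m" using Z1 by (simp add: m_def)
  have KZ: "K * Z \<le> q" using o1(2) by (simp add: q_def)
  have t1: "n * (n * 9 + 17) \<le> Z * (26 * Z)" using nZ Z1 by (intro mult_le_mono) linarith+
  have t2: "K * (n * 23 + 12) \<le> K * (35 * Z)" using nZ Z1 by (intro mult_le_mono) linarith+
  have t3: "n * (n * 9 + 17) + K * (n * 23 + 12) + 10 \<le> 71 * q"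
  proof -
    have "Z * (26 * Z) = 26 * p" "K * (35 * Z) = 35 * (K * Z)" by (simp_all add: p_def)
    then show ?thesis using t1 t2 KZ o1 o2 by linarith
  qed
  have t4: "n * (n * (n * 9 + 17) + K * (n * 23 + 12) + 10) + 4 \<le> 75 * (Z * q)"
  proof -
    have "n * (n * (n * 9 + 17) + K * (n * 23 + 12) + 10) \<le> Z * (71 * q)" by (rule mult_le_mono[OF nZ t3])
    moreover have "Z * (71 * q) = 71 * (Z * q)" by simp
    ultimately show ?thesis using o1 o2 o3 by linarith
  qed
  have t5: "cuts_time d n K \<le> 77 * u"
  proof -
    have "d * (n * (n * (n * 9 + 17) + K * (n * 23 + 12) + 10) + 4) \<le> Z * (75 * (Z * q))"
      by (rule mult_le_mono[OF dZ t4])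
    moreover have "Z * (75 * (Z * q)) = 75 * u" by (simp add: u_def)
    ultimately show ?thesis using o1 o2 o3 unfolding cuts_time_def by linarith
  qed
  have t6: "keep_time n \<le> 13 * u"
  proof -
    have "n * (n * 4 + 7) \<le> Z * (11 * Z)" using nZ Z1 by (intro mult_le_mono) linarith+
    moreover have "Z * (11 * Z) = 11 * p" by (simp add: p_def)
    ultimately show ?thesis using o1 o2 o3 unfolding keep_time_def by linarith
  qed
  have t7: "K * (n * 23 + 10 + (keep_time n + cuts_time d n K)) \<le> 123 * w"
  proof -
    have "n * 23 + 10 + (keep_time n + cuts_time d n K) \<le> 123 * u"
      using nZ Z1 t5 t6 o1 o2 o3 by linarith
    then have "K * (n * 23 + 10 + (keep_time n + cuts_time d n K)) \<le> K * (123 * u)" by (rule mult_le_mono2)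
    then show ?thesis by (simp add: w_def)
  qed
  have t8: "box_time d n K \<le> 190 * w"
  proof -
    have "(d + d) * (n * 5 + 6) \<le> (2 * Z) * (11 * Z)" using nZ dZ Z1 by (intro mult_le_mono) linarith+
    moreover have "(2 * Z) * (11 * Z) = 22 * p" by (simp add: p_def)
    moreover have "n * (d * 4 + 5) \<le> Z * (9 * Z)" using nZ dZ Z1 by (intro mult_le_mono) linarith+
    moreover have "Z * (9 * Z) = 9 * p" by (simp add: p_def)
    moreover have "n * (n * 9 + 12) \<le> Z * (21 * Z)" using nZ Z1 by (intro mult_le_mono) linarith+
    moreover have "Z * (21 * Z) = 21 * p" by (simp add: p_def)
    ultimately show ?thesis using t7 o1 o2 o3 o4 unfolding box_time_def by linarith
  qed
  have t9: "sweep_time d n K \<le> 194 * v"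
  proof -
    have "N * (box_time d n K + 2) \<le> N * (192 * w)"
      using t8 o1 o2 o3 o4 by (intro mult_le_mono2) linarith
    moreover have "N * (192 * w) = 192 * v" by (simp add: v_def)
    ultimately show ?thesis using o1 o2 o3 o4 o5 unfolding sweep_time_def N_def[symmetric] by linarith
  qed
  have t10: "n * (sweep_time d n K + 2) \<le> 196 * m"
  proof -
    have "n * (sweep_time d n K + 2) \<le> Z * (196 * v)"
      using nZ t9 o1 o2 o3 o4 o5 by (intro mult_le_mono) linarith+
    then show ?thesis by (simp add: m_def)
  qed
  have "(d + d) * (n * 3 + 5) \<le> (2 * Z) * (8 * Z)" using nZ dZ Z1 by (intro mult_le_mono) linarith+
  moreover have "(2 * Z) * (8 * Z) = 16 * p" by (simp add: p_def)
  \<comment> \<open>The summands amount to at most \<open>231 * m\<close>; 250 is a rounded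
    constant.\<close>
  ultimately have "1 + coloured_points.main_time d n K \<le> 250 * m"
    using t10 nZ o1 o2 o3 o4 o5 o6 unfolding coloured_points.main_time_def by linarith
  also have "m = (K * K) * N * Z ^ 5"
    by (simp add: m_def v_def w_def u_def q_def p_def numeral_eq_Suc mult.assoc mult.left_commute)
  finally show ?thesis by (simp add: N_def mult_2 mult.assoc)
qed

theorem theorem3p5:
  "\<exists>(prog :: com) (a :: nat) (c :: nat).
     \<forall>(d :: nat) (X :: point list) (k :: nat) (C :: nat \<Rightarrow> nat set) (s :: nat).
       valid_instance d X k C \<longrightarrow>
       (\<exists>t \<sigma>. exec (input_coords d X) prog (input_store d X k C s) t \<sigma> \<and>
              (accepting \<sigma> \<longleftrightarrow> clustering_explanation d X k C s) \<and>
              (length X \<ge> 1 \<longrightarrow>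
                 t \<le> a * 2 ^ (2 * min s k) * length X ^ (2 * d) * (d * length X) ^ c))"
proof (rule exI[of _ program], rule exI[of _ 250], rule exI[of _ 5], intro allI impI)
  fix d k s :: nat and X :: "point list" and C :: "nat \<Rightarrow> nat set"
  assume valid: "valid_instance d X k C"
  let ?x = "input_coords d X" and ?\<sigma> = "input_store d X k C s"
  let ?n = "length X" and ?cl = "cluster_of d X k C"
  let ?K = "2 ^ min s k :: nat"
  interpret coloured_points ?x d ?n s ?cl .
  have dk: "d \<ge> 1" "k > 0" using valid by (auto simp: valid_instance_def)
  have \<sigma>: "?\<sigma> ''n'' 0 = ?n" "?\<sigma> ''d'' 0 = d" "?\<sigma> ''s'' 0 = s" "?\<sigma> ''tab'' = (\<lambda>_. 0)"
    "\<forall>j<?n. ?\<sigma> ''cluster'' j = ?cl j"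
    by (simp_all add: input_store_def scalar_def cluster_of_def)
  show "\<exists>t \<sigma>. exec ?x program ?\<sigma> t \<sigma> \<and> (accepting \<sigma> \<longleftrightarrow> clustering_explanation d X k C s) \<and>
    (?n \<ge> 1 \<longrightarrow> t \<le> 250 * 2 ^ (2 * min s k) * ?n ^ (2 * d) * (d * ?n) ^ 5)"
  proof (cases "?n = 0")
    \<comment> \<open>The time bound speaks only of nonempty inputs; here the empty removal is a
      solution.\<close>
    case True
    have "expl ({..<?n} - {})" using True by (intro expl.mono) simp
    then have "clustering_explanation d X k C s"
      unfolding clustering_explanation_iff_expl[OF valid] by (intro exI[of _ "{}"]) simp
    moreover have "ok ?x program ?\<sigma> 2 (\<lambda>\<sigma>. \<sigma> ''out'' 0 > 0)"
      using True \<sigma>(1) by (simp add: program_def ok_simps)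
    ultimately show ?thesis using True unfolding ok_def accepting_def by auto
  next
    case False
    \<comment> \<open>The test in \<open>subsets\<close> limits the crossing colours to
      \<open>s\<close>, and the range of the colours limits them to \<open>k\<close>; here the
      minimum arises.\<close>
    have K: "2 ^ card (Cross U V) \<le> ?K" if "U \<subseteq> {..<?n}" "card (Cross U V) \<le> s" for U V
    proof -
      have "Cross U V \<subseteq> {..<k}"
        using that(1) cluster_of_iff(2)[OF valid _ dk(2)] by (auto simp: Cross_def)
      then have "card (Cross U V) \<le> k" by (metis card_lessThan card_mono finite_lessThan)
      then show ?thesis using that(2) by (intro power_increasing) auto
    qed
    have "ok ?x program ?\<sigma> (1 + main_time ?K)
      (\<lambda>\<tau>. \<tau> ''out'' 0 > 0 \<longleftrightarrow> (\<exists>W\<subseteq>{..<?n}. card W \<le> s \<and> expl ({..<?n} - W)))"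
      using False by (intro ok_program \<sigma> K) simp_all
    then obtain t \<tau> where t: "exec ?x program ?\<sigma> t \<tau>" "t \<le> 1 + main_time ?K"
      "\<tau> ''out'' 0 > 0 \<longleftrightarrow> clustering_explanation d X k C s"
      unfolding ok_def clustering_explanation_iff_expl[OF valid, symmetric] by (elim exE conjE) (rule that)
    have "1 + main_time ?K \<le> 250 * (?K * ?K) * ?n ^ (2 * d) * (d * ?n) ^ 5"
      using False dk(1) by (intro main_time_le) (simp_all add: Suc_le_eq)
    also have "?K * ?K = 2 ^ (2 * min s k)" by (simp only: mult_2 power_add)
    finally have "t \<le> 250 * 2 ^ (2 * min s k) * ?n ^ (2 * d) * (d * ?n) ^ 5"
      using t(2) by (rule order_trans[rotated])
    moreover have "accepting \<tau> \<longleftrightarrow> clustering_explanation d X k C s" using t(3) by (simp add: accepting_def)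
    ultimately show ?thesis using t(1) by blast
  qed
qed

end
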